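(* For every integer $n\geq 1$, the partition function $p(n)$ is represented by the convergent series $$p(n)=\sum_{k=1}^{\infty}\frac{1}{\pi\sqrt{2}}\,A_k(n)\,\sqrt{k}\;\frac{d}{dn}\left(\frac{\sinh\left\{\frac{\pi}{k}\sqrt{\frac{2}{3}\left(n-\frac{1}{24}\right)}\right\}}{\sqrt{n-\frac{1}{24}}}\right),$$ where $$A_k(n)=\sum_{\substack{1\leq h\leq k\\ (h,k)=1}}\exp\left(\pi i\, s(h,k)-\frac{2\pi i n h}{k}\right)$$ and $s(h,k)$ is the Dedekind sum.
   Context: For a positive integer $n$, $p(n)$ is the number of ways to express $n$ as a sum of positive integers (order of summands irrelevant). $(h,k)$ denotes the greatest common divisor. The Dedekind sum is defined, for an integer $h$ and an integer $k>1$, by $$s(h,k)=\sum_{r=1}^{k-1}\frac{r}{k}\left(\frac{hr}{k}-\left\lfloor\frac{hr}{k}\right\rfloor-\frac{1}{2}\right),$$ and $s(h,1)=0$ for every integer $h$. The notation $\frac{d}{dn}$ means: differentiate the displayed expression as a function of a real variable $n>\frac{1}{24}$, then evaluate the derivative at the given integer $n$ (the factor $A_k(n)$ is not differentiated). *)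

theory Defs
  imports "HOL-Analysis.Analysis" "HOL-Library.Multiset"
begin

text \<open>
  A partition of \<open>n\<close> is a finite multiset of positive integers with sum \<open>n\<close>.
\<close>

definition int_partitions :: "nat \<Rightarrow> nat multiset set" where
  "int_partitions n = {M. (\<forall>m \<in># M. 0 < m) \<and> \<Sum>\<^sub># M = n}"

definition num_partitions :: "nat \<Rightarrow> nat" where
  "num_partitions n = card (int_partitions n)"

lemma finite_int_partitions: "finite (int_partitions n)"
proof (rule finite_subset)
  let ?L = "{xs. set xs \<subseteq> {..n} \<and> length xs \<le> n}"
  show "finite (mset ` ?L)"
    by (intro finite_imageI finite_lists_length_le) simp
  show "int_partitions n \<subseteq> mset ` ?L"
  proof
    fix M assume M: "M \<in> int_partitions n"
    obtain xs where xs: "mset xs = M"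
      using ex_mset by blast
    have pos: "\<forall>x \<in> set xs. 0 < x" and sum: "sum_list xs = n"
      using M unfolding int_partitions_def xs [symmetric] by (auto simp: sum_mset_sum_list)
    have "length ys \<le> sum_list ys" if "\<forall>y \<in> set ys. 0 < y" for ys :: "nat list"
      using that by (induction ys) auto
    with pos sum have "length xs \<le> n"
      by blast
    moreover have "set xs \<subseteq> {..n}"
      using sum member_le_sum_list by fastforce
    ultimately show "M \<in> mset ` ?L"
      using xs by blast
  qed
qed

text \<open>For \<open>k = 1\<close> the sum is empty, which gives the convention \<open>s(h,1) = 0\<close>.\<close>

definition dedekind_sum :: "int \<Rightarrow> nat \<Rightarrow> real" where
  "dedekind_sum h k =
     (\<Sum>r = 1..<k. real r / real k *
        (of_int h * real r / real k - of_int \<lfloor>of_int h * real r / real k\<rfloor> - 1 / 2))"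

definition A_sum :: "nat \<Rightarrow> nat \<Rightarrow> complex" where
  "A_sum k n =
     (\<Sum>h \<in> {h. 1 \<le> h \<and> h \<le> k \<and> coprime h k}.
        exp (of_real pi * \<i> * of_real (dedekind_sum (int h) k)
             - 2 * of_real pi * \<i> * of_nat n * of_nat h / of_nat k))"

end

theory Submission
  imports Defs "HOL-Complex_Analysis.Complex_Analysis" "HOL-Probability.Probability"
    "HOL-Number_Theory.Number_Theory"
begin

text \<open>
  Write \<open>F(q) = \<Sum> p(n) q\<^sup>n = \<Prod> 1 / (1 - q\<^sup>m)\<close> for \<open>|q| < 1\<close>.  The number \<open>p(n)\<close> is the integral
  of \<open>F(e\<^bsup>2\<pi>i\<tau>\<^esup>) e\<^bsup>-2\<pi>in\<tau>\<^esup>\<close> along any path from \<open>\<tau>\<^sub>0\<close> to \<open>\<tau>\<^sub>0 + 1\<close> in the upper half-plane.  Near a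
  rational \<open>h/k\<close> the function \<open>F\<close> grows like an explicit elementary function, because \<open>F\<close> is
  essentially \<open>1/\<eta>\<close>.  Rademacher's path runs along the Ford circles of the Farey fractions of order
  \<open>N\<close>; on each circle \<open>F\<close> is replaced by its elementary main term, and the arc by the complete circle.
  The total error is \<open>O(N\<^bsup>-1/2\<^esup>)\<close>, and each complete circle contributes one term of the series.

  The behaviour near \<open>h/k\<close> (\<open>partition_gf_modular\<close>) comes from two facts.  The inversion
  \<open>\<tau> \<mapsto> -1/\<tau>\<close> is treated on the imaginary axis: by the partial fractions of \<open>coth\<close>, the logarithm of
  \<open>F(e\<^bsup>-2\<pi>t\<^esup>)\<close> is, up to elementary terms, a double series with summand \<open>t / (j\<^sup>2t\<^sup>2 + n\<^sup>2)\<close>, which is invariant under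
  \<open>t \<mapsto> 1/t\<close> together with the exchange of \<open>j\<close> and \<open>n\<close>.  The series converges conditionally only, and
  truncating it at a \<open>Q M \<times> P M\<close> rectangle for \<open>t = P/Q\<close> makes the two tails cancel in the limit
  (\<open>double_sum_asymmetry\<close>); the identity theorem then covers the half-plane.  For general \<open>h/k\<close> the
  inversion lowers the denominator as in Euclid's algorithm, and the root of unity
  \<open>e\<^bsup>\<pi>is(h,k)\<^esup>\<close> is propagated by the reciprocity law \<open>dedekind_reciprocity\<close>.

  The path never has to be parametrised.  The integrand has a primitive \<open>\<Phi>\<close> with
  \<open>\<Phi>(\<tau> + 1) - \<Phi>(\<tau>) = p(n)\<close> (\<open>gf_coeff_primitive\<close>), and the differences of \<open>\<Phi>\<close> between the points at
  which consecutive Ford circles touch telescope (\<open>farey_dissection\<close>).  In the coordinate \<open>y\<close> given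
  by \<open>\<tau> = h/k + i / (k\<^sup>2y\<^sup>2)\<close> the arc at \<open>h/k\<close> joins two points on the curve \<open>Re y\<^sup>2 = 1\<close>, and up to the
  constant \<open>-i e\<^bsup>\<pi>is(h,k)-2\<pi>inh/k\<^esup> k\<^bsup>-5/2\<^esup>\<close> the integrand becomes
  \<open>2 y\<^bsup>-4\<^esup> exp(a y\<^sup>2 + b/y\<^sup>2) F(q')\<close> with \<open>a = \<pi>/12\<close>, \<open>b = 2\<pi>(n - 1/24)/k\<^sup>2\<close> and
  \<open>|q'| = exp(-2\<pi> Re y\<^sup>2)\<close>.  The part with \<open>F(q') - 1\<close> decays to the right, so its path is pushed to
  \<open>Re y = \<infinity>\<close> (\<open>remainder_estimate\<close>).  The part with \<open>1\<close> is holomorphic for \<open>Re y > 0\<close>, so its path is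
  moved to the line \<open>Re y = 1\<close> and completed (\<open>horizontal_estimate\<close>, \<open>vertical_estimate\<close>).  On that
  line the integrals of \<open>y\<^bsup>-m\<^esup> exp(a y\<^sup>2)\<close> with even \<open>m\<close> reduce to a Gaussian one, and expanding
  \<open>exp(b/y\<^sup>2)\<close> yields, up to a constant factor, the derivative of \<open>sinh(2\<surd>(ab)) / \<surd>b\<close> with respect to \<open>b\<close> (\<open>bessel_integral_derivative\<close>).
\<close>

section \<open>Generating function of the partition numbers\<close>

definition partitions_upto :: "nat \<Rightarrow> nat \<Rightarrow> nat multiset set" where
  "partitions_upto m n = {M \<in> int_partitions n. \<forall>x\<in>#M. x \<le> m}"

lemma finite_partitions_upto [simp]: "finite (partitions_upto m n)"
  unfolding partitions_upto_def by (rule finite_subset[OF _ finite_int_partitions[of n]]) auto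

lemma partitions_upto_0: "partitions_upto 0 n = (if n = 0 then {{#}} else {})"
proof -
  have "M = {#}" if "\<forall>m\<in>#M. 0 < m" "\<forall>x\<in>#M. x \<le> 0" for M :: "nat multiset"
    using that by (metis multiset_nonemptyE not_le)
  hence "M \<in> partitions_upto 0 n \<longleftrightarrow> n = 0 \<and> M = {#}" for M
    unfolding partitions_upto_def int_partitions_def by fastforce
  thus ?thesis by (auto split: if_splits)
qed

text \<open>
  A partition with parts at most \<open>m + 1\<close> either avoids the part \<open>m + 1\<close> or arises from a smaller
  one by adding one copy of that part.
\<close>
lemma card_partitions_upto_Suc:
  "card (partitions_upto (Suc m) n) =
     card (partitions_upto m n) + (if Suc m \<le> n then card (partitions_upto (Suc m) (n - Suc m)) else 0)"
proof -
  let ?B = "if Suc m \<le> n then add_mset (Suc m) ` partitions_upto (Suc m) (n - Suc m) else {}"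
  have eq: "partitions_upto (Suc m) n = partitions_upto m n \<union> ?B"
  proof (intro equalityI subsetI)
    fix M assume M: "M \<in> partitions_upto (Suc m) n"
    show "M \<in> partitions_upto m n \<union> ?B"
    proof (cases "Suc m \<in># M")
      case False
      hence "\<forall>x\<in>#M. x \<le> m" using M unfolding partitions_upto_def
        by (metis (mono_tags, lifting) le_SucE mem_Collect_eq)
      thus ?thesis using M by (auto simp: partitions_upto_def)
    next
      case True
      then obtain M' where M': "M = add_mset (Suc m) M'" by (metis mset_add)
      have "Suc m \<le> n" "M' \<in> partitions_upto (Suc m) (n - Suc m)"
        using M unfolding M' by (auto simp: partitions_upto_def int_partitions_def)
      thus ?thesis using M' by auto
    qed
  next
    fix M assume "M \<in> partitions_upto m n \<union> ?B"
    thus "M \<in> partitions_upto (Suc m) n"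
      by (auto simp: partitions_upto_def int_partitions_def split: if_splits intro: le_SucI)
  qed
  have disj: "partitions_upto m n \<inter> ?B = {}"
    by (auto simp: partitions_upto_def)
  have "card ?B = (if Suc m \<le> n then card (partitions_upto (Suc m) (n - Suc m)) else 0)"
    by (auto intro!: card_image inj_onI)
  thus ?thesis unfolding eq by (subst card_Un_disjoint) (use disj in auto)
qed

lemma partitions_upto_eq: "n \<le> m \<Longrightarrow> partitions_upto m n = int_partitions n"
proof -
  assume "n \<le> m"
  moreover have "x \<le> \<Sum>\<^sub># M" if "x \<in># M" for x and M :: "nat multiset"
    using that by (metis le_add1 mset_add sum_mset.add_mset)
  ultimately show ?thesis by (fastforce simp: partitions_upto_def int_partitions_def)
qed

lemma card_partitions_upto_le: "card (partitions_upto m n) \<le> num_partitions n"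
  unfolding num_partitions_def
  by (rule card_mono) (auto simp: finite_int_partitions partitions_upto_def)

text \<open>
  The recursion over the largest part multiplies the series by \<open>1 / (1 - r\<^bsup>m+1\<^esup>)\<close>.  The same
  recursion bounds every partial sum of the new series by itself times \<open>r\<^bsup>m+1\<^esup>\<close> plus the old sum, which
  is where convergence comes from.
\<close>
lemma partitions_upto_sums:
  fixes r :: real assumes r: "0 \<le> r" "r < 1"
  shows "(\<lambda>n. real (card (partitions_upto m n)) * r ^ n) sums (\<Prod>j=1..m. 1 / (1 - r ^ j))"
proof (induction m)
  case 0
  have "(\<lambda>n. if n = 0 then (1::real) else 0) sums 1"
    using sums_single[of 0 "\<lambda>_. 1::real"] by simp
  also have "(\<lambda>n. if n = 0 then (1::real) else 0) = (\<lambda>n. real (card (partitions_upto 0 n)) * r ^ n)"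
    by (auto simp: partitions_upto_0 fun_eq_iff)
  finally show ?case by simp
next
  case (Suc m)
  let ?a = "\<lambda>n. real (card (partitions_upto m n)) * r ^ n"
  let ?b = "\<lambda>n. real (card (partitions_upto (Suc m) n)) * r ^ n"
  let ?b' = "\<lambda>n. if Suc m \<le> n then r ^ Suc m * ?b (n - Suc m) else 0"
  let ?A = "\<Prod>j=1..m. 1 / (1 - r ^ j)"
  have rm: "r ^ Suc m < 1" using r by (metis power_Suc_less_one power_0 power_strict_decreasing zero_less_Suc less_eq_real_def power_0_Suc zero_less_one)
  have rec: "?b n = ?a n + ?b' n" for n
  proof -
    have "Suc m \<le> n \<Longrightarrow> r ^ n = r ^ Suc m * r ^ (n - Suc m)"
      by (metis le_add_diff_inverse power_add)
    thus ?thesis by (subst card_partitions_upto_Suc) (auto simp: algebra_simps)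
  qed
  have bnn: "?b n \<ge> 0" "?a n \<ge> 0" for n using r by auto
  have sb': "(\<Sum>n<N. ?b' n) \<le> r ^ Suc m * (\<Sum>n<N. ?b n)" for N
  proof (cases "N \<le> Suc m")
    case True
    hence "(\<Sum>n<N. ?b' n) = 0" by (intro sum.neutral) auto
    thus ?thesis using r bnn by (simp add: sum_nonneg)
  next
    case False
    have "(\<Sum>n<N. ?b' n) = (\<Sum>n\<in>{Suc m..<N}. r ^ Suc m * ?b (n - Suc m))"
      by (intro sum.mono_neutral_cong_right) auto
    also have "\<dots> = (\<Sum>n<N - Suc m. r ^ Suc m * ?b n)"
      by (rule sum.reindex_bij_witness[of _ "\<lambda>n. n + Suc m" "\<lambda>n. n - Suc m"]) auto
    also have "\<dots> = r ^ Suc m * (\<Sum>n<N - Suc m. ?b n)" by (simp only: sum_distrib_left)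
    also have "\<dots> \<le> r ^ Suc m * (\<Sum>n<N. ?b n)"
      using r bnn by (intro mult_left_mono sum_mono2) auto
    finally show ?thesis .
  qed
  have bound: "(\<Sum>n<N. ?b n) \<le> ?A / (1 - r ^ Suc m)" for N
  proof -
    have "(\<Sum>n<N. ?b n) = (\<Sum>n<N. ?a n) + (\<Sum>n<N. ?b' n)"
      unfolding sum.distrib[symmetric] using rec by (intro sum.cong) auto
    also have "\<dots> \<le> ?A + r ^ Suc m * (\<Sum>n<N. ?b n)"
      using sb'[of N] sum_le_suminf[OF sums_summable[OF Suc], of "{..<N}"] bnn sums_unique[OF Suc]
      by (intro add_mono) auto
    finally have "(1 - r ^ Suc m) * (\<Sum>n<N. ?b n) \<le> ?A" by (simp add: algebra_simps)
    thus ?thesis using rm by (simp add: pos_le_divide_eq mult.commute)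
  qed
  have summ: "summable ?b" 
    by (rule summableI_nonneg_bounded[of _ "?A / (1 - r ^ Suc m)"]) (use bnn bound in auto)
  have "(\<lambda>n. ?b' (n + Suc m)) sums (r ^ Suc m * suminf ?b)"
    using sums_mult[OF summable_sums[OF summ], of "r ^ Suc m"] by simp
  hence "?b' sums (r ^ Suc m * suminf ?b + (\<Sum>n<Suc m. ?b' n))"
    by (subst (asm) sums_iff_shift) simp
  hence "?b' sums (r ^ Suc m * suminf ?b)" by simp
  from sums_add[OF Suc this] have "?b sums (?A + r ^ Suc m * suminf ?b)"
    using rec by (simp add: fun_eq_iff cong: sums_cong)
  hence "suminf ?b = ?A + r ^ Suc m * suminf ?b" by (simp add: sums_iff)
  hence "suminf ?b = ?A / (1 - r ^ Suc m)" using rm by (simp add: field_simps)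
  thus ?case using summable_sums[OF summ] by simp
qed

text \<open>
  The logarithm of \<open>\<Prod> 1 / (1 - r\<^sup>m)\<close>: expanding \<open>- ln (1 - r\<^sup>m) = \<Sum> r\<^bsup>mj\<^esup> / j\<close> and summing the
  geometric series over \<open>m\<close> leaves this Lambert series.
\<close>
definition partition_log :: "real \<Rightarrow> real" where
  "partition_log r = (\<Sum>j. r ^ Suc j / (real (Suc j) * (1 - r ^ Suc j)))"

lemma partition_log_summable:
  fixes r :: real assumes r: "0 \<le> r" "r < 1"
  shows "summable (\<lambda>j. r ^ Suc j / (real (Suc j) * (1 - r ^ Suc j)))"
proof (rule summable_comparison_test)
  show "summable (\<lambda>j. r ^ Suc j * (1 / (1 - r)))"
    using r by (intro summable_mult2 summable_Suc_iff[THEN iffD2] summable_geometric) auto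
  show "\<exists>N. \<forall>n\<ge>N. norm (r ^ Suc n / (real (Suc n) * (1 - r ^ Suc n))) \<le> r ^ Suc n * (1 / (1 - r))"
  proof (intro exI allI impI)
    fix n
    have le: "r ^ Suc n \<le> r" using r by (simp add: mult_left_le power_le_one)
    have "1 * (1 - r) \<le> real (Suc n) * (1 - r ^ Suc n)"
      using le r by (intro mult_mono) auto
    hence "r ^ Suc n / (real (Suc n) * (1 - r ^ Suc n)) \<le> r ^ Suc n / (1 - r)"
      using r by (intro divide_left_mono mult_pos_pos) (use le in auto)
    thus "norm (r ^ Suc n / (real (Suc n) * (1 - r ^ Suc n))) \<le> r ^ Suc n * (1 / (1 - r))"
      using r le by (simp add: abs_of_nonneg)
  qed
qed

text \<open>
  All terms of the double series are nonnegative, and the finite products sum it over finitely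
  many \<open>m\<close>; dominated convergence (Tannery) passes to the limit inside the sum over \<open>j\<close>.
\<close>
lemma ln_prod_tendsto_partition_log:
  fixes r :: real assumes r: "0 \<le> r" "r < 1"
  shows "(\<lambda>m. \<Prod>j=1..m. 1 / (1 - r ^ j)) \<longlonglongrightarrow> exp (partition_log r)"
proof -
  have rj: "0 \<le> r ^ Suc j" "r ^ Suc j < 1" for j
    using r power_Suc_less_one[of r j] by (auto simp: less_eq_real_def)
  have ln1: "(\<lambda>n. x ^ Suc n / real (Suc n)) sums ln (1 / (1 - x))" if "0 \<le> x" "x < 1" for x :: real
  proof -
    from sums_minus[OF ln_series'[of "-x"]] have "(\<lambda>n. x ^ n / real n) sums (- ln (1 - x))" using that by simp
    hence "(\<lambda>n. x ^ Suc n / real (Suc n)) sums (- ln (1 - x))"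
      by (subst sums_Suc_iff) simp
    thus ?thesis using that by (simp add: ln_div)
  qed
  have geo: "(\<lambda>i. x ^ Suc i) sums (x / (1 - x))" if "0 \<le> x" "x < 1" for x :: real
    using sums_mult[OF geometric_sums[of x], of x] that by simp
  have fin: "(\<Prod>j=1..m. 1 / (1 - r ^ j)) = exp (\<Sum>i. (\<Sum>j<m. (r ^ Suc j) ^ Suc i / real (Suc i)))" for m
  proof -
    have "(\<Sum>i. (\<Sum>j<m. (r ^ Suc j) ^ Suc i / real (Suc i))) = (\<Sum>j<m. ln (1 / (1 - r ^ Suc j)))"
      by (rule sums_unique[symmetric], rule sums_sum) (use ln1 rj in auto)
    also have "exp \<dots> = (\<Prod>j<m. 1 / (1 - r ^ Suc j))"
      using rj by (simp add: exp_sum)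
    also have "\<dots> = (\<Prod>j=1..m. 1 / (1 - r ^ j))"
      by (rule prod.reindex_bij_witness[of _ "\<lambda>j. j - 1" Suc]) auto
    finally show ?thesis by simp
  qed
  define g where "g = (\<lambda>i. r ^ Suc i / (real (Suc i) * (1 - r ^ Suc i)))"
  have inner: "(\<lambda>m. \<Sum>j<m. (r ^ Suc j) ^ Suc i / real (Suc i)) \<longlonglongrightarrow> g i" for i
  proof -
    have "(\<lambda>j. (r ^ Suc i) ^ Suc j / real (Suc i)) sums (r ^ Suc i / (1 - r ^ Suc i) / real (Suc i))"
      by (intro sums_divide geo rj)
    also have "(\<lambda>j. (r ^ Suc i) ^ Suc j / real (Suc i)) = (\<lambda>j. (r ^ Suc j) ^ Suc i / real (Suc i))"
      by (simp only: power_mult[symmetric] mult.commute)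
    finally show ?thesis by (simp add: sums_def g_def mult.commute)
  qed
  have le: "(\<Sum>j<m. (r ^ Suc j) ^ Suc i / real (Suc i)) \<le> g i" for m i
  proof (rule incseq_le[OF _ inner])
    show "incseq (\<lambda>m. \<Sum>j<m. (r ^ Suc j) ^ Suc i / real (Suc i))"
      using rj by (intro incseq_SucI) (simp add: zero_le_power del: power_Suc)
  qed
  have gs: "summable g" unfolding g_def by (rule partition_log_summable[OF r])
  have "(\<lambda>m. \<Sum>i. (\<Sum>j<m. (r ^ Suc j) ^ Suc i / real (Suc i))) \<longlonglongrightarrow> suminf g"
  proof (rule tannerys_theorem[where M = g, THEN conjunct2, THEN conjunct2])
    show "\<forall>\<^sub>F (i, m) in at_top \<times>\<^sub>F sequentially. norm (\<Sum>j<m. (r ^ Suc j) ^ Suc i / real (Suc i)) \<le> g i"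
    proof (rule always_eventually, clarify)
      fix i m
      have "(\<Sum>j<m. (r ^ Suc j) ^ Suc i / real (Suc i)) \<ge> 0" using rj by (intro sum_nonneg) (simp del: power_Suc)
      thus "norm (\<Sum>j<m. (r ^ Suc j) ^ Suc i / real (Suc i)) \<le> g i" using le[of i m] by simp
    qed
  qed (use inner gs in auto)
  thus ?thesis unfolding fin partition_log_def g_def[symmetric] by (intro tendsto_intros)
qed

text \<open>
  The counts with parts at most \<open>m\<close> agree with \<open>p(n)\<close> for \<open>n \<le> m\<close> and never exceed it, so
  the partial sums of \<open>\<Sum> p(n) r\<^sup>n\<close> and the finite products bound each other.
\<close>
theorem num_partitions_sums:
  fixes r :: real assumes r: "0 \<le> r" "r < 1"
  shows "(\<lambda>n. real (num_partitions n) * r ^ n) sums exp (partition_log r)"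
proof -
  let ?P = "\<lambda>m. \<Prod>j=1..m. 1 / (1 - r ^ j)"
  let ?p = "\<lambda>n. real (num_partitions n) * r ^ n"
  note lim = ln_prod_tendsto_partition_log[OF r]
  have nn: "?p n \<ge> 0" for n using r by auto
  have Pm: "incseq ?P"
  proof (rule incseq_SucI)
    fix m
    have "r ^ Suc m < 1" using r power_Suc_less_one[of r m] by (auto simp: less_eq_real_def)
    moreover have "r ^ j \<le> 1" for j using r by (simp add: power_le_one)
    ultimately show "?P m \<le> ?P (Suc m)"
      using r by (simp add: mult_right_le_one_le prod_nonneg field_simps mult_left_le) 
  qed
  have up: "(\<Sum>n<N. ?p n) \<le> exp (partition_log r)" for N
  proof -
    have "(\<Sum>n<N. ?p n) = (\<Sum>n<N. real (card (partitions_upto N n)) * r ^ n)"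
      by (intro sum.cong) (auto simp: partitions_upto_eq num_partitions_def)
    also have "\<dots> \<le> ?P N"
      using sum_le_suminf[OF sums_summable[OF partitions_upto_sums[OF r]], of "{..<N}" N] r
        sums_unique[OF partitions_upto_sums[OF r, of N]] by simp
    also have "\<dots> \<le> exp (partition_log r)" by (rule incseq_le[OF Pm lim])
    finally show ?thesis .
  qed
  have summ: "summable ?p"
    by (rule summableI_nonneg_bounded[of _ "exp (partition_log r)"]) (use nn up in auto)
  have "suminf ?p \<le> exp (partition_log r)"
    by (rule suminf_le_const[OF summ]) (use up in auto)
  moreover have "?P m \<le> suminf ?p" for m
    unfolding sums_unique[OF partitions_upto_sums[OF r, of m]]
    by (rule suminf_le[OF _ sums_summable[OF partitions_upto_sums[OF r]] summ])
       (use r card_partitions_upto_le in \<open>auto intro!: mult_right_mono\<close>)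
  hence "exp (partition_log r) \<le> suminf ?p" by (intro LIMSEQ_le_const2[OF lim]) auto
  ultimately show ?thesis using summable_sums[OF summ] by simp
qed

definition partition_gf :: "complex \<Rightarrow> complex" where
  "partition_gf q = (\<Sum>n. of_nat (num_partitions n) * q ^ n)"

lemma partition_gf_norm_summable:
  assumes "norm (q::complex) < 1"
  shows "summable (\<lambda>n. norm (of_nat (num_partitions n) * q ^ n))"
  using num_partitions_sums[of "norm q"] assms by (simp add: sums_iff norm_mult norm_power)

lemma partition_gf_sums:
  assumes "norm (q::complex) < 1"
  shows "(\<lambda>n. of_nat (num_partitions n) * q ^ n) sums partition_gf q"
  unfolding partition_gf_def
  by (rule summable_sums, rule summable_norm_cancel, rule partition_gf_norm_summable[OF assms])

lemma partition_gf_holomorphic: "partition_gf holomorphic_on ball 0 1"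
proof (rule power_series_holomorphic)
  fix w :: complex assume "w \<in> ball 0 1"
  thus "(\<lambda>n. of_nat (num_partitions n) * (w - 0) ^ n) sums partition_gf w"
    using partition_gf_sums[of w] by simp
qed

lemma partition_gf_holomorphic_comp:
  assumes "f holomorphic_on S" "\<And>z. z \<in> S \<Longrightarrow> norm (f z) < 1"
  shows "(\<lambda>z. partition_gf (f z)) holomorphic_on S"
  using holomorphic_on_compose_gen[OF assms(1) partition_gf_holomorphic] assms(2)
  by (auto simp: o_def image_subset_iff)

lemma partition_gf_of_real:
  assumes "0 \<le> r" "r < 1"
  shows "partition_gf (of_real r) = of_real (exp (partition_log r))"
proof -
  have "(\<lambda>n. complex_of_real (real (num_partitions n) * r ^ n)) sums of_real (exp (partition_log r))"
    by (intro sums_of_real num_partitions_sums assms)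
  hence "(\<lambda>n. of_nat (num_partitions n) * complex_of_real r ^ n) sums of_real (exp (partition_log r))"
    by simp
  thus ?thesis unfolding partition_gf_def by (rule sums_unique[symmetric])
qed

lemma num_partitions_0: "num_partitions 0 = 1"
proof -
  have "int_partitions 0 = {{#}}" using partitions_upto_eq[of 0 0] partitions_upto_0[of 0] by simp
  thus ?thesis by (simp add: num_partitions_def)
qed

text \<open>
  On the Ford circles, and to the right of them in the coordinate \<open>y\<close>, the transformed variable
  has modulus at most \<open>e\<^bsup>-2\<pi>\<^esup>\<close>, so a linear bound for
  \<open>F - 1\<close> on this disc controls the remainder uniformly in \<open>h/k\<close>.
\<close>
lemma partition_gf_minus_1_bound:
  obtains C where "C > 0" "\<And>q. norm q \<le> exp (- 2 * pi) \<Longrightarrow> norm (partition_gf q - 1) \<le> C * norm q"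
proof -
  let ?r = "exp (- 2 * pi)"
  have r: "0 < ?r" "?r < 1" by auto
  let ?p = "\<lambda>n. real (num_partitions (Suc n))"
  have "summable (\<lambda>n. real (num_partitions n) * ?r ^ n)"
    using num_partitions_sums[of ?r] r by (simp add: sums_iff)
  hence "summable (\<lambda>n. ?p n * ?r ^ Suc n)" by (subst summable_Suc_iff)
  from summable_mult[OF this, of "1 / ?r"] have S: "summable (\<lambda>n. ?p n * ?r ^ n)" by simp
  show ?thesis
  proof (rule that[of "suminf (\<lambda>n. ?p n * ?r ^ n) + 1"])
    show "suminf (\<lambda>n. ?p n * ?r ^ n) + 1 > 0"
      by (intro add_nonneg_pos suminf_nonneg S) auto
    fix q :: complex assume q: "norm q \<le> ?r"
    hence q1: "norm q < 1" using r by linarith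
    have "(\<lambda>n. of_nat (num_partitions (Suc n)) * q ^ Suc n) sums (partition_gf q - 1)"
      using partition_gf_sums[OF q1] by (subst sums_Suc_iff) (simp add: num_partitions_0)
    hence eq: "partition_gf q - 1 = (\<Sum>n. of_nat (num_partitions (Suc n)) * q ^ Suc n)"
      by (rule sums_unique)
    have le: "norm (of_nat (num_partitions (Suc n)) * q ^ Suc n) \<le> norm q * (?p n * ?r ^ n)" for n
    proof -
      have "norm q ^ n \<le> ?r ^ n" using q by (intro power_mono) auto
      hence "norm q * (?p n * norm q ^ n) \<le> norm q * (?p n * ?r ^ n)"
        by (intro mult_left_mono) auto
      thus ?thesis by (simp add: norm_mult norm_power mult_ac del: of_nat_Suc)
    qed
    have "norm (partition_gf q - 1) \<le> (\<Sum>n. norm q * (?p n * ?r ^ n))"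
      unfolding eq by (rule norm_suminf_le[OF le summable_mult[OF S]])
    also have "\<dots> = norm q * (\<Sum>n. ?p n * ?r ^ n)" by (rule suminf_mult[OF S])
    also have "\<dots> \<le> (suminf (\<lambda>n. ?p n * ?r ^ n) + 1) * norm q" by (simp add: algebra_simps)
    finally show "norm (partition_gf q - 1) \<le> (suminf (\<lambda>n. ?p n * ?r ^ n) + 1) * norm q" .
  qed
qed

section \<open>Partial fractions of the hyperbolic cotangent\<close>

lemma sinh_product_formula:
  fixes x :: real
  shows "(\<lambda>n. pi * x * (\<Prod>k=1..n. 1 + x\<^sup>2 / (real k)\<^sup>2)) \<longlonglongrightarrow> sinh (pi * x)"
proof -
  have "(\<lambda>n. of_real pi * (\<i> * of_real x) * (\<Prod>k=1..n. 1 - (\<i> * of_real x)\<^sup>2 / (of_nat k)\<^sup>2))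
           \<longlonglongrightarrow> sin (of_real pi * (\<i> * complex_of_real x))"
    by (rule sin_product_formula_complex)
  also have "(\<lambda>n. of_real pi * (\<i> * of_real x) * (\<Prod>k=1..n. 1 - (\<i> * of_real x)\<^sup>2 / (of_nat k)\<^sup>2))
      = (\<lambda>n. \<i> * complex_of_real (pi * x * (\<Prod>k=1..n. 1 + x\<^sup>2 / (real k)\<^sup>2)))"
    by (simp add: power_mult_distrib mult_ac)
  also have "sin (of_real pi * (\<i> * complex_of_real x)) = \<i> * complex_of_real (sinh (pi * x))"
    by (simp add: sinh_field_def sin_exp_eq exp_of_real[symmetric] field_simps)
  finally have "(\<lambda>n. Im (\<i> * complex_of_real (pi * x * (\<Prod>k=1..n. 1 + x\<^sup>2 / (real k)\<^sup>2))))
      \<longlonglongrightarrow> Im (\<i> * complex_of_real (sinh (pi * x)))" by (rule tendsto_Im)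
  thus ?thesis by (simp only: Im_i_times Re_complex_of_real)
qed

lemma ln_one_plus_summable:
  fixes x :: real
  shows "summable (\<lambda>k. ln (1 + x\<^sup>2 / (real (Suc k))\<^sup>2))"
proof (rule summable_comparison_test)
  show "summable (\<lambda>k. x\<^sup>2 * (1 / (real (Suc k))\<^sup>2))"
    using inverse_squares_sums by (intro summable_mult) (simp add: sums_iff)
  show "\<exists>N. \<forall>n\<ge>N. norm (ln (1 + x\<^sup>2 / (real (Suc n))\<^sup>2)) \<le> x\<^sup>2 * (1 / (real (Suc n))\<^sup>2)"
    by (auto intro!: ln_add_one_self_le_self)
qed

text \<open>
  The logarithmic derivative of the product for \<open>sinh\<close>, where \<open>1 / (e\<^bsup>2\<pi>x\<^esup> - 1) = (coth (\<pi>x) - 1) / 2\<close>.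
\<close>
lemma coth_partial_fractions:
  fixes x :: real assumes x: "x > 0"
  shows "(\<lambda>n. x / (x\<^sup>2 + (real (Suc n))\<^sup>2)) sums (pi * (1 / (exp (2 * pi * x) - 1) - 1 / (2 * pi * x) + 1 / 2))"
proof -
  define f where "f = (\<lambda>n (y::real). ln (1 + y\<^sup>2 / (real (Suc n))\<^sup>2))"
  define f' where "f' = (\<lambda>n (y::real). 2 * y / (y\<^sup>2 + (real (Suc n))\<^sup>2))"
  have "(\<lambda>y. \<Sum>n. f n y) y = ln (sinh (pi * y) / (pi * y))" if "y > 0" for y
  proof -
    have "(\<lambda>n. ln (pi * y * (\<Prod>k=1..n. 1 + y\<^sup>2 / (real k)\<^sup>2) / (pi * y))) \<longlonglongrightarrow> ln (sinh (pi * y) / (pi * y))"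
      using that by (intro tendsto_intros sinh_product_formula) auto
    also have "(\<lambda>n. ln (pi * y * (\<Prod>k=1..n. 1 + y\<^sup>2 / (real k)\<^sup>2) / (pi * y))) = (\<lambda>n. \<Sum>k<n. f k y)"
    proof
      fix n
      have pos: "1 + y\<^sup>2 / (real k)\<^sup>2 > 0" for k by (simp add: add_pos_nonneg)
      have "ln (pi * y * (\<Prod>k=1..n. 1 + y\<^sup>2 / (real k)\<^sup>2) / (pi * y)) = (\<Sum>k=1..n. ln (1 + y\<^sup>2 / (real k)\<^sup>2))"
        using that pos by (subst ln_prod[symmetric]) (auto simp: pos[THEN less_imp_neq, symmetric])
      also have "\<dots> = (\<Sum>k<n. f k y)" unfolding f_def
        by (rule sum.reindex_bij_witness[of _ Suc "\<lambda>j. j - 1"]) auto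
      finally show "ln (pi * y * (\<Prod>k=1..n. 1 + y\<^sup>2 / (real k)\<^sup>2) / (pi * y)) = (\<Sum>k<n. f k y)" .
    qed
    finally have "(\<lambda>n. f n y) sums ln (sinh (pi * y) / (pi * y))" by (simp only: sums_def)
    thus ?thesis by (simp add: sums_iff)
  qed
  note fsum = this
  have f'_bound: "norm (f' n y) \<le> 2 * (2 * x) * (1 / (real (Suc n))\<^sup>2)" if "y \<in> {0<..<2*x}" for n y
  proof -
    have "2 * y / (y\<^sup>2 + (real (Suc n))\<^sup>2) \<le> 2 * (2 * x) / ((real (Suc n))\<^sup>2)"
      using that by (intro frac_le) auto
    thus ?thesis using that by (simp add: f'_def abs_of_nonneg)
  qed
  have "((\<lambda>y. \<Sum>n. f n y) has_field_derivative (\<Sum>n. f' n x)) (at x)"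
  proof (rule has_field_derivative_series'(2)[where S = "{0<..<2*x}" and x0 = x])
    show "(f n has_field_derivative f' n y) (at y within {0<..<2 * x})" if "y \<in> {0<..<2*x}" for n y
    proof -
      have "1 + y\<^sup>2 / (real (Suc n))\<^sup>2 > 0" by (simp add: add_pos_nonneg)
      thus ?thesis unfolding f_def f'_def
        by (auto intro!: derivative_eq_intros simp: divide_simps power2_eq_square)
    qed
    show "uniformly_convergent_on {0<..<2 * x} (\<lambda>n y. \<Sum>i<n. f' i y)"
    proof (rule Weierstrass_m_test')
      show "summable (\<lambda>n. 2 * (2 * x) * (1 / (real (Suc n))\<^sup>2))"
        using inverse_squares_sums by (intro summable_mult) (simp add: sums_iff)
    qed (use f'_bound in auto)
    show "summable (\<lambda>n. f n x)" unfolding f_def by (rule ln_one_plus_summable)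
  qed (use x in auto)
  moreover have "eventually (\<lambda>y. y > 0) (nhds x)"
    using x eventually_nhds_in_open[of "{0<..}" x] by auto
  hence "eventually (\<lambda>y. (\<Sum>n. f n y) = ln (sinh (pi * y) / (pi * y))) (nhds x)"
    by eventually_elim (rule fsum)
  ultimately have D1: "((\<lambda>y. ln (sinh (pi * y) / (pi * y))) has_field_derivative (\<Sum>n. f' n x)) (at x)"
    by (subst (asm) DERIV_cong_ev[OF refl _ refl])
  have sp: "sinh (pi * x) > 0" using x by simp
  have D2: "((\<lambda>y. ln (sinh (pi * y) / (pi * y))) has_field_derivative
         (pi * cosh (pi * x) / sinh (pi * x) - 1 / x)) (at x)"
    using x sp by (auto intro!: derivative_eq_intros simp: field_simps)
  have "summable (\<lambda>n. f' n x)"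
  proof (rule summable_comparison_test)
    show "summable (\<lambda>n. 2 * (2 * x) * (1 / (real (Suc n))\<^sup>2))"
      using inverse_squares_sums by (intro summable_mult) (simp add: sums_iff)
    show "\<exists>N. \<forall>n\<ge>N. norm (f' n x) \<le> 2 * (2 * x) * (1 / (real (Suc n))\<^sup>2)"
      using f'_bound x by auto
  qed
  hence "(\<lambda>n. f' n x) sums (pi * cosh (pi * x) / sinh (pi * x) - 1 / x)"
    using DERIV_unique[OF D1 D2] by (simp add: sums_iff)
  from sums_mult[OF this, of "1/2"]
  have "(\<lambda>n. x / (x\<^sup>2 + (real (Suc n))\<^sup>2)) sums (1 / 2 * (pi * cosh (pi * x) / sinh (pi * x) - 1 / x))"
    by (simp add: f'_def)
  moreover have "cosh (pi * x) / sinh (pi * x) = 2 / (exp (2 * pi * x) - 1) + 1"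
  proof -
    have e: "exp (2 * pi * x) = exp (pi * x) * exp (pi * x)" by (simp flip: exp_add)
    have "exp (pi * x) > 1" using x by simp
    hence "exp (pi * x) * exp (pi * x) > 1" by (rule less_1_mult[OF _ \<open>exp (pi * x) > 1\<close>])
    thus ?thesis unfolding e
      by (simp add: cosh_field_def sinh_field_def exp_minus field_simps)
  qed
  hence "1 / 2 * (pi * cosh (pi * x) / sinh (pi * x) - 1 / x) =
          pi * (1 / (exp (2 * pi * x) - 1) - 1 / (2 * pi * x) + 1 / 2)"
    using x by (simp add: field_simps)
  ultimately show ?thesis by simp
qed

section \<open>Inversion of the generating function\<close>

text \<open>
  \<open>c / (c\<^sup>2 + u\<^sup>2)\<close> is the derivative of \<open>arctan (u / c)\<close> and decreases in \<open>u\<close>.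
\<close>
lemma arctan_increment_bounds:
  fixes c u :: real assumes c: "c > 0" and u: "u \<ge> 0"
  shows "c / (c\<^sup>2 + (u + 1)\<^sup>2) \<le> arctan ((u + 1) / c) - arctan (u / c)"
    and "arctan ((u + 1) / c) - arctan (u / c) \<le> c / (c\<^sup>2 + u\<^sup>2)"
proof -
  have "\<exists>z>u. z < u + 1 \<and> arctan ((u + 1) / c) - arctan (u / c) = (u + 1 - u) * (c / (c\<^sup>2 + z\<^sup>2))"
  proof (rule MVT2)
    fix x :: real
    show "((\<lambda>x. arctan (x / c)) has_field_derivative (c / (c\<^sup>2 + x\<^sup>2))) (at x)"
      using c by (auto intro!: derivative_eq_intros simp: field_simps power2_eq_square add_pos_nonneg)
  qed auto
  then obtain z where z: "u < z" "z < u + 1" "arctan ((u + 1) / c) - arctan (u / c) = c / (c\<^sup>2 + z\<^sup>2)"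
    by auto
  have "z\<^sup>2 \<le> (u + 1)\<^sup>2" "u\<^sup>2 \<le> z\<^sup>2" using z u by (auto intro!: power_mono)
  moreover have "c\<^sup>2 > 0" using c by simp
  ultimately show "c / (c\<^sup>2 + (u + 1)\<^sup>2) \<le> arctan ((u + 1) / c) - arctan (u / c)"
    "arctan ((u + 1) / c) - arctan (u / c) \<le> c / (c\<^sup>2 + u\<^sup>2)"
    unfolding z(3) using c by (auto intro!: divide_left_mono mult_pos_pos add_pos_nonneg)
qed

lemma lorentzian_summable:
  fixes c :: real assumes c: "c > 0"
  shows "summable (\<lambda>n. c / (c\<^sup>2 + (real (Suc n))\<^sup>2))"
proof (rule summable_comparison_test)
  show "summable (\<lambda>n. c * (1 / (real (Suc n))\<^sup>2))"
    using inverse_squares_sums by (intro summable_mult) (simp add: sums_iff)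
  show "\<exists>N. \<forall>n\<ge>N. norm (c / (c\<^sup>2 + (real (Suc n))\<^sup>2)) \<le> c * (1 / (real (Suc n))\<^sup>2)"
    using c by (auto simp: abs_of_nonneg intro!: frac_le)
qed

text \<open>
  Comparison with the telescoping sum of arctangents, whose tail beyond \<open>K\<close> is
  \<open>\<pi>/2 - arctan (K / c)\<close>.
\<close>
lemma lorentzian_tail:
  fixes c :: real assumes c: "c > 0" and K: "K > 0"
  shows "\<bar>(\<Sum>n. c / (c\<^sup>2 + (real (Suc (n + K)))\<^sup>2)) - arctan (c / real K)\<bar> \<le> c / (real K)\<^sup>2"
proof -
  let ?d = "\<lambda>n. arctan ((real (n + K) + 1) / c) - arctan (real (n + K) / c)"
  let ?T = "\<Sum>n. c / (c\<^sup>2 + (real (Suc (n + K)))\<^sup>2)"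
  have "(\<lambda>n. arctan (real (n + K) / c)) \<longlonglongrightarrow> pi / 2"
    using c by (intro filterlim_compose[OF tendsto_arctan_at_top])
       (real_asymp)
  from telescope_sums[OF this] 
  have "?d sums (pi / 2 - arctan (real K / c))" by (simp add: add_ac)
  moreover have "pi / 2 - arctan (real K / c) = arctan (c / real K)"
    using arctan_inverse[of "real K / c"] c K by (simp add: sgn_real_def)
  ultimately have d: "?d sums arctan (c / real K)" by simp
  have S: "summable (\<lambda>n. c / (c\<^sup>2 + (real (Suc (n + K)))\<^sup>2))"
    using summable_ignore_initial_segment[OF lorentzian_summable[OF c], of K] by simp
  have "?T \<le> suminf ?d"
    using arctan_increment_bounds(1)[OF c, of "real (n + K)" for n]
    by (intro suminf_le S sums_summable[OF d]) (simp add: add_ac)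
  moreover have "suminf ?d \<le> c / (c\<^sup>2 + (real K)\<^sup>2) + ?T"
  proof -
    have S': "summable (\<lambda>n. c / (c\<^sup>2 + (real (n + K))\<^sup>2))"
      by (subst summable_Suc_iff[symmetric]) (use S in simp)
    have "suminf ?d \<le> (\<Sum>n. c / (c\<^sup>2 + (real (n + K))\<^sup>2))"
      using arctan_increment_bounds(2)[OF c] by (intro suminf_le S' sums_summable[OF d]) simp
    also have "\<dots> = c / (c\<^sup>2 + (real K)\<^sup>2) + ?T"
      using suminf_split_head[OF S'] by simp
    finally show ?thesis .
  qed
  moreover have "c / (c\<^sup>2 + (real K)\<^sup>2) \<le> c / (real K)\<^sup>2"
    using c K by (intro divide_left_mono mult_pos_pos add_pos_pos) auto
  ultimately show ?thesis using sums_unique[OF d] by simp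
qed

lemma arctan_over_antimono:
  fixes u v :: real assumes "0 < u" "u \<le> v"
  shows "arctan v / v \<le> arctan u / u"
proof (rule DERIV_nonpos_imp_nonincreasing[OF assms(2)])
  fix x assume x: "u \<le> x" "x \<le> v"
  hence x0: "x > 0" using assms by simp
  have "\<exists>z>0. z < x \<and> arctan x - arctan 0 = (x - 0) * inverse (1 + z\<^sup>2)"
    using x0 by (intro MVT2 DERIV_arctan) auto
  then obtain z where z: "0 < z" "z < x" "arctan x = x * inverse (1 + z\<^sup>2)" by auto
  have "z\<^sup>2 \<le> x\<^sup>2" using z by (intro power_mono) auto
  hence "inverse (1 + x\<^sup>2) \<le> inverse (1 + z\<^sup>2)" by (intro le_imp_inverse_le) (auto intro: add_pos_nonneg)
  hence "x * inverse (1 + x\<^sup>2) \<le> arctan x" unfolding z(3) using x0 by (intro mult_left_mono) auto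
  hence "(inverse (1 + x\<^sup>2) * x - arctan x * 1) / (x * x) \<le> 0"
    by (intro divide_nonpos_nonneg) (auto simp: mult.commute)
  moreover have "((\<lambda>x. arctan x / x) has_field_derivative (inverse (1 + x\<^sup>2) * x - arctan x * 1) / (x * x)) (at x)"
    using x0 by (intro DERIV_divide DERIV_arctan DERIV_ident) auto
  ultimately show "\<exists>y. ((\<lambda>x. arctan x / x) has_real_derivative y) (at x) \<and> y \<le> 0" by blast
qed

text \<open>
  These are lower Riemann sums of the decreasing function \<open>arctan u / u\<close> on \<open>[0, 1]\<close>.  Below they
  occur with two different meshes, and only the fact that both have the same limit matters.
\<close>
lemma arctan_riemann_sum_convergent:
  "convergent (\<lambda>n. \<Sum>j<n. arctan (real (Suc j) / real n) / real (Suc j))"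
proof -
  define g where "g = (\<lambda>u::real. if u = 0 then 1 else arctan u / u)"
  have arctan0: "((\<lambda>u. arctan u / u) \<longlongrightarrow> 1) (at (0::real))"
    using DERIV_arctan[of 0] by (simp add: has_field_derivative_iff)
  have cont: "continuous_on {0..1} g"
  proof -
    have "isCont g x" for x
    proof (cases "x = 0")
      case True
      have "(g \<longlongrightarrow> 1) (at 0)"
        by (rule Lim_transform_eventually[OF arctan0]) (auto simp: g_def eventually_at_filter)
      thus ?thesis using True by (simp add: isCont_def g_def)
    next
      case False
      have "isCont (\<lambda>u. arctan u / u) x" using False by (intro continuous_intros) auto
      moreover have "eventually (\<lambda>u. u \<noteq> 0) (nhds x)" using False by (simp add: t1_space_nhds)
      hence "eventually (\<lambda>u. g u = arctan u / u) (nhds x)" by eventually_elim (simp add: g_def)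
      ultimately show ?thesis by (simp add: isCont_cong)
    qed
    thus ?thesis by (simp add: continuous_at_imp_continuous_on)
  qed
  have anti: "g v \<le> g u" if "0 \<le> u" "u \<le> v" for u v
  proof (cases "u = 0 \<and> v > 0")
    case True
    have "arctan v \<le> v" using True arctan_le_self[of v] by simp
    thus ?thesis using True by (simp add: g_def)
  qed (use that arctan_over_antimono[of u v] in \<open>auto simp: g_def\<close>)
  define G where "G = (\<lambda>x. integral {0..x} g)"
  have dG: "(G has_real_derivative g x) (at x within {0..1})" if "x \<in> {0..1}" for x
    unfolding G_def by (rule integral_has_real_derivative[OF cont that])
  have step: "g v * (v - u) \<le> G v - G u \<and> G v - G u \<le> g u * (v - u)" if "0 \<le> u" "u < v" "v \<le> 1" for u v
  proof -
    have "\<exists>z\<in>{u<..<v}. G v - G u = (\<lambda>h. h * g z) (v - u)"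
    proof (rule mvt_simple[OF that(2)])
      fix x assume "u \<le> x" "x \<le> v"
      hence "(G has_real_derivative g x) (at x within {u..v})"
        using that by (intro has_field_derivative_subset[OF dG]) auto
      thus "(G has_derivative (\<lambda>h. h * g x)) (at x within {u..v})"
        by (simp add: has_field_derivative_def mult.commute[of _ "g x"] mult_commute_abs)
    qed
    then obtain z where z: "u < z" "z < v" "G v - G u = (v - u) * g z" by auto
    show ?thesis unfolding z(3) using anti[of u z] anti[of z v] z that
      by (auto simp: mult.commute intro!: mult_left_mono)
  qed
  let ?S = "\<lambda>n. \<Sum>j<n. arctan (real (Suc j) / real n) / real (Suc j)"
  have bnd: "norm (?S n - G 1) \<le> 1 / real n" if n: "n > 0" for n
  proof -
    have eq: "?S n = (\<Sum>j<n. g (real (Suc j) / n) * (1 / n))"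
      using n by (intro sum.cong) (auto simp: g_def field_simps)
    have G1: "G 1 = (\<Sum>j<n. G (real (Suc j) / n) - G (real j / n))"
      using n sum_lessThan_telescope[of "\<lambda>j. G (real j / n)" n] by (simp add: G_def)
    have st: "g (real (Suc j) / n) * (1 / n) \<le> G (real (Suc j) / n) - G (real j / n) \<and>
         G (real (Suc j) / n) - G (real j / n) \<le> g (real j / n) * (1 / n)" if "j < n" for j
    proof -
      have "real (Suc j) / n - real j / n = 1 / n" by (simp add: diff_divide_distrib[symmetric])
      moreover have "real j / n < real (Suc j) / n" using n by (intro divide_strict_right_mono) auto
      moreover have "real (Suc j) / n \<le> 1" using that by (simp add: field_simps)
      ultimately show ?thesis using step[of "real j / n" "real (Suc j) / n"] by simp
    qed
    have "?S n \<le> G 1" unfolding eq G1 using st by (intro sum_mono) auto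
    moreover have "G 1 \<le> (\<Sum>j<n. g (real j / n) * (1 / n))" unfolding G1 using st by (intro sum_mono) auto
    moreover have "(\<Sum>j<n. g (real j / n) * (1 / n)) - ?S n = (g 0 - g 1) / n"
    proof -
      have "(\<Sum>j<n. g (real j / n) * (1 / n)) - ?S n = (\<Sum>j<n. (g (real j / n) - g (real (Suc j) / n)) * (1 / n))"
        unfolding eq sum_subtractf[symmetric] by (simp only: left_diff_distrib)
      also have "\<dots> = (\<Sum>j<n. g (real j / n) - g (real (Suc j) / n)) * (1 / n)" by (simp only: sum_distrib_right)
      also have "(\<Sum>j<n. g (real j / n) - g (real (Suc j) / n)) = g 0 - g 1"
        using n sum_lessThan_telescope'[of "\<lambda>j. g (real j / n)" n] by simp
      finally show ?thesis by simp
    qed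
    moreover have "(g 0 - g 1) / n \<le> 1 / n"
      by (intro divide_right_mono) (auto simp: g_def)
    ultimately show ?thesis by simp
  qed
  have "eventually (\<lambda>n. norm (?S n - G 1) \<le> 1 / real n) sequentially"
    using eventually_gt_at_top[of 0] by eventually_elim (rule bnd)
  hence "(\<lambda>n. ?S n - G 1) \<longlonglongrightarrow> 0"
    by (rule Lim_null_comparison) real_asymp
  hence "?S \<longlonglongrightarrow> G 1" by (simp add: LIM_zero_iff)
  thus ?thesis by (auto simp: convergent_def)
qed

abbreviation lattice_row :: "real \<Rightarrow> nat \<Rightarrow> real" where
  "lattice_row t j \<equiv> (\<Sum>n. t / ((real (Suc j))\<^sup>2 * t\<^sup>2 + (real (Suc n))\<^sup>2))"

abbreviation partition_log_nome :: "real \<Rightarrow> real" where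
  "partition_log_nome t \<equiv> partition_log (exp (- 2 * pi * t))"

text \<open>
  Each term of the Lambert series is \<open>1 / (j (e\<^bsup>2\<pi>jt\<^esup> - 1))\<close>.  The three series into which the partial
  fractions split it do not all converge, so they are kept together in the partial sums.
\<close>
lemma partition_log_partial_fractions:
  fixes t :: real assumes t: "t > 0"
  shows "(\<lambda>J. \<Sum>j<J. 1 / (2 * pi * t) * (1 / (real (Suc j))\<^sup>2) - 1 / 2 * (1 / real (Suc j)) +
            1 / pi * lattice_row t j)
          \<longlonglongrightarrow> partition_log_nome t"
proof -
  let ?r = "exp (- 2 * pi * t)"
  have "(\<lambda>j. ?r ^ Suc j / (real (Suc j) * (1 - ?r ^ Suc j))) sums partition_log ?r"
    unfolding partition_log_def by (rule summable_sums, rule partition_log_summable) (use t in auto)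
  moreover have "?r ^ Suc j / (real (Suc j) * (1 - ?r ^ Suc j)) =
     1 / (2 * pi * t) * (1 / (real (Suc j))\<^sup>2) - 1 / 2 * (1 / real (Suc j)) +
            1 / pi * lattice_row t j" for j
  proof -
    define c where "c = real (Suc j)"
    have c: "c > 0" by (simp add: c_def)
    have ct: "c * t > 0" using c t by simp
    have "(\<lambda>n. 1 / c * (c * t / ((c * t)\<^sup>2 + (real (Suc n))\<^sup>2))) sums
       (1 / c * (pi * (1 / (exp (2 * pi * (c * t)) - 1) - 1 / (2 * pi * (c * t)) + 1 / 2)))"
      by (intro sums_mult coth_partial_fractions ct)
    hence "(\<lambda>n. t / (c\<^sup>2 * t\<^sup>2 + (real (Suc n))\<^sup>2)) sums
       (1 / c * (pi * (1 / (exp (2 * pi * (c * t)) - 1) - 1 / (2 * pi * (c * t)) + 1 / 2)))"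
      using c by (simp add: power_mult_distrib del: of_nat_Suc)
    hence s: "(\<Sum>n. t / (c\<^sup>2 * t\<^sup>2 + (real (Suc n))\<^sup>2)) = 
       (1 / c * (pi * (1 / (exp (2 * pi * (c * t)) - 1) - 1 / (2 * pi * (c * t)) + 1 / 2)))"
      by (rule sums_unique[symmetric])
    have e1: "exp (2 * pi * (c * t)) > 1" using ct by simp
    have "?r ^ Suc j = exp (- (2 * pi * (c * t)))"
      unfolding c_def exp_of_nat_mult[symmetric] by (rule arg_cong[of _ _ exp]) (simp add: algebra_simps)
    hence r: "?r ^ Suc j = 1 / exp (2 * pi * (c * t))" by (simp add: exp_minus inverse_eq_divide)
    define X where "X = exp (2 * pi * (c * t))"
    have X1: "X > 1" unfolding X_def by (rule e1)
    have "1 / X / (c * (1 - 1 / X)) = 1 / (c * (X - 1))"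
      using X1 c by (simp add: field_simps)
    also have "\<dots> = 1 / (2 * pi * t) * (1 / c\<^sup>2) - 1 / 2 * (1 / c) +
        1 / c * (1 / (X - 1) - 1 / (2 * pi * (c * t)) + 1 / 2)"
      using c t by (simp add: distrib_left right_diff_distrib power2_eq_square)
    finally show ?thesis unfolding c_def[symmetric] s r X_def[symmetric] by simp
  qed
  ultimately show ?thesis by (simp add: sums_def)
qed

text \<open>
  The tail of the \<open>j\<close>-th row of the double series, for either scale \<open>s = t\<close> or \<open>s = 1/t\<close>.
\<close>
lemma rescaled_lorentzian_row:
  fixes s :: real assumes s: "s > 0" and K: "K > 0"
  shows "summable (\<lambda>n. s / ((real (Suc j))\<^sup>2 * s\<^sup>2 + (real (Suc n))\<^sup>2)) \<and>
       \<bar>(\<Sum>n. s / ((real (Suc j))\<^sup>2 * s\<^sup>2 + (real (Suc (n + K)))\<^sup>2)) -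
          arctan (real (Suc j) * s / real K) / real (Suc j)\<bar> \<le> s / (real K)\<^sup>2" 
  proof -
    define c where "c = real (Suc j)"
    have c: "c > 0" and cs: "c * s > 0" using s by (simp_all add: c_def)
      let ?T = "(\<Sum>n. s / (c\<^sup>2 * s\<^sup>2 + (real (Suc (n + K)))\<^sup>2))"
    let ?U = "(\<Sum>n. c * s / ((c * s)\<^sup>2 + (real (Suc (n + K)))\<^sup>2))"
  have eq: "s / (c\<^sup>2 * s\<^sup>2 + (real (Suc n))\<^sup>2) = 1 / c * (c * s / ((c * s)\<^sup>2 + (real (Suc n))\<^sup>2))" for n
      using c by (simp add: power_mult_distrib del: of_nat_Suc)
    note S = lorentzian_summable[OF cs]
    have "?T =
        1 / c * ?U"
      unfolding eq using summable_ignore_initial_segment[OF S, of K] by (intro suminf_mult) simp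
    hence "?T - arctan (c * s / real K) / c =
       1 / c * (?U - arctan (c * s / real K))"
      by (simp add: right_diff_distrib)
    moreover have "\<bar>1 / c * (?U - arctan (c * s / real K))\<bar>
        \<le> 1 / c * (c * s / (real K)\<^sup>2)"
      unfolding abs_mult using lorentzian_tail[OF cs K] c by (intro mult_mono) auto
    moreover have "1 / c * (c * s / (real K)\<^sup>2) = s / (real K)\<^sup>2" using c by simp
    ultimately have bound: "\<bar>?T - arctan (c * s / real K) / c\<bar> \<le> s / (real K)\<^sup>2"
      by metis
    have summ: "summable (\<lambda>n. s / (c\<^sup>2 * s\<^sup>2 + (real (Suc n))\<^sup>2))"
      unfolding eq by (intro summable_mult S)
    show ?thesis unfolding c_def[symmetric] by (rule conjI[OF summ bound])
  qed
text \<open>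
  The two iterated sums share the rectangle \<open>j \<le> Q M\<close>, \<open>n \<le> P M\<close> and differ by its two tails.  Since
  \<open>t Q M = P M\<close>, these tails are Riemann sums of one and the same function, up to \<open>O(1/M)\<close>.
\<close>
lemma double_sum_asymmetry:
  fixes t :: real assumes PQ: "P > 0" "Q > 0" and t: "t = real P / real Q"
  shows "(\<lambda>M. (\<Sum>j<Q*M. lattice_row t j) -
              (\<Sum>n<P*M. lattice_row (1 / t) n)) \<longlonglongrightarrow> 0"
proof -
  have t0: "t > 0" using PQ t by simp
  let ?a = "\<lambda>j n. t / ((real (Suc j))\<^sup>2 * t\<^sup>2 + (real (Suc n))\<^sup>2)"
  let ?b = "\<lambda>n j. (1 / t) / ((real (Suc n))\<^sup>2 * (1 / t)\<^sup>2 + (real (Suc j))\<^sup>2)"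
  let ?S = "\<lambda>n. \<Sum>j<n. arctan (real (Suc j) / real n) / real (Suc j)"
  have ab: "?a j n = ?b n j" for j n
  proof -
    have "t / (x * t\<^sup>2 + y) = (1 / t) / (y * (1 / t)\<^sup>2 + x)" for x y
    proof -
      have "y * (1 / t)\<^sup>2 + x = (x * t\<^sup>2 + y) / t\<^sup>2" using t0 by (simp add: field_simps)
      thus ?thesis using t0 by (simp add: power2_eq_square)
    qed
    thus ?thesis .
  qed
  note row = rescaled_lorentzian_row
  let ?X = "\<lambda>M. (\<Sum>j<Q*M. \<Sum>n. ?a j n) - (\<Sum>n<P*M. \<Sum>j. ?b n j)"
  have bnd: "norm (?X M - (?S (Q*M) - ?S (P*M))) \<le> 1 / real (P*M) + 1 / real (Q*M)" if M: "M > 0" for M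
  proof -
    define J where "J = Q * M" 
    define K where "K = P * M"
    have J: "J > 0" and K: "K > 0" using M PQ by (auto simp: J_def K_def)
    have tJK: "t * real J = real K" using PQ by (simp add: t J_def K_def)
    have split_a: "(\<Sum>n. ?a j n) = (\<Sum>n. ?a j (n + K)) + (\<Sum>n<K. ?a j n)" for j
      by (rule suminf_split_initial_segment[OF conjunct1[OF row[OF t0 K]]])
    have split_b: "(\<Sum>j. ?b n j) = (\<Sum>j. ?b n (j + J)) + (\<Sum>j<J. ?b n j)" for n
      by (rule suminf_split_initial_segment[OF conjunct1[OF row[OF _ J]]]) (use t0 in simp)
    have swap: "(\<Sum>j<J. \<Sum>n<K. ?a j n) = (\<Sum>n<K. \<Sum>j<J. ?b n j)"
      by (subst sum.swap) (simp only: ab)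
    have sum_a: "(\<Sum>j<J. \<Sum>n. ?a j n) = (\<Sum>j<J. \<Sum>n. ?a j (n + K)) + (\<Sum>j<J. \<Sum>n<K. ?a j n)"
      by (subst sum.distrib[symmetric]) (intro sum.cong refl split_a)
    have sum_b: "(\<Sum>n<K. \<Sum>j. ?b n j) = (\<Sum>n<K. \<Sum>j. ?b n (j + J)) + (\<Sum>n<K. \<Sum>j<J. ?b n j)"
      by (subst sum.distrib[symmetric]) (intro sum.cong refl split_b)
    have "?X M = (\<Sum>j<J. \<Sum>n. ?a j (n + K)) - (\<Sum>n<K. \<Sum>j. ?b n (j + J))"
      using sum_a sum_b swap unfolding J_def[symmetric] K_def[symmetric] by linarith
    hence eq: "?X M - (?S J - ?S K) =
        ((\<Sum>j<J. \<Sum>n. ?a j (n + K)) - ?S J) - ((\<Sum>n<K. \<Sum>j. ?b n (j + J)) - ?S K)" by linarith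
    have "norm (\<Sum>j<J. (\<Sum>n. ?a j (n + K)) - arctan (real (Suc j) / real J) / real (Suc j)) \<le> (\<Sum>j<J. t / (real K)\<^sup>2)"
    proof (rule sum_norm_le)
      fix j
      have e: "real (Suc j) * t / real K = real (Suc j) / real J"
        using tJK J K t0 by (simp add: field_simps)
      show "norm ((\<Sum>n. ?a j (n + K)) - arctan (real (Suc j) / real J) / real (Suc j)) \<le> t / (real K)\<^sup>2"
        using conjunct2[OF row[OF t0 K, of j]] unfolding e real_norm_def .
    qed
    moreover have "(\<Sum>j<J. t / (real K)\<^sup>2) = 1 / real K"
      using K by (simp add: tJK[symmetric] power2_eq_square)
    ultimately have n1: "norm ((\<Sum>j<J. \<Sum>n. ?a j (n + K)) - ?S J) \<le> 1 / real K"
      by (simp only: sum_subtractf)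
    have t1: "1 / t > 0" using t0 by simp
    have "norm (\<Sum>n<K. (\<Sum>j. ?b n (j + J)) - arctan (real (Suc n) / real K) / real (Suc n)) \<le> (\<Sum>n<K. (1 / t) / (real J)\<^sup>2)"
    proof (rule sum_norm_le)
      fix n
      have e: "real (Suc n) * (1 / t) / real J = real (Suc n) / real K"
        using tJK J K t0 by (simp add: field_simps)
      show "norm ((\<Sum>j. ?b n (j + J)) - arctan (real (Suc n) / real K) / real (Suc n)) \<le> (1 / t) / (real J)\<^sup>2"
        using conjunct2[OF row[OF t1 J, of n]] unfolding e real_norm_def .
    qed
    moreover have "(\<Sum>n<K. (1 / t) / (real J)\<^sup>2) = 1 / real J"
      using J t0 by (simp add: tJK[symmetric] power2_eq_square)
    ultimately have n2: "norm ((\<Sum>n<K. \<Sum>j. ?b n (j + J)) - ?S K) \<le> 1 / real J"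
      by (simp only: sum_subtractf)
    have "norm (?X M - (?S J - ?S K)) \<le> 1 / real K + 1 / real J"
      unfolding eq by (rule order_trans[OF norm_triangle_ineq4 add_mono[OF n1 n2]])
    thus ?thesis unfolding J_def K_def .
  qed
  obtain L where L: "?S \<longlonglongrightarrow> L" using arctan_riemann_sum_convergent by (auto simp: convergent_def)
  have L': "(\<lambda>M. ?S (N * M)) \<longlonglongrightarrow> L" if "N > 0" for N
    using that by (intro filterlim_compose[OF L] mult_nat_left_at_top) auto
  have "eventually (\<lambda>M. norm (?X M - (?S (Q*M) - ?S (P*M))) \<le> 1 / real (P*M) + 1 / real (Q*M)) sequentially"
    using eventually_gt_at_top[of 0] by eventually_elim (rule bnd)
  hence "(\<lambda>M. ?X M - (?S (Q*M) - ?S (P*M))) \<longlonglongrightarrow> 0"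
  proof (rule Lim_null_comparison)
    show "(\<lambda>M. 1 / real (P*M) + 1 / real (Q*M)) \<longlonglongrightarrow> 0" using PQ by simp real_asymp
  qed
  from tendsto_add[OF this tendsto_diff[OF L'[OF PQ(2)] L'[OF PQ(1)]]] show ?thesis by simp
qed

text \<open>
  The conditionally convergent double series cancel, the terms \<open>1 / j\<^sup>2\<close> sum to \<open>\<pi>\<^sup>2/6\<close>, and
  \<open>ln t / 2\<close> is half of the limit of the difference of the harmonic numbers \<open>H\<^bsub>PM\<^esub> - H\<^bsub>QM\<^esub>\<close>.
\<close>
lemma partition_log_inversion:
  fixes t :: real assumes PQ: "P > 0" "Q > 0" and t: "t = real P / real Q"
  shows "partition_log_nome t - partition_log_nome (1 / t) =
          ln t / 2 + pi / (12 * t) - pi * t / 12"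
proof -
  have t0: "t > 0" using PQ t by simp
  define A where "A = lattice_row"
  let ?w = "\<lambda>t J. \<Sum>j<J. 1 / (2 * pi * t) * (1 / (real (Suc j))\<^sup>2) - 1 / 2 * (1 / real (Suc j)) + 1 / pi * A t j"
  define Z where "Z = (\<lambda>J. \<Sum>j<J. 1 / (real (Suc j))\<^sup>2)"
  have w: "?w t J = 1 / (2 * pi * t) * Z J - 1 / 2 * harm J + 1 / pi * (\<Sum>j<J. A t j)" for t J
  proof -
    have "harm J = (\<Sum>j<J. 1 / real (Suc j))"
      unfolding harm_def by (rule sum.reindex_bij_witness[of _ Suc "\<lambda>j. j - 1"]) (auto simp: divide_inverse)
    thus ?thesis by (simp only: sum.distrib sum_subtractf sum_distrib_left[symmetric] Z_def)
  qed
  have m: "filterlim (\<lambda>M. N * M) at_top sequentially" if "N > 0" for N :: nat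
    using that by (intro mult_nat_left_at_top) auto
  have "(\<lambda>M. ?w t (Q*M) - ?w (1/t) (P*M)) \<longlonglongrightarrow>
          partition_log_nome t - partition_log_nome (1 / t)"
    unfolding A_def using t0
    by (intro tendsto_diff filterlim_compose[OF partition_log_partial_fractions] m PQ) auto
  moreover have "(\<lambda>M. ?w t (Q*M) - ?w (1/t) (P*M)) \<longlonglongrightarrow>
     (1 / (2 * pi * t)) * (pi\<^sup>2 / 6) - (1 / (2 * pi * (1 / t))) * (pi\<^sup>2 / 6) - 1 / 2 * (ln (real Q) - ln (real P)) + 1 / pi * 0"
  proof -
    have eq: "?w t (Q*M) - ?w (1/t) (P*M) = (1 / (2 * pi * t)) * Z (Q*M) - (1 / (2 * pi * (1 / t))) * Z (P*M)
       - 1 / 2 * (harm (Q*M) - harm (P*M)) + 1 / pi * ((\<Sum>j<Q*M. A t j) - (\<Sum>n<P*M. A (1/t) n))" for M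
      unfolding w by (simp add: algebra_simps)
    have Zlim: "Z \<longlonglongrightarrow> pi\<^sup>2 / 6" unfolding Z_def using inverse_squares_sums by (simp add: sums_def)
    have h: "(\<lambda>M. harm (Q*M) - harm (P*M)) \<longlonglongrightarrow> ln (real Q) - ln (real P)"
    proof -
      have "(\<lambda>M. (harm (Q*M) - ln (real (Q*M))) - (harm (P*M) - ln (real (P*M))) + (ln (real Q) - ln (real P)))
         \<longlonglongrightarrow> (euler_mascheroni - euler_mascheroni) + (ln (real Q) - ln (real P))"
        by (intro tendsto_intros filterlim_compose[OF euler_mascheroni_LIMSEQ] m PQ)
      hence "(\<lambda>M. (harm (Q*M) - ln (real (Q*M))) - (harm (P*M) - ln (real (P*M))) + (ln (real Q) - ln (real P)))
         \<longlonglongrightarrow> ln (real Q) - ln (real P)" by simp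
      moreover have "eventually (\<lambda>M. (harm (Q*M) - ln (real (Q*M))) - (harm (P*M) - ln (real (P*M))) + (ln (real Q) - ln (real P)) = 
           harm (Q*M) - harm (P*M)) sequentially"
        using eventually_gt_at_top[of 0] by eventually_elim (use PQ in \<open>simp add: ln_mult\<close>)
      ultimately show ?thesis by (rule Lim_transform_eventually)
    qed
    have asym: "(\<lambda>M. (\<Sum>j<Q*M. A t j) - (\<Sum>n<P*M. A (1/t) n)) \<longlonglongrightarrow> 0"
      unfolding A_def by (rule double_sum_asymmetry[OF PQ t])
    show ?thesis unfolding eq
      by (intro tendsto_add[OF tendsto_diff[OF tendsto_diff]] tendsto_mult[OF tendsto_const] 
           filterlim_compose[OF Zlim m] PQ h asym)
  qed
  ultimately have "partition_log_nome t - partition_log_nome (1 / t) =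
     (1 / (2 * pi * t)) * (pi\<^sup>2 / 6) - (1 / (2 * pi * (1 / t))) * (pi\<^sup>2 / 6) - 1 / 2 * (ln (real Q) - ln (real P)) + 1 / pi * 0"
    by (rule LIMSEQ_unique)
  also have "\<dots> = pi / (12 * t) - pi * t / 12 + 1 / 2 * ln t"
    using PQ t0 unfolding t by (simp add: ln_div field_simps power2_eq_square)
  finally show ?thesis by simp
qed

lemma partition_gf_inversion_rational:
  assumes PQ: "P > 0" "Q > 0" and t: "t = real P / real Q"
  shows "partition_gf (exp (of_real (- 2 * pi * t))) * exp (of_real (pi * t / 12)) =
     of_real (sqrt t) * (partition_gf (exp (of_real (- 2 * pi * (1 / t)))) * exp (of_real (pi / (12 * t))))"
proof -
  have t0: "t > 0" using PQ t by simp
  have "partition_log (exp (- 2 * pi * t)) + pi * t / 12 =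
      ln t / 2 + (partition_log (exp (- 2 * pi * (1 / t))) + pi / (12 * t))"
    using partition_log_inversion[OF PQ t] by simp
  hence "exp (partition_log (exp (- 2 * pi * t)) + pi * t / 12) =
       exp (ln t / 2 + (partition_log (exp (- 2 * pi * (1 / t))) + pi / (12 * t)))" by (rule arg_cong)
  hence "exp (partition_log (exp (- 2 * pi * t))) * exp (pi * t / 12) =
     sqrt t * (exp (partition_log (exp (- 2 * pi * (1 / t)))) * exp (pi / (12 * t)))"
    unfolding exp_add using t0 by (simp add: ln_sqrt[symmetric])
  from arg_cong[OF this, of complex_of_real] show ?thesis
    unfolding exp_of_real by (subst (1 2) partition_gf_of_real) (use t0 in auto)
qed

lemma Re_one_divide_pos:
  assumes "Re w > 0"
  shows "Re (1 / w) > 0"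
proof -
  have "w \<noteq> 0" using assms by auto
  hence "(Re w)\<^sup>2 + (Im w)\<^sup>2 > 0" by (simp add: complex_eq_iff sum_power2_gt_zero_iff)
  thus ?thesis using assms by (simp add: Re_divide)
qed

text \<open>
  Both sides are holomorphic in the right half-plane and agree at the positive rationals, which
  accumulate at \<open>1\<close>.
\<close>
theorem partition_gf_inversion:
  assumes z: "Re z > 0"
  shows "partition_gf (exp (- 2 * of_real pi * z)) * exp (of_real pi * z / 12) =
     csqrt z * (partition_gf (exp (- 2 * of_real pi / z)) * exp (of_real pi / (12 * z)))"
proof -
  let ?S = "{z. Re z > 0}"
  let ?f = "\<lambda>z. partition_gf (exp (- 2 * of_real pi * z)) * exp (of_real pi * z / 12) -
     csqrt z * (partition_gf (exp (- 2 * of_real pi / z)) * exp (of_real pi / (12 * z)))"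
  \<comment> \<open>rationals different from \<open>1\<close> that converge to \<open>1\<close>\<close>
  define u where "u = (\<lambda>n::nat. complex_of_real (real (n + 2) / real (n + 1)))"
  have Re_neg_2pi_div: "Re (- 2 * of_real pi / w) = (- 2 * pi) * Re (1 / w)" for w by (simp add: Re_divide)
  have neg_2pi: "- 2 * pi < 0" by simp
  have "?f z = 0"
  proof (rule analytic_continuation[where f = ?f and S = ?S and U = "range u" and \<xi> = 1])
    have "norm (exp (- 2 * of_real pi * w)) < 1" if "Re w > 0" for w
      using that by simp
    moreover have "norm (exp (- 2 * of_real pi / w)) < 1" if "Re w > 0" for w
      using Re_one_divide_pos[OF that] that by (simp only: norm_exp_eq_Re exp_less_one_iff Re_neg_2pi_div mult_neg_pos neg_2pi)
    moreover have "w \<notin> \<real>\<^sub>\<le>\<^sub>0" "w \<noteq> 0" if "Re w > 0" for w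
      using that by (auto simp: complex_nonpos_Reals_iff)
    ultimately show "?f holomorphic_on ?S"
      by (intro holomorphic_intros partition_gf_holomorphic_comp) auto
    show "open ?S" by (rule open_halfspace_Re_gt)
    show "connected ?S" by (intro convex_connected convex_halfspace_Re_gt)
    show "range u \<subseteq> ?S" by (auto simp: u_def)
    show "(1::complex) islimpt range u"
    proof (unfold islimpt_sequential, intro exI[of _ u] conjI allI)
      show "u n \<in> range u - {1}" for n by (simp add: u_def complex_eq_iff)
      have "(\<lambda>n. real (n + 2) / real (n + 1)) \<longlonglongrightarrow> 1" by real_asymp
      from tendsto_of_real[OF this, where 'a = complex] show "u \<longlonglongrightarrow> 1"
        unfolding u_def of_real_1 .
    qed
    fix w assume "w \<in> range u"
    then obtain n where n: "w = u n" by auto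
    show "?f w = 0"
      using partition_gf_inversion_rational[of "n + 2" "n + 1", OF _ _ refl]
      unfolding n u_def of_real_sqrt by (simp add: csqrt_of_real_nonneg)
  qed (use z in auto)
  thus ?thesis by simp
qed

section \<open>Dedekind sums and their reciprocity law\<close>

lemma dedekind_sum_mod:
  assumes k: "k > 0"
  shows "dedekind_sum (h mod int k) k = dedekind_sum h k"
  unfolding dedekind_sum_def
proof (rule sum.cong[OF refl])
  fix r
  let ?t = "\<lambda>x. real r / real k * (x - of_int \<lfloor>x\<rfloor> - 1 / 2)"
  have e: "real_of_int (h mod int k) = of_int h - of_int (h div int k) * real k"
    by (simp add: minus_div_mult_eq_mod[symmetric])
  have "of_int (h mod int k) * real r / real k = of_int h * real r / real k - of_int (h div int k * int r)"
    unfolding e using k by (simp add: field_simps)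
  thus "?t (of_int (h mod int k) * real r / real k) =
        ?t (of_int h * real r / real k)"
    by (simp only: floor_diff_of_int) simp
qed

lemma dedekind_sum_minus:
  assumes "coprime h (int k)"
  shows "dedekind_sum (- h) k = - dedekind_sum h k"
  unfolding dedekind_sum_def sum_negf[symmetric]
proof (rule sum.cong[OF refl])
  fix r assume r: "r \<in> {1..<k}"
  let ?t = "\<lambda>x. real r / real k * (x - of_int \<lfloor>x\<rfloor> - 1 / 2)"
  define x where "x = of_int h * real r / real k"
  have "x \<notin> \<int>"
  proof
    assume "x \<in> \<int>"
    then obtain m where "x = of_int m" by (auto elim: Ints_cases)
    hence "real_of_int (h * int r) = of_int (m * int k)" using r by (simp add: x_def field_simps)
    hence "h * int r = m * int k" by (simp only: of_int_eq_iff)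
    hence "int k dvd h * int r" by simp
    hence "int k dvd int r" using assms by (simp add: coprime_dvd_mult_right_iff coprime_commute)
    thus False using r by (auto dest: dvd_imp_le)
  qed
  hence f: "of_int \<lfloor>- x\<rfloor> = - real_of_int \<lfloor>x\<rfloor> - 1"
    by (metis (no_types) ceiling_altdef floor_minus Ints_of_int of_int_1 of_int_add of_int_minus minus_add_distrib add_uminus_conv_diff)
  have e: "of_int (- h) * real r / real k = - x" by (simp add: x_def)
  show "?t (of_int (- h) * real r / real k) =
         - (?t (of_int h * real r / real k))"
    unfolding e x_def[symmetric] f by (simp add: algebra_simps)
qed

lemma sum_mult_mod_reindex:
  fixes f :: "nat \<Rightarrow> real"
  assumes "coprime h k"
  shows "(\<Sum>r=1..<k. f ((h * r) mod k)) = (\<Sum>r=1..<k. f r)"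
proof -
  have inj: "inj_on (\<lambda>r. (h * r) mod k) {1..<k}"
  proof (rule inj_onI)
    fix x y assume xy: "x \<in> {1..<k}" "y \<in> {1..<k}" "(h * x) mod k = (h * y) mod k"
    hence "[x = y] (mod k)" using assms by (simp add: cong_def[symmetric] cong_mult_lcancel_nat)
    thus "x = y" using xy by (simp add: cong_def)
  qed
  have "(\<lambda>r. (h * r) mod k) ` {1..<k} \<subseteq> {1..<k}"
  proof
    fix y assume "y \<in> (\<lambda>r. (h * r) mod k) ` {1..<k}"
    then obtain x where x: "x \<in> {1..<k}" "y = (h * x) mod k" by auto
    have "\<not> k dvd x" using x by (auto dest: dvd_imp_le)
    hence "\<not> k dvd h * x" using assms by (simp add: coprime_dvd_mult_right_iff coprime_commute)
    hence "y \<noteq> 0" using x by (simp add: dvd_eq_mod_eq_0)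
    thus "y \<in> {1..<k}" using x by auto
  qed
  hence "(\<lambda>r. (h * r) mod k) ` {1..<k} = {1..<k}" by (intro endo_inj_surj inj) auto
  thus ?thesis using sum.reindex[OF inj, of f] by simp
qed

text \<open>
  Counts the points \<open>(r, v)\<close> with \<open>v \<le> h r / k\<close> and weight \<open>2 v\<close>, once by \<open>r\<close> and once by \<open>v\<close>.  By
  coprimality no such point lies on the line \<open>k v = h r\<close>.
\<close>
lemma sum_div_mult_Suc_div:
  fixes h k :: nat
  assumes co: "coprime h k" and h: "h > 0" and k: "k > 0"
  shows "(\<Sum>r=1..<k. (h * r) div k * ((h * r) div k + 1)) + 2 * (\<Sum>v=1..<h. v * ((k * v) div h)) =
          (k - 1) * h * (h - 1)"
proof -
  have gauss: "m * (m + 1) = (\<Sum>v=1..m. 2 * v)" for m :: nat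
    by (induction m) auto
  have lt: "(h * r) div k < h" if "r < k" for r
    using that h k by (simp add: div_less_iff_less_mult)
  have "(\<Sum>r=1..<k. (h * r) div k * ((h * r) div k + 1)) =
         (\<Sum>r=1..<k. \<Sum>v\<in>{v\<in>{1..<h}. v \<le> (h * r) div k}. 2 * v)"
    unfolding gauss by (intro sum.cong refl) (use lt in fastforce)+
  also have "\<dots> = (\<Sum>v=1..<h. \<Sum>r\<in>{r\<in>{1..<k}. v \<le> (h * r) div k}. 2 * v)"
    by (rule sum.swap_restrict) auto
  also have "\<dots> = (\<Sum>v=1..<h. (k - 1 - (k * v) div h) * (2 * v))"
  proof (rule sum.cong[OF refl])
    fix v assume v: "v \<in> {1..<h}"
    have "\<not> h dvd v" using v by (auto dest: dvd_imp_le)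
    hence nd: "\<not> h dvd k * v" using co by (simp add: coprime_dvd_mult_right_iff)
    define q where "q = (k * v) div h"
    have iff: "v \<le> (h * r) div k \<longleftrightarrow> q < r" for r
    proof -
      have "v \<le> (h * r) div k \<longleftrightarrow> k * v \<le> h * r" using k by (simp add: less_eq_div_iff_mult_less_eq mult.commute)
      also have "\<dots> \<longleftrightarrow> k * v < h * r" using nd by (metis dvd_triv_left le_neq_implies_less less_imp_le)
      also have "\<dots> \<longleftrightarrow> q < r" unfolding q_def using h by (simp add: div_less_iff_less_mult mult.commute)
      finally show ?thesis .
    qed
    show "(\<Sum>r\<in>{r\<in>{1..<k}. v \<le> (h * r) div k}. 2 * v) = (k - 1 - (k * v) div h) * (2 * v)"
    proof -
      have "{r\<in>{1..<k}. v \<le> (h * r) div k} = {q<..<k}" unfolding iff by auto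
      hence "card {r\<in>{1..<k}. v \<le> (h * r) div k} = k - 1 - q" by simp
      thus ?thesis unfolding sum_constant of_nat_id q_def by (rule arg_cong)
    qed
  qed
  also have "\<dots> + 2 * (\<Sum>v=1..<h. v * ((k * v) div h)) = (\<Sum>v=1..<h. (k - 1) * (2 * v))"
    unfolding sum_distrib_left sum.distrib[symmetric]
  proof (rule sum.cong[OF refl])
    have aux: "a * (2 * v) + 2 * (v * b) = (a + b) * (2 * v)" for a b v :: nat
      by (simp add: algebra_simps)
    fix v assume v: "v \<in> {1..<h}"
    hence "(k * v) div h < k" using h k by (simp add: div_less_iff_less_mult)
    hence e: "(k - 1 - (k * v) div h) + (k * v) div h = k - 1" by simp
    have "(k - 1 - (k * v) div h) * (2 * v) + 2 * (v * ((k * v) div h)) = ((k - 1 - (k * v) div h) + (k * v) div h) * (2 * v)"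
      by (rule aux)
    thus "(k - 1 - (k * v) div h) * (2 * v) + 2 * (v * ((k * v) div h)) = (k - 1) * (2 * v)"
      unfolding e .
  qed
  also have "\<dots> = (k - 1) * (\<Sum>v=1..h-1. 2 * v)"
    unfolding sum_distrib_left using h by (intro sum.cong) auto
  also have "(\<Sum>v=1..h-1. 2 * v) = (h - 1) * h" using gauss[of "h - 1"] h by simp
  also have "(k - 1) * ((h - 1) * h) = (k - 1) * h * (h - 1)" by simp
  finally show ?thesis .
qed

lemma sum_upto_less: "(\<Sum>r=1..<k. real r) = real k * (real k - 1) / 2" if "k > 0"
  using that by (induction k rule: nat_induct_non_zero) (auto simp: field_simps)

lemma sum_squares_upto_less:
  "(\<Sum>r=1..<k. (real r)\<^sup>2) = real k * (real k - 1) * (2 * real k - 1) / 6" if "k > 0"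
  using that by (induction k rule: nat_induct_non_zero) (auto simp: field_simps power2_eq_square)

lemma dedekind_sum_nat:
  assumes k: "k > 0"
  shows "dedekind_sum (int h) k = real h * (\<Sum>r=1..<k. (real r)\<^sup>2) / (real k)\<^sup>2
      - (\<Sum>r=1..<k. real r * real ((h * r) div k)) / real k - (\<Sum>r=1..<k. real r) / (2 * real k)"
proof -
  have "real r / real k * (of_int (int h) * real r / real k - of_int \<lfloor>of_int (int h) * real r / real k\<rfloor> - 1 / 2) =
     real h * (real r)\<^sup>2 / (real k)\<^sup>2 - real r * real ((h * r) div k) / real k - real r / (2 * real k)" for r
  proof -
    have "\<lfloor>of_int (int h) * real r / real k\<rfloor> = int ((h * r) div k)"
      using floor_divide_of_nat_eq[of "h * r" k, where 'a = real] by simp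
    thus ?thesis using k by (simp only: of_int_of_nat_eq) (simp add: field_simps power2_eq_square)
  qed
  thus ?thesis unfolding dedekind_sum_def
    by (simp only: sum_subtractf sum_divide_distrib[symmetric] sum_distrib_left[symmetric])
qed

text \<open>
  Three linear relations determine the sum \<open>s(h,k) + s(k,h)\<close>: multiplication by \<open>h\<close> permutes the
  nonzero residues modulo \<open>k\<close>, so the sums of \<open>h r mod k\<close> and of its square are known, and the
  lattice-point count relates the quotients \<open>h r div k\<close> to \<open>k v div h\<close>.
\<close>
theorem dedekind_reciprocity:
  fixes h k :: nat
  assumes co: "coprime h k" and h: "h > 0" and k: "k > 0"
  shows "dedekind_sum (int h) k + dedekind_sum (int k) h =
          - 1 / 4 + (real h / real k + real k / real h + 1 / (real h * real k)) / 12"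
proof -
  define m where "m = (\<lambda>r. real ((h * r) div k))"
  define A where "A = (\<Sum>r=1..<k. real r * m r)"
  define A' where "A' = (\<Sum>v=1..<h. real v * real ((k * v) div h))"
  define B where "B = (\<Sum>r=1..<k. (m r)\<^sup>2)"
  define D where "D = (\<Sum>r=1..<k. m r)"
  define S1 where "S1 = (\<Sum>r=1..<k. real r)"
  define S2 where "S2 = (\<Sum>r=1..<k. (real r)\<^sup>2)"
  have modr: "real ((h * r) mod k) = real h * real r - real k * m r" for r
  proof -
    have "h * r = k * ((h * r) div k) + (h * r) mod k" by (rule mult_div_mod_eq[symmetric])
    hence "real (h * r) = real (k * ((h * r) div k) + (h * r) mod k)" by (rule arg_cong)
    thus ?thesis unfolding of_nat_add of_nat_mult m_def by linarith
  qed
  have e1: "real h * S1 - real k * D = S1"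
    using sum_mult_mod_reindex[OF co, of real] unfolding modr
    by (simp add: sum_subtractf S1_def D_def sum_distrib_left)
  have "(\<Sum>r=1..<k. (real ((h * r) mod k))\<^sup>2) = S2"
    unfolding S2_def by (rule sum_mult_mod_reindex[OF co])
  also have "(\<Sum>r=1..<k. (real ((h * r) mod k))\<^sup>2) =
       (\<Sum>r=1..<k. (real h)\<^sup>2 * (real r)\<^sup>2 - 2 * real h * real k * (real r * m r) + (real k)\<^sup>2 * (m r)\<^sup>2)"
    unfolding modr by (intro sum.cong refl) (simp add: power2_eq_square algebra_simps)
  also have "\<dots> = (real h)\<^sup>2 * S2 - 2 * real h * real k * A + (real k)\<^sup>2 * B"
    by (simp add: sum_subtractf sum.distrib sum_distrib_left[symmetric] S2_def A_def B_def mult.assoc)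
  finally have e2: "(real h)\<^sup>2 * S2 - 2 * real h * real k * A + (real k)\<^sup>2 * B = S2" .
  have "real ((\<Sum>r=1..<k. (h * r) div k * ((h * r) div k + 1)) + 2 * (\<Sum>v=1..<h. v * ((k * v) div h))) =
          real ((k - 1) * h * (h - 1))"
    by (simp only: sum_div_mult_Suc_div[OF co h k])
  moreover have "real (\<Sum>r=1..<k. (h * r) div k * ((h * r) div k + 1)) = B + D"
    by (simp add: B_def D_def m_def power2_eq_square distrib_left sum.distrib)
  moreover have "real (\<Sum>v=1..<h. v * ((k * v) div h)) = A'" by (simp add: A'_def)
  ultimately have e3: "B + D + 2 * A' = (real k - 1) * real h * (real h - 1)"
    using h k by (simp add: of_nat_diff)
  have S1: "S1 = real k * (real k - 1) / 2" unfolding S1_def by (rule sum_upto_less[OF k])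
  have S2: "S2 = real k * (real k - 1) * (2 * real k - 1) / 6" unfolding S2_def by (rule sum_squares_upto_less[OF k])
  have d1: "dedekind_sum (int h) k = real h * S2 / (real k)\<^sup>2 - A / real k - S1 / (2 * real k)"
    unfolding dedekind_sum_nat[OF k] S2_def A_def S1_def m_def ..
  have d2: "dedekind_sum (int k) h = real k * (real h * (real h - 1) * (2 * real h - 1) / 6) / (real h)\<^sup>2 - A' / real h
      - (real h * (real h - 1) / 2) / (2 * real h)"
    unfolding dedekind_sum_nat[OF h] A'_def sum_upto_less[OF h] sum_squares_upto_less[OF h] ..
  define x where "x = real h"
  define y where "y = real k"
  have x: "x > 0" and y: "y > 0" using h k by (auto simp: x_def y_def)
  have D: "D = (x - 1) * (y - 1) / 2"
  proof -
    have "y * D = y * ((x - 1) * (y - 1) / 2)"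
      using e1 unfolding S1 x_def[symmetric] y_def[symmetric] by (simp add: field_simps)
    thus ?thesis using y by simp
  qed
  have B: "B = (y - 1) * x * (x - 1) - 2 * A' - (x - 1) * (y - 1) / 2"
    using e3 unfolding D x_def[symmetric] y_def[symmetric] by simp
  have A: "A = ((x\<^sup>2 - 1) * (y * (y - 1) * (2 * y - 1) / 6) + y\<^sup>2 * B) / (2 * x * y)"
    using e2 x y unfolding S2 x_def[symmetric] y_def[symmetric] by (simp add: field_simps)
  show ?thesis unfolding d1 d2 S1 S2 A B x_def[symmetric] y_def[symmetric]
    using x y by (simp add: field_simps power2_eq_square)
qed

section \<open>Transformation of the generating function at a rational point\<close>

text \<open>
  This is \<open>1 / \<eta>(\<tau>)\<close> for Dedekind's \<open>\<eta>(\<tau>) = e\<^bsup>\<pi>i\<tau>/12\<^esup> \<Prod> (1 - e\<^bsup>2\<pi>im\<tau>\<^esup>)\<close>; in this normalisation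
  translation and inversion become multiplication by an elementary factor.
\<close>
definition inv_eta :: "complex \<Rightarrow> complex" where
  "inv_eta \<tau> = partition_gf (exp (2 * of_real pi * \<i> * \<tau>)) * exp (- of_real pi * \<i> * \<tau> / 12)"

lemma inv_eta_translation: "inv_eta (\<tau> + of_int m) = exp (- of_real pi * \<i> * of_int m / 12) * inv_eta \<tau>"
proof -
  have "exp (2 * of_real pi * \<i> * (\<tau> + of_int m)) = exp (2 * of_real pi * \<i> * \<tau>)"
    using exp_plus_2pin[of "2 * of_real pi * \<i> * \<tau>" m] by (simp add: algebra_simps)
  moreover have "exp (- of_real pi * \<i> * (\<tau> + of_int m) / 12) =
      exp (- of_real pi * \<i> * of_int m / 12) * exp (- of_real pi * \<i> * \<tau> / 12)"
    unfolding exp_add[symmetric] by (rule arg_cong[of _ _ exp]) (simp add: field_simps)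
  ultimately show ?thesis unfolding inv_eta_def by (simp only: mult_ac)
qed

lemma inv_eta_inversion:
  assumes "Im \<tau> > 0"
  shows "inv_eta \<tau> = csqrt (- \<i> * \<tau>) * inv_eta (- 1 / \<tau>)"
proof -
  have nz: "\<tau> \<noteq> 0" using assms by auto
  have e: "- 2 * of_real pi * (- \<i> * \<tau>) = 2 * of_real pi * \<i> * \<tau>"
    "of_real pi * (- \<i> * \<tau>) / 12 = - of_real pi * \<i> * \<tau> / 12"
    "- 2 * of_real pi / (- \<i> * \<tau>) = 2 * of_real pi * \<i> * (- 1 / \<tau>)"
    "of_real pi / (12 * (- \<i> * \<tau>)) = - of_real pi * \<i> * (- 1 / \<tau>) / 12"
    using nz by (auto simp: field_simps)
  have "Re (- \<i> * \<tau>) > 0" using assms by simp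
  from partition_gf_inversion[OF this] show ?thesis
    unfolding e inv_eta_def .
qed

lemma csqrt_halfplane:
  assumes "Re u > 0"
  shows "\<bar>Im (csqrt u)\<bar> < Re (csqrt u)"
proof -
  define c where "c = csqrt u"
  have "c\<^sup>2 = u" by (simp add: c_def)
  hence "Re u = Re (c\<^sup>2)" by simp
  hence "(Im c)\<^sup>2 < (Re c)\<^sup>2"
    using assms by (simp add: power2_eq_square)
  moreover have "Re c \<ge> 0" using csqrt_principal[of u] by (auto simp: c_def)
  ultimately show ?thesis unfolding c_def[symmetric] by (metis power2_less_imp_less power2_abs)
qed

text \<open>
  Both sides have the same square, and both have positive real part because a principal root of
  a number in the right half-plane has argument of modulus below \<open>\<pi>/4\<close>.
\<close>
lemma csqrt_mult_halfplane:
  assumes "Re u > 0" "Re v > 0" "Re z > 0" "u * v = - \<i> * z"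
  shows "csqrt u * csqrt v = exp (- (of_real pi * \<i> / 4)) * csqrt z"
proof -
  let ?a = "csqrt u * csqrt v" 
  let ?b = "exp (- (of_real pi * \<i> / 4)) * csqrt z"
  have cis: "exp (- (of_real pi * \<i> / 4)) = cis (- (pi / 4))"
    by (simp add: cis_conv_exp mult.commute)
  have e2: "(exp (- (of_real pi * \<i> / 4)))\<^sup>2 = - \<i>"
    unfolding cis power2_eq_square cis_mult by (simp add: complex_eq_iff)
  have "?a\<^sup>2 = ?b\<^sup>2" using assms(4) by (simp add: power_mult_distrib e2 del: power_inverse)
  hence "?a = ?b \<or> ?a = - ?b" by (simp add: power2_eq_iff)
  moreover have "Re ?a > 0"
  proof -
    have "\<bar>Im (csqrt u)\<bar> * \<bar>Im (csqrt v)\<bar> < Re (csqrt u) * Re (csqrt v)"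
      using csqrt_halfplane[OF assms(1)] csqrt_halfplane[OF assms(2)] by (intro mult_strict_mono') auto
    moreover have "Im (csqrt u) * Im (csqrt v) \<le> \<bar>Im (csqrt u)\<bar> * \<bar>Im (csqrt v)\<bar>"
      by (simp flip: abs_mult)
    ultimately show ?thesis unfolding times_complex.sel by linarith
  qed
  moreover have "Re ?b > 0"
  proof -
    have "Re ?b = (sqrt 2 / 2) * (Re (csqrt z) + Im (csqrt z))"
      unfolding cis by (simp add: cos_45 sin_45 algebra_simps)
    moreover have "Re (csqrt z) + Im (csqrt z) > 0" using csqrt_halfplane[OF assms(3)] by linarith
    hence "(sqrt 2 / 2) * (Re (csqrt z) + Im (csqrt z)) > 0" by (intro mult_pos_pos) auto
    ultimately show ?thesis by (simp only:)
  qed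
  ultimately show ?thesis by (metis less_asym neg_less_0_iff_less uminus_complex.sel(1))
qed

abbreviation eta_phase :: "int \<Rightarrow> int \<Rightarrow> nat \<Rightarrow> real" where
  "eta_phase h H k \<equiv> dedekind_sum h k + (of_int H - of_int h) / (12 * real k)"

text \<open>
  Descent on the denominator.  Reducing \<open>h\<close> modulo \<open>k\<close> is a translation; for \<open>0 < h < k\<close> the
  inversion leads from \<open>(h + iz)/k\<close> to \<open>(-k + iz')/h\<close>, whose denominator is smaller.  The second
  argument on the right-hand side is the same point before and after, and the exponents match exactly
  because of the reciprocity law.
\<close>
lemma inv_eta_modular:
  fixes h H :: int and k :: nat
  assumes "k > 0" "int k dvd h * H + 1" "Re z > 0"
  shows "inv_eta ((of_int h + \<i> * z) / of_nat k) =
     exp (of_real pi * \<i> * of_real (eta_phase h H k)) * csqrt z *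
     inv_eta ((of_int H + \<i> / z) / of_nat k)"
  using assms
proof (induction k arbitrary: h H z rule: less_induct)
  case (less k)
  have z0: "z \<noteq> 0" using less.prems by auto
  have coprime: "coprime h (int k)"
  proof -
    obtain m where "h * H + 1 = int k * m" using less.prems(2) by auto
    hence "h * (- H) + int k * m = 1" by simp
    thus ?thesis by (metis coprimeI dvd_add dvd_mult2)
  qed
  show ?case
  proof (cases "k = 1")
    case True
    have im: "Im (\<i> * z) > 0" using less.prems by simp
    have "inv_eta (\<i> * z) = csqrt z * inv_eta (\<i> / z)"
    proof -
      have "- 1 / (\<i> * z) = \<i> / z" using z0 by (simp add: divide_simps)
      moreover have "- \<i> * (\<i> * z) = z" by simp
      ultimately show ?thesis using inv_eta_inversion[OF im] by metis
    qed
    moreover have "inv_eta (of_int h + \<i> * z) = exp (- of_real pi * \<i> * of_int h / 12) * inv_eta (\<i> * z)"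
      using inv_eta_translation[of "\<i> * z" h] by (simp add: add.commute)
    moreover have "inv_eta (of_int H + \<i> / z) = exp (- of_real pi * \<i> * of_int H / 12) * inv_eta (\<i> / z)"
      using inv_eta_translation[of "\<i> / z" H] by (simp add: add.commute)
    moreover have "exp (of_real pi * \<i> * of_real ((of_int H - of_int h) / 12)) * exp (- of_real pi * \<i> * of_int H / 12) =
      exp (- of_real pi * \<i> * of_int h / 12)"
      unfolding exp_add[symmetric] by (rule arg_cong[of _ _ exp]) (simp add: field_simps)
    ultimately show ?thesis using True by (simp add: dedekind_sum_def mult_ac)
  next
    case False
    hence k1: "k > 1" using less.prems by simp
    define h0 where "h0 = nat (h mod int k)"
    define d where "d = h div int k"
    have h0: "int h0 = h mod int k" using k1 by (simp add: h0_def)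
    have hd: "h = int h0 + d * int k" by (simp add: h0 d_def)
    have "h mod int k \<noteq> 0"
    proof
      assume "h mod int k = 0"
      hence "int k dvd h" by auto
      with coprime have "int k dvd 1" by (meson coprime_common_divisor dvd_refl)
      thus False using k1 by auto
    qed
    hence h0pos: "h0 > 0" using h0 by (metis gr0I of_nat_0)
    have h0lt: "h0 < k" using h0 k1 by (metis of_nat_0_less_iff of_nat_less_iff pos_mod_bound less_trans zero_less_one)
    have "int k dvd int h0 * H + 1"
    proof -
      have "int h0 * H + 1 = h * H + 1 - int k * (d * H)" by (simp add: hd algebra_simps)
      thus ?thesis using less.prems(2) by (metis dvd_diff dvd_triv_left)
    qed
    then obtain H' where H': "int h0 * H + 1 = int k * H'" by auto
    have cop0: "coprime h0 k"
    proof -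
      have "coprime (int h0) (int k)" unfolding h0 using coprime k1 by simp
      thus ?thesis by simp
    qed
    let ?h = "of_nat h0 :: complex" 
    let ?k = "of_nat k :: complex"
    define \<tau> where "\<tau> = (?h + \<i> * z) / ?k"
    \<comment> \<open>chosen such that \<open>- 1 / \<tau> = (- k + i z') / h0\<close>\<close>
    define z' where "z' = ?k * z / (?h + \<i> * z)"
    have kz: "?k \<noteq> 0" "?h \<noteq> 0" using k1 h0pos by auto
    have nz: "?h + \<i> * z \<noteq> 0" using less.prems(3) by (auto simp: complex_eq_iff)
    have Im\<tau>: "Im \<tau> > 0" using less.prems k1 by (simp add: \<tau>_def Im_divide_of_nat)
    have Rez': "Re z' > 0"
    proof -
      have "z' = ?k * (z * (?h - \<i> * cnj z)) / of_real ((cmod (?h + \<i> * z))\<^sup>2)"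
      proof -
        have "of_real ((cmod (?h + \<i> * z))\<^sup>2) = (?h + \<i> * z) * (?h - \<i> * cnj z)"
          by (subst complex_norm_square) simp
        moreover have "?h - \<i> * cnj z \<noteq> 0" using less.prems(3) by (auto simp: complex_eq_iff)
        ultimately show ?thesis using nz by (simp add: z'_def)
      qed
      also have "Re \<dots> = real k * (real h0 * Re z) / (cmod (?h + \<i> * z))\<^sup>2"
        by (simp add: Re_divide_of_real algebra_simps)
      also have "\<dots> > 0" using nz k1 h0pos less.prems(3) by simp
      finally show ?thesis .
    qed
    have e1: "- 1 / \<tau> = (of_int (- int k) + \<i> * z') / of_nat h0"
      using kz nz unfolding \<tau>_def z'_def by (simp add: divide_simps) (simp add: algebra_simps)
    have HH: "?h * of_int H + 1 = ?k * of_int H'"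
      using arg_cong[OF H', of complex_of_int] by simp
    have e2: "(of_int H' + \<i> / z') / of_nat h0 = (of_int H + \<i> / z) / ?k"
    proof -
      have "\<i> / z' = \<i> * ?h / (?k * z) - 1 / ?k"
        using kz nz z0 unfolding z'_def by (simp add: field_simps)
      moreover have "of_int H' = (?h * of_int H + 1) / ?k" using HH kz by (simp add: field_simps)
      ultimately have "of_int H' + \<i> / z' = ?h * ((of_int H + \<i> / z) / ?k)"
        by (simp add: add_divide_distrib distrib_left mult.commute)
      thus ?thesis using kz by simp
    qed
    have "int h0 dvd (- int k) * H' + 1"
    proof -
      have "(- int k) * H' + 1 = - (int h0 * H)" using H' by simp
      thus ?thesis by simp
    qed
    note IH = less.IH[OF h0lt h0pos this Rez']
    have sq: "csqrt (- \<i> * \<tau>) * csqrt z' = exp (- (of_real pi * \<i> / 4)) * csqrt z"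
    proof (rule csqrt_mult_halfplane)
      show "Re (- \<i> * \<tau>) > 0" using Im\<tau> by simp
      show "- \<i> * \<tau> * z' = - \<i> * z" using kz nz by (simp add: \<tau>_def z'_def)
    qed (use Rez' less.prems in auto)
    define x where "x = dedekind_sum (- int k) h0 + (of_int H' - of_int (- int k)) / (12 * real h0)"
    define y where "y = dedekind_sum (int h0) k + (of_int H - real h0) / (12 * real k)"
    have "x - 1 / 4 = y"
    proof -
      have "dedekind_sum (- int k) h0 = - dedekind_sum (int k) h0"
        using cop0 by (intro dedekind_sum_minus) (simp add: coprime_commute)
      moreover have "dedekind_sum (int h0) k + dedekind_sum (int k) h0 =
          - 1 / 4 + (real h0 / real k + real k / real h0 + 1 / (real h0 * real k)) / 12"
        using dedekind_reciprocity[OF cop0 h0pos] k1 by simp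
      moreover have "real_of_int H' / real h0 = of_int H / real k + 1 / (real h0 * real k)"
      proof -
        have "real h0 * of_int H + 1 = real k * of_int H'" using arg_cong[OF H', of real_of_int] by simp
        thus ?thesis using h0pos k1 by (simp add: field_simps)
      qed
      ultimately show ?thesis unfolding x_def y_def
        using h0pos k1 by (simp add: add_divide_distrib diff_divide_distrib)
    qed
    hence xy: "exp (of_real pi * \<i> * of_real x) * exp (- (of_real pi * \<i> / 4)) = exp (of_real pi * \<i> * of_real y)"
      unfolding exp_add[symmetric] by (intro arg_cong[of _ _ exp]) (auto simp: algebra_simps)
    have "inv_eta \<tau> = csqrt (- \<i> * \<tau>) * inv_eta (- 1 / \<tau>)" by (rule inv_eta_inversion[OF Im\<tau>])
    also have "inv_eta (- 1 / \<tau>) = exp (of_real pi * \<i> * of_real x) * csqrt z' * inv_eta ((of_int H + \<i> / z) / ?k)"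
      unfolding e1 IH e2 x_def ..
    also have "csqrt (- \<i> * \<tau>) * (exp (of_real pi * \<i> * of_real x) * csqrt z' * inv_eta ((of_int H + \<i> / z) / ?k)) =
      exp (of_real pi * \<i> * of_real x) * (csqrt (- \<i> * \<tau>) * csqrt z') * inv_eta ((of_int H + \<i> / z) / ?k)"
      by (simp only: mult_ac)
    also have "\<dots> = exp (of_real pi * \<i> * of_real y) * csqrt z * inv_eta ((of_int H + \<i> / z) / ?k)"
      unfolding sq xy[symmetric] by (simp only: mult_ac)
    finally have main: "inv_eta \<tau> = exp (of_real pi * \<i> * of_real y) * csqrt z * inv_eta ((of_int H + \<i> / z) / ?k)" .
    have "(of_int h + \<i> * z) / ?k = \<tau> + of_int d"
      using kz by (simp add: \<tau>_def hd field_simps)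
    hence "inv_eta ((of_int h + \<i> * z) / ?k) = exp (- of_real pi * \<i> * of_int d / 12) * inv_eta \<tau>"
      by (simp only: inv_eta_translation)
    also have "\<dots> = (exp (- of_real pi * \<i> * of_int d / 12) * exp (of_real pi * \<i> * of_real y)) * csqrt z * inv_eta ((of_int H + \<i> / z) / ?k)"
      unfolding main by (simp only: mult_ac)
    also have "exp (- of_real pi * \<i> * of_int d / 12) * exp (of_real pi * \<i> * of_real y) =
       exp (of_real pi * \<i> * of_real (eta_phase h H k))"
    proof -
      have "dedekind_sum h k = dedekind_sum (int h0) k"
        unfolding h0 using k1 by (intro dedekind_sum_mod[symmetric]) auto
      hence "eta_phase h H k = y - of_int d / 12"
        using k1 by (simp add: y_def hd field_simps)
      hence "complex_of_real (eta_phase h H k) = of_real y - of_int d / 12"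
        by simp
      thus ?thesis unfolding exp_add[symmetric] by (simp only:) (simp add: algebra_simps)
    qed
    finally show ?thesis .
  qed
qed

text \<open>
  The transformation of \<open>1/\<eta>\<close> in terms of \<open>F\<close>; the exponential growth as \<open>z \<rightarrow> 0\<close> comes from the
  factor \<open>e\<^bsup>-\<pi>i\<tau>/12\<^esup>\<close> of \<open>1/\<eta>\<close> at the transformed point.
\<close>
theorem partition_gf_modular:
  fixes h H :: int and k :: nat
  assumes k: "k > 0" and hH: "int k dvd h * H + 1" and z: "Re z > 0"
  shows "partition_gf (exp (2 * of_real pi * \<i> * ((of_int h + \<i> * z) / of_nat k))) =
     exp (of_real pi * \<i> * of_real (dedekind_sum h k)) * csqrt z *
     exp (of_real pi / (12 * of_nat k * z) - of_real pi * z / (12 * of_nat k)) *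
     partition_gf (exp (2 * of_real pi * \<i> * ((of_int H + \<i> / z) / of_nat k)))"
proof -
  let ?t = "(of_int h + \<i> * z) / of_nat k"
  let ?t' = "(of_int H + \<i> / z) / of_nat k"
  have z0: "z \<noteq> 0" using z by auto
  have "partition_gf (exp (2 * of_real pi * \<i> * ?t)) = inv_eta ?t * exp (of_real pi * \<i> * ?t / 12)"
    unfolding inv_eta_def by (simp add: mult.assoc flip: exp_add)
  also have "\<dots> = exp (of_real pi * \<i> * of_real (eta_phase h H k)) * csqrt z *
     (partition_gf (exp (2 * of_real pi * \<i> * ?t')) * exp (- of_real pi * \<i> * ?t' / 12)) * exp (of_real pi * \<i> * ?t / 12)"
    unfolding inv_eta_modular[OF assms] unfolding inv_eta_def ..
  also have "\<dots> = (exp (of_real pi * \<i> * of_real (eta_phase h H k)) *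
      exp (- of_real pi * \<i> * ?t' / 12) * exp (of_real pi * \<i> * ?t / 12)) * csqrt z * partition_gf (exp (2 * of_real pi * \<i> * ?t'))"
    by (simp only: mult_ac)
  also have "exp (of_real pi * \<i> * of_real (eta_phase h H k)) *
      exp (- of_real pi * \<i> * ?t' / 12) * exp (of_real pi * \<i> * ?t / 12) =
      exp (of_real pi * \<i> * of_real (dedekind_sum h k)) * exp (of_real pi / (12 * of_nat k * z) - of_real pi * z / (12 * of_nat k))"
    unfolding exp_add[symmetric]
  proof (rule arg_cong[of _ _ exp])
    define s where "s = complex_of_real (dedekind_sum h k)"
    have "complex_of_real (eta_phase h H k) = s + (of_int H - of_int h) / (12 * of_nat k)"
      by (simp add: s_def)
    thus "of_real pi * \<i> * of_real (eta_phase h H k) +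
      - of_real pi * \<i> * ?t' / 12 + of_real pi * \<i> * ?t / 12 =
      of_real pi * \<i> * of_real (dedekind_sum h k) + (of_real pi / (12 * of_nat k * z) - of_real pi * z / (12 * of_nat k))"
      unfolding s_def[symmetric] using k z0 by (simp add: field_simps)
  qed
  finally show ?thesis by (simp only: mult_ac)
qed

section \<open>Farey dissection along Ford circles\<close>

text \<open>
  The denominator of the right neighbour of \<open>h/k\<close> in the Farey sequence of order \<open>N\<close>: neighbours
  \<open>h/k < h'/k'\<close> satisfy \<open>h' k - h k' = 1\<close> and \<open>k + k' > N\<close>, which leaves one residue class and one
  window of length \<open>k\<close>.  The left neighbour of \<open>h/k\<close> has denominator \<open>farey_next N (- h) k\<close>.
\<close>
definition farey_next :: "nat \<Rightarrow> int \<Rightarrow> int \<Rightarrow> int" where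
  "farey_next N h k = (THE m. int N - k < m \<and> m \<le> int N \<and> k dvd h * m + 1)"

lemma residue_window_unique:
  fixes k m m' B :: int
  assumes "k dvd m - m'" "B - k < m" "m \<le> B" "B - k < m'" "m' \<le> B"
  shows "m = m'"
proof (rule ccontr)
  assume "m \<noteq> m'"
  hence "\<bar>k\<bar> \<le> \<bar>m - m'\<bar>" using assms(1) by (intro dvd_imp_le_int) auto
  thus False using assms by linarith
qed

lemma farey_next_eqI:
  assumes "coprime h k" "int N - k < m" "m \<le> int N" "k dvd h * m + 1"
  shows "farey_next N h k = m"
  unfolding farey_next_def
proof (rule the_equality)
  fix m' assume m': "int N - k < m' \<and> m' \<le> int N \<and> k dvd h * m' + 1"
  have "k dvd (h * m' + 1) - (h * m + 1)" using m' assms by (intro dvd_diff) auto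
  hence "k dvd h * (m' - m)" by (simp add: algebra_simps)
  hence "k dvd m' - m" using assms(1) by (simp add: coprime_dvd_mult_right_iff coprime_commute)
  thus "m' = m" using m' assms by (intro residue_window_unique[of k m' m "int N"]) auto
qed (use assms in auto)

lemma farey_next_exists:
  fixes h k :: int
  assumes "coprime h k" "k > 0"
  obtains m where "int N - k < m" "m \<le> int N" "k dvd h * m + 1"
proof -
  obtain x where x: "[h * x = 1] (mod k)" using cong_solve_coprime_int[OF assms(1)] by blast
  \<comment> \<open>the representative of \<open>- x\<close> modulo \<open>k\<close> in the window\<close>
  define m where "m = int N - ((int N + x) mod k)"
  have "0 \<le> (int N + x) mod k" "(int N + x) mod k < k" using assms by auto
  moreover have "k dvd h * m + 1"
  proof -
    have "k dvd h * x - 1" using x by (simp add: cong_iff_dvd_diff)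
    moreover have "k dvd (int N + x) - (int N + x) mod k" by (simp add: minus_mod_eq_mult_div)
    hence "k dvd h * ((int N + x) - (int N + x) mod k)" by simp
    from this and \<open>k dvd h * x - 1\<close> have "k dvd h * ((int N + x) - (int N + x) mod k) - (h * x - 1)" by (rule dvd_diff)
    moreover have "h * ((int N + x) - (int N + x) mod k) - (h * x - 1) = h * m + 1"
      unfolding m_def by (simp only: algebra_simps)
    ultimately show ?thesis by simp
  qed
  ultimately show ?thesis by (intro that[of m]) (auto simp: m_def)
qed

lemma farey_next_props:
  assumes "coprime h k" "k > 0"
  shows "int N - k < farey_next N h k" "farey_next N h k \<le> int N" "k dvd h * farey_next N h k + 1"
proof -
  obtain m where m: "int N - k < m" "m \<le> int N" "k dvd h * m + 1" by (rule farey_next_exists[OF assms])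
  have "farey_next N h k = m" by (rule farey_next_eqI[OF assms(1) m])
  thus "int N - k < farey_next N h k" "farey_next N h k \<le> int N" "k dvd h * farey_next N h k + 1"
    using m by auto
qed

text \<open>
  The point at which the Ford circle of \<open>h/k\<close> touches that of its neighbour with denominator
  \<open>|m|\<close>, on the right for \<open>m > 0\<close> and on the left for \<open>m < 0\<close>.
\<close>
definition farey_tangency :: "int \<Rightarrow> int \<Rightarrow> int \<Rightarrow> complex" where
  "farey_tangency h k m = of_int h / of_int k + \<i> / (of_int k * (of_int k + \<i> * of_int m))"

text \<open>
  Neighbouring circles touch in a common point; this makes the sum over the arcs telescope.
\<close>
lemma farey_tangency_neighbour:
  fixes h k h' k' :: int
  assumes "k > 0" "k' > 0" "h' * k - h * k' = 1"
  shows "farey_tangency h k k' = farey_tangency h' k' (- k)"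
proof -
  have nz: "of_int k + \<i> * of_int k' \<noteq> 0" "of_int k' - \<i> * of_int k \<noteq> 0"
    using assms by (auto simp: complex_eq_iff)
  have e: "of_int k + \<i> * of_int k' = \<i> * (of_int k' - \<i> * complex_of_int k)" by (simp add: algebra_simps)
  have d: "of_int h' * of_int k - of_int h * of_int k' = (1::complex)"
    using arg_cong[OF assms(3), of complex_of_int] by simp
  have "farey_tangency h' k' (- k) - farey_tangency h k k' =
      (of_int h' / of_int k' - of_int h / of_int k) + \<i> / (of_int k' * (of_int k' - \<i> * of_int k)) - 1 / (of_int k * (of_int k' - \<i> * of_int k))"
    unfolding farey_tangency_def e by simp
  also have "of_int h' / of_int k' - of_int h / of_int k = 1 / (of_int k * complex_of_int k')"
    using assms(1,2) d by (simp add: field_simps)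
  also have "1 / (of_int k * complex_of_int k') + \<i> / (of_int k' * (of_int k' - \<i> * of_int k)) - 1 / (of_int k * (of_int k' - \<i> * of_int k)) = 0"
    using assms(1,2) nz by (simp add: field_simps)
  finally show ?thesis by simp
qed

definition farey_between :: "nat \<Rightarrow> int \<Rightarrow> int \<Rightarrow> int \<Rightarrow> int \<Rightarrow> (int \<times> int) set" where
  "farey_between N h k h' k' = {(a, b). coprime a b \<and> 0 < b \<and> b \<le> int N \<and> h * b < a * k \<and> a * k' < h' * b}"

text \<open>
  \<open>b\<close> is the combination of \<open>k'\<close> and \<open>k\<close> with the positive integers \<open>a k - h b\<close> and \<open>h' b - a k'\<close> as
  coefficients.
\<close>
lemma mediant_denominator_le:
  fixes h k h' k' a b :: int
  assumes "k > 0" "k' > 0" "h' * k - h * k' = 1" "h * b < a * k" "a * k' < h' * b"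
  shows "k + k' \<le> b"
proof -
  have "b = k' * (a * k - h * b) + k * (h' * b - a * k')"
  proof -
    have "k' * (a * k - h * b) + k * (h' * b - a * k') = b * (h' * k - h * k')" by (simp add: algebra_simps)
    thus ?thesis using assms(3) by simp
  qed
  moreover have "k' * 1 \<le> k' * (a * k - h * b)" "k * 1 \<le> k * (h' * b - a * k')"
    using assms by (intro mult_left_mono; simp)+
  ultimately show ?thesis by linarith
qed

lemma finite_farey_between:
  assumes "k > 0" "k' > 0"
  shows "finite (farey_between N h k h' k')"
proof (rule finite_subset)
  let ?S = "SIGMA b:{1..int N}. {(h * b) div k..(h' * b) div k'}"
  show "finite (prod.swap ` ?S)" by (intro finite_imageI finite_SigmaI) auto
  show "farey_between N h k h' k' \<subseteq> prod.swap ` ?S"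
  proof
    fix x assume "x \<in> farey_between N h k h' k'"
    then obtain a b where x: "x = prod.swap (b, a)" "0 < b" "b \<le> int N" "h * b < a * k" "a * k' < h' * b"
      by (auto simp: farey_between_def)
    have "(h * b) div k \<le> a" "a \<le> (h' * b) div k'"
      using zdiv_mono1[of "h * b" "a * k" k] zdiv_mono1[of "a * k'" "h' * b" k'] x assms by auto
    thus "x \<in> prod.swap ` ?S" unfolding x(1) using x by (intro imageI) auto
  qed
qed

lemma coprime_of_det:
  fixes h k h' k' :: int
  assumes "h' * k - h * k' = 1"
  shows "coprime h k" "coprime h' k'"
proof -
  show "coprime h k"
  proof (rule coprimeI)
    fix c assume "c dvd h" "c dvd k"
    hence "c dvd h' * k - h * k'" by (intro dvd_diff dvd_mult dvd_mult2)
    thus "is_unit c" using assms by simp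
  qed
  show "coprime h' k'"
  proof (rule coprimeI)
    fix c assume "c dvd h'" "c dvd k'"
    hence "c dvd h' * k - h * k'" by (intro dvd_diff dvd_mult dvd_mult2)
    thus "is_unit c" using assms by simp
  qed
qed

lemma farey_between_split:
  fixes h k h' k' :: int
  assumes "k > 0" "k' > 0" "h' * k - h * k' = 1" "k + k' \<le> int N"
  shows "farey_between N h k h' k' =
     insert (h + h', k + k') (farey_between N h k (h + h') (k + k') \<union> farey_between N (h + h') (k + k') h' k')"
proof -
  have "(a, b) \<in> farey_between N h k h' k' \<longleftrightarrow> (a, b) = (h + h', k + k') \<or>
     (a, b) \<in> farey_between N h k (h + h') (k + k') \<or> (a, b) \<in> farey_between N (h + h') (k + k') h' k'" for a b
  proof
    assume L: "(a, b) \<in> farey_between N h k h' k'"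
    hence ab: "coprime a b" "0 < b" "b \<le> int N" "h * b < a * k" "a * k' < h' * b"
      by (auto simp: farey_between_def)
    consider "a * (k + k') < (h + h') * b" | "(h + h') * b < a * (k + k')" | "a * (k + k') = (h + h') * b" by linarith
    thus "(a, b) = (h + h', k + k') \<or>
     (a, b) \<in> farey_between N h k (h + h') (k + k') \<or> (a, b) \<in> farey_between N (h + h') (k + k') h' k'"
    proof cases
      case 3
      have co: "coprime (h + h') (k + k')"
        using coprime_of_det(1)[of h' "k + k'" "h + h'" k'] assms(3) by (simp add: algebra_simps)
      have "b dvd (k + k')"
      proof -
        have "b dvd a * (k + k')" using 3 by simp
        thus ?thesis using ab(1) by (simp add: coprime_dvd_mult_right_iff coprime_commute)
      qed
      moreover have "(k + k') dvd b"
      proof -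
        have "(k + k') dvd (h + h') * b" using 3 by (metis dvd_triv_right)
        thus ?thesis using co by (simp add: coprime_dvd_mult_right_iff coprime_commute)
      qed
      ultimately have "b = k + k'" using ab(2) assms(1,2) by (simp add: zdvd_antisym_nonneg)
      moreover from this have "a = h + h'" using 3 assms(1,2) by simp
      ultimately show ?thesis by simp
    qed (use ab in \<open>auto simp: farey_between_def\<close>)
  next
    assume "(a, b) = (h + h', k + k') \<or>
     (a, b) \<in> farey_between N h k (h + h') (k + k') \<or> (a, b) \<in> farey_between N (h + h') (k + k') h' k'"
    thus "(a, b) \<in> farey_between N h k h' k'"
    proof (elim disjE)
      assume "(a, b) = (h + h', k + k')"
      moreover have "coprime (h + h') (k + k')"
        using coprime_of_det(1)[of h' "k + k'" "h + h'" k'] assms(3) by (simp add: algebra_simps)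
      moreover have "h * (k + k') < (h + h') * k" "(h + h') * k' < h' * (k + k')"
        using assms(3) by (simp_all add: algebra_simps)
      ultimately show ?thesis using assms by (simp add: farey_between_def)
    qed (auto simp: farey_between_def algebra_simps)
  qed
  thus ?thesis by auto
qed

definition farey_arc :: "(complex \<Rightarrow> complex) \<Rightarrow> nat \<Rightarrow> int \<Rightarrow> int \<Rightarrow> complex" where
  "farey_arc \<Phi> N h k = \<Phi> (farey_tangency h k (farey_next N h k)) - \<Phi> (farey_tangency h k (- farey_next N (- h) k))"

text \<open>
  Induction along the Stern--Brocot tree: the mediant splits the interval in two as long as its
  denominator is at most \<open>N\<close>, and otherwise \<open>h/k\<close> and \<open>h'/k'\<close> are neighbours.
\<close>
lemma farey_telescope:
  fixes h k h' k' :: int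
  assumes "k > 0" "k' > 0" "k \<le> int N" "k' \<le> int N" "h' * k - h * k' = 1"
  shows "(\<Sum>(a, b)\<in>farey_between N h k h' k'. farey_arc \<Phi> N a b) =
     \<Phi> (farey_tangency h' k' (- farey_next N (- h') k')) - \<Phi> (farey_tangency h k (farey_next N h k))"
  using assms
proof (induction "nat (2 * int N - (k + k'))" arbitrary: h k h' k' rule: less_induct)
  case less
  note co = coprime_of_det[OF less.prems(5)]
  show ?case
  proof (cases "k + k' \<le> int N")
    case False
    have "farey_between N h k h' k' = {}"
      using mediant_denominator_le[OF less.prems(1,2,5)] False by (fastforce simp: farey_between_def)
    moreover have "farey_next N h k = k'"
    proof (rule farey_next_eqI)
      have "h * k' + 1 = k * h'" using less.prems(5) by (simp add: algebra_simps)
      thus "k dvd h * k' + 1" by simp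
    qed (use co False less.prems in auto)
    moreover have "farey_next N (- h') k' = k"
    proof (rule farey_next_eqI)
      have "- h' * k + 1 = k' * (- h)" using less.prems(5) by (simp add: algebra_simps)
      thus "k' dvd - h' * k + 1" by (metis dvd_triv_left)
    qed (use co False less.prems in auto)
    ultimately show ?thesis using farey_tangency_neighbour[OF less.prems(1,2,5)] by simp
  next
    case True
    let ?A = "farey_between N h k (h + h') (k + k')" 
    let ?B = "farey_between N (h + h') (k + k') h' k'"
    let ?s = "\<lambda>S. \<Sum>(a, b)\<in>S. farey_arc \<Phi> N a b"
    have fin: "finite ?A" "finite ?B" using less.prems by (auto intro!: finite_farey_between)
    have IH1: "?s ?A = \<Phi> (farey_tangency (h + h') (k + k') (- farey_next N (- (h + h')) (k + k')))
         - \<Phi> (farey_tangency h k (farey_next N h k))"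
      using less.prems True by (intro less.hyps) (auto simp: algebra_simps)
    have IH2: "?s ?B = \<Phi> (farey_tangency h' k' (- farey_next N (- h') k'))
         - \<Phi> (farey_tangency (h + h') (k + k') (farey_next N (h + h') (k + k')))"
      using less.prems True by (intro less.hyps) (auto simp: algebra_simps)
    have "?A \<inter> ?B = {}" by (auto simp: farey_between_def)
    moreover have "(h + h', k + k') \<notin> ?A \<union> ?B" by (auto simp: farey_between_def)
    ultimately have "?s (farey_between N h k h' k') = farey_arc \<Phi> N (h + h') (k + k') + (?s ?A + ?s ?B)"
      unfolding farey_between_split[OF less.prems(1,2,5) True] using fin
      by (simp add: sum.union_disjoint)
    also have "\<dots> = \<Phi> (farey_tangency h' k' (- farey_next N (- h') k')) - \<Phi> (farey_tangency h k (farey_next N h k))"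
      unfolding IH1 IH2 by (simp add: farey_arc_def)
    finally show ?thesis .
  qed
qed

text \<open>
  The fractions in \<open>(0, 1]\<close> are those between \<open>0/1\<close> and \<open>1/1\<close> together with \<open>1/1\<close>, and the last
  tangency point is the first one shifted by \<open>1\<close>.
\<close>
theorem farey_dissection:
  fixes \<Phi> :: "complex \<Rightarrow> complex"
  assumes N: "N > 0"
  shows "(\<Sum>k=1..N. \<Sum>h\<in>{h::nat. 1 \<le> h \<and> h \<le> k \<and> coprime h k}. farey_arc \<Phi> N (int h) (int k)) =
     \<Phi> (farey_tangency 0 1 (int N) + 1) - \<Phi> (farey_tangency 0 1 (int N))"
proof -
  let ?C = "\<lambda>k. {h::nat. 1 \<le> h \<and> h \<le> k \<and> coprime h k}"
  have finC: "finite (?C k)" for k by (rule finite_subset[of _ "{1..k}"]) auto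
  have "(\<Sum>k=1..N. \<Sum>h\<in>?C k. farey_arc \<Phi> N (int h) (int k)) =
     (\<Sum>(k, h)\<in>(SIGMA k:{1..N}. ?C k). farey_arc \<Phi> N (int h) (int k))"
    using finC by (intro sum.Sigma) auto
  also have "\<dots> = (\<Sum>(a, b)\<in>insert (1, 1) (farey_between N 0 1 1 1). farey_arc \<Phi> N a b)"
  proof (rule sum.reindex_bij_witness[of _ "\<lambda>(a, b). (nat b, nat a)" "\<lambda>(k, h). (int h, int k)"], goal_cases)
    case (2 x)
    then obtain k h where x: "x = (k, h)" "1 \<le> k" "k \<le> N" "1 \<le> h" "h \<le> k" "coprime h k" by auto
    show ?case
    proof (cases "h = k")
      case True
      hence "k = 1" using x by simp
      thus ?thesis using x True by simp
    next
      case False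
      thus ?thesis using x by (auto simp: farey_between_def)
    qed
  next
    case (4 x)
    then consider "x = (1, 1)" | a b where "x = (a, b)" "(a, b) \<in> farey_between N 0 1 1 1"
      by (cases x) auto
    thus ?case
    proof cases
      case 2
      have "coprime (int (nat a)) (int (nat b))"
        using 2 by (auto simp: farey_between_def)
      hence "coprime (nat a) (nat b)" unfolding coprime_int_iff .
      thus ?thesis using 2 by (auto simp: farey_between_def)
    qed (use N in auto)
  qed (auto simp: farey_between_def)
  also have "\<dots> = farey_arc \<Phi> N 1 1 + (\<Sum>(a, b)\<in>farey_between N 0 1 1 1. farey_arc \<Phi> N a b)"
    using finite_farey_between[of 1 1 N 0 1] by (subst sum.insert) (auto simp: farey_between_def)
  also have "(\<Sum>(a, b)\<in>farey_between N 0 1 1 1. farey_arc \<Phi> N a b) =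
      \<Phi> (farey_tangency 1 1 (- farey_next N (- 1) 1)) - \<Phi> (farey_tangency 0 1 (farey_next N 0 1))"
    using N by (intro farey_telescope) auto
  also have "farey_next N 0 1 = int N" by (rule farey_next_eqI) auto
  finally have "(\<Sum>k=1..N. \<Sum>h\<in>?C k. farey_arc \<Phi> N (int h) (int k)) =
     \<Phi> (farey_tangency 1 1 (farey_next N 1 1)) - \<Phi> (farey_tangency 0 1 (int N))"
    by (simp add: farey_arc_def)
  also have "farey_next N 1 1 = int N" by (rule farey_next_eqI) auto
  also have "farey_tangency 1 1 (int N) = farey_tangency 0 1 (int N) + 1"
    by (simp add: farey_tangency_def)
  finally show ?thesis .
qed

section \<open>A Bessel integral in closed form\<close>

lemma gaussian_integrable:
  fixes a :: real assumes a: "a > 0"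
  shows "integrable lborel (\<lambda>t. exp (- a * t\<^sup>2))"
proof -
  define \<sigma> where "\<sigma> = 1 / sqrt (2 * a)"
  have s: "\<sigma> > 0" using a by (simp add: \<sigma>_def)
  have s2: "2 * \<sigma>\<^sup>2 = 1 / a" using a by (simp add: \<sigma>_def power_divide)
  have "integrable lborel (\<lambda>t. sqrt (2 * pi * \<sigma>\<^sup>2) * normal_density 0 \<sigma> t)"
    by (intro integrable_mult_right integrable_normal_density s)
  also have "(\<lambda>t. sqrt (2 * pi * \<sigma>\<^sup>2) * normal_density 0 \<sigma> t) = (\<lambda>t. exp (- a * t\<^sup>2))"
    unfolding normal_density_def s2 using s a by (simp add: fun_eq_iff mult.commute)
  finally show ?thesis .
qed

abbreviation vline :: "real \<Rightarrow> complex" where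
  "vline t \<equiv> 1 + \<i> * complex_of_real t"

lemma Re_one_plus_ii_square: "Re ((vline t)\<^sup>2) = 1 - t\<^sup>2"
  by (simp add: power2_eq_square)

lemma norm_one_plus_ii_square: "(norm (vline t))\<^sup>2 = 1 + t\<^sup>2"
  by (simp add: cmod_power2)

lemma norm_one_plus_ii_ge: "norm (vline t) \<ge> 1"
  using abs_Re_le_cmod[of "vline t"] by simp

lemma one_plus_ii_nonzero: "vline t \<noteq> 0"
  using norm_one_plus_ii_ge[of t] by auto

text \<open>
  In the variable \<open>x = y\<^sup>2\<close> the line \<open>y = 1 + it\<close> is a parabola, and these are, up to a
  constant, the integrands of Hankel's formula for \<open>1 / \<Gamma>((m + 1) / 2)\<close>.
\<close>
definition parabola_gauss :: "real \<Rightarrow> nat \<Rightarrow> real \<Rightarrow> complex" where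
  "parabola_gauss a m t = exp (of_real a * (vline t)\<^sup>2) / (vline t) ^ m"

abbreviation parabola_moment :: "real \<Rightarrow> nat \<Rightarrow> complex" where
  "parabola_moment a m \<equiv> (LINT t|lborel. parabola_gauss a m t)"

lemma norm_parabola_gauss_le: "norm (parabola_gauss a m t) \<le> exp a * exp (- a * t\<^sup>2)"
proof -
  have "norm (parabola_gauss a m t) \<le> norm (exp (of_real a * (vline t)\<^sup>2)) / 1"
    unfolding parabola_gauss_def norm_divide norm_power
    using norm_one_plus_ii_ge[of t] by (intro frac_le one_le_power) auto
  also have "\<dots> = exp (a * (1 - t\<^sup>2))"
    by (simp only: norm_exp_eq_Re Re_complex_of_real times_complex.sel Im_complex_of_real Re_one_plus_ii_square) simp
  also have "\<dots> = exp a * exp (- a * t\<^sup>2)" by (simp add: algebra_simps flip: exp_add)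
  finally show ?thesis .
qed

lemma parabola_gauss_continuous: "continuous_on S (parabola_gauss a m)"
  unfolding parabola_gauss_def by (intro continuous_intros) (simp add: one_plus_ii_nonzero)

lemma parabola_gauss_measurable [measurable]: "parabola_gauss a m \<in> borel_measurable borel"
  by (intro borel_measurable_continuous_onI parabola_gauss_continuous)

lemma parabola_gauss_integrable:
  assumes a: "a > 0"
  shows "integrable lborel (parabola_gauss a m)"
proof (rule Bochner_Integration.integrable_bound)
  show "integrable lborel (\<lambda>t. exp a * exp (- a * t\<^sup>2))"
    by (intro integrable_mult_right gaussian_integrable a)
  show "AE t in lborel. norm (parabola_gauss a m t) \<le> norm (exp a * exp (- a * t\<^sup>2))"
    using norm_parabola_gauss_le by simp
qed measurable

text \<open>
  Up to scaling this is the characteristic function of the normal distribution, since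
  \<open>(1 + it)\<^sup>2 = 1 - t\<^sup>2 + 2it\<close>.
\<close>
lemma parabola_gauss_0:
  assumes a: "a > 0"
  shows "parabola_moment a 0 = of_real (sqrt (pi / a))"
proof -
  define c where "c = sqrt (2 * a)"
  have c: "c > 0" "c\<^sup>2 = 2 * a" using a by (auto simp: c_def)
  have "complex_of_real (exp (- (c\<^sup>2) / 2)) = char std_normal_distribution c"
    by (simp add: char_std_normal_distribution)
  also have "\<dots> = (LINT x|lborel. std_normal_density x *\<^sub>R iexp (c * x))"
    unfolding char_def by (subst integral_density) auto
  also have "\<dots> = \<bar>c\<bar> *\<^sub>R (LINT t|lborel. std_normal_density (0 + c * t) *\<^sub>R iexp (c * (0 + c * t)))"
    using c by (intro lborel_integral_real_affine) auto
  also have "(\<lambda>t. std_normal_density (0 + c * t) *\<^sub>R iexp (c * (0 + c * t))) =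
     (\<lambda>t. of_real (exp (- a) / sqrt (2 * pi)) * parabola_gauss a 0 t)"
  proof
    fix t
    have e: "exp (of_real a * (vline t)\<^sup>2) = of_real (exp a) * (of_real (exp (- a * t\<^sup>2)) * iexp (2 * a * t))"
      unfolding exp_of_real[symmetric] exp_add[symmetric]
      by (rule arg_cong[of _ _ exp]) (simp add: power2_eq_square algebra_simps)
    have e1: "c * (0 + c * t) = 2 * a * t" using c(2) by (simp add: power2_eq_square)
    have "(c * t)\<^sup>2 / 2 = a * t\<^sup>2" using c(2) by (simp add: power_mult_distrib)
    hence e2: "std_normal_density (0 + c * t) = exp (- a * t\<^sup>2) / sqrt (2 * pi)"
      by (simp add: std_normal_density_def)
    have ea: "complex_of_real (exp (- a)) * of_real (exp a) = 1"
      by (simp flip: of_real_mult exp_add)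
    have "of_real (exp (- a) / sqrt (2 * pi)) * parabola_gauss a 0 t =
      (of_real (exp (- a)) * of_real (exp a)) * (of_real (exp (- a * t\<^sup>2)) * iexp (2 * a * t)) / of_real (sqrt (2 * pi))"
      unfolding parabola_gauss_def e by simp
    thus "std_normal_density (0 + c * t) *\<^sub>R iexp (c * (0 + c * t)) =
       of_real (exp (- a) / sqrt (2 * pi)) * parabola_gauss a 0 t"
      unfolding e1 e2 ea by (simp add: scaleR_conv_of_real)
  qed
  finally have "complex_of_real (exp (- a)) = of_real (c * (exp (- a) / sqrt (2 * pi))) * parabola_moment a 0"
    using c by (simp add: scaleR_conv_of_real mult.assoc)
  hence "complex_of_real (exp (- a)) * 1 =
      complex_of_real (exp (- a)) * (of_real (c / sqrt (2 * pi)) * parabola_moment a 0)"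
    by (simp add: mult_ac)
  hence "1 = of_real (c / sqrt (2 * pi)) * parabola_moment a 0"
    unfolding mult_cancel_left by simp
  moreover have "c / sqrt (2 * pi) = 1 / sqrt (pi / a)"
    using a by (simp add: c_def real_sqrt_divide real_sqrt_mult field_simps)
  ultimately have "1 = of_real (1 / sqrt (pi / a)) * parabola_moment a 0" by metis
  moreover have "sqrt (pi / a) > 0" using a by simp
  ultimately show ?thesis by (simp add: field_simps)
qed

text \<open>
  The derivative of \<open>y\<^bsup>-m-1\<^esup> exp (a y\<^sup>2)\<close> integrates to zero along the line.
\<close>
lemma parabola_gauss_rec:
  assumes a: "a > 0"
  shows "of_nat (Suc m) * parabola_moment a (Suc (Suc m)) = 2 * of_real a * parabola_moment a m"
proof -
  let ?F = "parabola_gauss a (Suc m)"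
  let ?f = "\<lambda>t. \<i> * (2 * of_real a * parabola_gauss a m t - of_nat (Suc m) * parabola_gauss a (Suc (Suc m)) t)"
  have int: "integrable lborel ?f"
    by (intro integrable_mult_right Bochner_Integration.integrable_diff parabola_gauss_integrable a)
  have lim: "(?F \<longlongrightarrow> 0) at_top" "(?F \<longlongrightarrow> 0) at_bot"
  proof -
    have "((\<lambda>t::real. exp a * exp (- a * t\<^sup>2)) \<longlongrightarrow> 0) at_top" "((\<lambda>t::real. exp a * exp (- a * t\<^sup>2)) \<longlongrightarrow> 0) at_bot"
      using a by real_asymp+
    moreover have "(?F \<longlongrightarrow> 0) F" if "((\<lambda>t. exp a * exp (- a * t\<^sup>2)) \<longlongrightarrow> 0) F" for F
    proof (rule Lim_null_comparison)
      show "eventually (\<lambda>t. norm (?F t) \<le> exp a * exp (- a * t\<^sup>2)) F"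
        by (intro always_eventually allI norm_parabola_gauss_le)
    qed (rule that)
    ultimately show "(?F \<longlongrightarrow> 0) at_top" "(?F \<longlongrightarrow> 0) at_bot" by blast+
  qed
  have "(LBINT t=-\<infinity>..\<infinity>. ?f t) = 0 - 0"
  proof (rule interval_integral_FTC_integrable)
    fix t :: real
    let ?y = "vline t"
    have "((\<lambda>y. exp (of_real a * y\<^sup>2) / y ^ Suc m) has_field_derivative
        (2 * of_real a * (exp (of_real a * ?y\<^sup>2) / ?y ^ m) - of_nat (Suc m) * (exp (of_real a * ?y\<^sup>2) / ?y ^ Suc (Suc m)))) (at ?y)"
    proof -
      define y where "y = ?y"
      define E where "E = exp (of_real a * y\<^sup>2)"
      define Y where "Y = y ^ m"
      have y0: "y \<noteq> 0" unfolding y_def by (rule one_plus_ii_nonzero)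
      hence Y0: "Y \<noteq> 0" by (simp add: Y_def)
      have dE: "((\<lambda>y. exp (of_real a * y\<^sup>2)) has_field_derivative E * (of_real a * (2 * y))) (at y)"
        unfolding E_def by (auto intro!: derivative_eq_intros)
      have dY: "((\<lambda>y. y ^ Suc m) has_field_derivative of_nat (Suc m) * Y) (at y)"
        by (rule DERIV_cong[OF DERIV_power[OF DERIV_ident]]) (simp add: Y_def)
      have "((\<lambda>y. exp (of_real a * y\<^sup>2) / y ^ Suc m) has_field_derivative
         (E * (of_real a * (2 * y)) * (y * Y) - E * (of_nat (Suc m) * Y)) / (y * Y * (y * Y))) (at y)"
        using DERIV_divide[OF dE dY] y0 by (simp add: E_def Y_def)
      also have "(E * (of_real a * (2 * y)) * (y * Y) - E * (of_nat (Suc m) * Y)) / (y * Y * (y * Y)) =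
          2 * of_real a * (E / Y) - of_nat (Suc m) * (E / (y * (y * Y)))"
        using y0 Y0 by (simp add: diff_divide_distrib mult_ac del: of_nat_Suc)
      finally show ?thesis by (simp add: y_def[symmetric] E_def Y_def)
    qed
    moreover have "((\<lambda>t. 1 + \<i> * complex_of_real t) has_vector_derivative \<i>) (at t)"
      by (auto intro!: derivative_eq_intros)
    ultimately have "(((\<lambda>y. exp (of_real a * y\<^sup>2) / y ^ Suc m) \<circ> (\<lambda>t. 1 + \<i> * complex_of_real t)) has_vector_derivative
       \<i> * (2 * of_real a * (exp (of_real a * ?y\<^sup>2) / ?y ^ m) - of_nat (Suc m) * (exp (of_real a * ?y\<^sup>2) / ?y ^ Suc (Suc m)))) (at t)"
      by (rule field_vector_diff_chain_at[rotated])
    thus "(?F has_vector_derivative ?f t) (at t)"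
      by (simp only: o_def parabola_gauss_def[abs_def])
    show "isCont ?f t"
      using parabola_gauss_continuous[of UNIV] by (intro continuous_intros) (auto simp: continuous_on_eq_continuous_at)
  next
    show "set_integrable lborel (einterval (-\<infinity>) \<infinity>) ?f" using int by (simp add: set_integrable_def)
    show "((?F \<circ> real_of_ereal) \<longlongrightarrow> 0) (at_right (-\<infinity>))" using lim by (simp add: ereal_tendsto_simps)
    show "((?F \<circ> real_of_ereal) \<longlongrightarrow> 0) (at_left \<infinity>)" using lim by (simp add: ereal_tendsto_simps)
  qed simp
  hence "(LINT t|lborel. ?f t) = 0"
    by (simp add: interval_lebesgue_integral_def set_lebesgue_integral_def)
  also have "(LINT t|lborel. ?f t) = \<i> * (2 * of_real a * parabola_moment a m - of_nat (Suc m) * parabola_moment a (Suc (Suc m)))"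
    by (subst integral_mult_right_zero, subst Bochner_Integration.integral_diff)
       (simp_all add: parabola_gauss_integrable a integrable_mult_right del: of_nat_Suc)
  finally show ?thesis by simp
qed

lemma parabola_gauss_even:
  assumes a: "a > 0"
  shows "parabola_moment a (2 * j + 4) =
    of_real (sqrt (pi / a) * (2 * a) ^ (j + 2) * 2 ^ (j + 1) * fact (j + 1) / fact (2 * j + 3))"
proof (induction j)
  case 0
  have "parabola_moment a 2 = 2 * of_real a * of_real (sqrt (pi / a))"
    using parabola_gauss_rec[OF a, of 0] parabola_gauss_0[OF a] by (simp add: numeral_2_eq_2)
  moreover have "3 * parabola_moment a 4 = 2 * of_real a * parabola_moment a 2"
    using parabola_gauss_rec[OF a, of 2] by (simp add: eval_nat_numeral)
  ultimately have "parabola_moment a 4 = 4 * of_real a * of_real a * of_real (sqrt (pi / a)) / 3" by (simp add: field_simps)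
  thus ?case by (simp add: power2_eq_square fact_numeral eval_nat_numeral)
next
  case (Suc j)
  let ?q = "\<lambda>j. sqrt (pi / a) * (2 * a) ^ (j + 2) * 2 ^ (j + 1) * fact (j + 1) / fact (2 * j + 3)"
  have "of_nat (2 * j + 5) * parabola_moment a (2 * Suc j + 4) = 2 * of_real a * of_real (?q j)"
    using parabola_gauss_rec[OF a, of "2 * j + 4"] Suc by (simp add: eval_nat_numeral)
  hence "parabola_moment a (2 * Suc j + 4) = 2 * of_real a * of_real (?q j) / of_nat (2 * j + 5)"
    by (metis nonzero_mult_div_cancel_left of_nat_eq_0_iff add_is_0 zero_neq_numeral)
  also have "\<dots> = of_real (2 * a * ?q j / real (2 * j + 5))" by (simp only: of_real_mult of_real_divide of_real_numeral of_real_of_nat_eq)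
  also have "2 * a * ?q j / real (2 * j + 5) = ?q (Suc j)"
  proof -
    have "fact (2 * Suc j + 3) = real (2 * j + 5) * (real (2 * j + 4) * fact (2 * j + 3))"
      by (simp add: eval_nat_numeral del: of_nat_Suc)
    moreover have "(fact (Suc j + 1) :: real) = real (j + 2) * fact (j + 1)" by simp
    moreover have "real (2 * j + 4) = 2 * real (j + 2)" by simp
    moreover have "real (j + 2) \<noteq> 0" "real (2 * j + 5) \<noteq> 0" "fact (2 * j + 3) \<noteq> (0::real)" by simp_all
    ultimately show ?thesis by (simp add: divide_simps del: of_nat_add of_nat_mult of_nat_Suc)
  qed
  finally show ?case .
qed

definition bessel_integrand :: "real \<Rightarrow> real \<Rightarrow> complex \<Rightarrow> complex" where
  "bessel_integrand a b y = 2 / y ^ 4 * exp (of_real a * y\<^sup>2 + of_real b / y\<^sup>2)"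

lemma norm_bessel_integrand_le:
  assumes "b \<ge> 0" "norm y \<ge> 1"
  shows "norm (bessel_integrand a b y) \<le> 2 / norm y ^ 4 * (exp b * exp (a * Re (y\<^sup>2)))"
proof -
  have "Re (of_real b / y\<^sup>2) \<le> norm (of_real b / y\<^sup>2)" by (rule complex_Re_le_cmod)
  also have "\<dots> = b / (norm y)\<^sup>2" using assms by (simp add: norm_divide norm_power)
  also have "\<dots> \<le> b / 1" using assms by (intro divide_left_mono) (auto intro: one_le_power)
  finally have "Re (of_real a * y\<^sup>2 + of_real b / y\<^sup>2) \<le> b + a * Re (y\<^sup>2)" by simp
  hence "norm (exp (of_real a * y\<^sup>2 + of_real b / y\<^sup>2)) \<le> exp b * exp (a * Re (y\<^sup>2))"
    unfolding norm_exp_eq_Re by (simp only: exp_le_cancel_iff exp_add[symmetric])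
  thus ?thesis unfolding bessel_integrand_def norm_mult norm_divide norm_power
    by (intro mult_mono) auto
qed

lemma norm_bessel_integrand_line_le:
  assumes "b \<ge> 0"
  shows "norm (bessel_integrand a b (vline t)) \<le> 2 / (1 + t\<^sup>2)\<^sup>2 * (exp (a + b) * exp (- a * t\<^sup>2))"
proof -
  have "norm (vline t) ^ 4 = (1 + t\<^sup>2)\<^sup>2"
    unfolding norm_one_plus_ii_square[symmetric] by simp
  moreover have "exp b * exp (a * (1 - t\<^sup>2)) = exp (a + b) * exp (- a * t\<^sup>2)"
    by (simp add: algebra_simps flip: exp_add)
  ultimately show ?thesis
    using norm_bessel_integrand_le[OF assms norm_one_plus_ii_ge[of t], of a]
    by (simp only: Re_one_plus_ii_square)
qed

lemma bessel_integrand_line_continuous: "continuous_on S (\<lambda>t. bessel_integrand a b (vline t))"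
  unfolding bessel_integrand_def by (intro continuous_intros) (simp_all add: one_plus_ii_nonzero)

lemma bessel_integrand_line_integrable:
  assumes "a > 0" "b \<ge> 0"
  shows "integrable lborel (\<lambda>t. bessel_integrand a b (vline t))"
proof (rule Bochner_Integration.integrable_bound)
  show "integrable lborel (\<lambda>t. 2 * (exp (a + b) * exp (- a * t\<^sup>2)))"
    by (intro integrable_mult_right gaussian_integrable assms)
  show "AE t in lborel. norm (bessel_integrand a b (vline t)) \<le> norm (2 * (exp (a + b) * exp (- a * t\<^sup>2)))"
  proof (rule AE_I2)
    fix t :: real
    have "2 / (1 + t\<^sup>2)\<^sup>2 \<le> 2 / 1" by (intro frac_le one_le_power) auto
    hence "2 / (1 + t\<^sup>2)\<^sup>2 * (exp (a + b) * exp (- a * t\<^sup>2)) \<le> 2 * (exp (a + b) * exp (- a * t\<^sup>2))"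
      by (intro mult_right_mono) auto
    with norm_bessel_integrand_line_le[OF assms(2), of a t]
    show "norm (bessel_integrand a b (vline t)) \<le> norm (2 * (exp (a + b) * exp (- a * t\<^sup>2)))"
      by simp
  qed
  show "(\<lambda>t. bessel_integrand a b (vline t)) \<in> borel_measurable lborel"
    using borel_measurable_continuous_onI[OF bessel_integrand_line_continuous[of UNIV a b]] by simp
qed

definition bessel_integral :: "real \<Rightarrow> real \<Rightarrow> complex" where
  "bessel_integral a b = (LINT t|lborel. bessel_integrand a b (vline t))"

text \<open>
  Expands \<open>exp (b / y\<^sup>2)\<close>; as \<open>|y| \<ge> 1\<close> on the line, every term is dominated by the same Gaussian.
\<close>
lemma bessel_integral_sums:
  assumes a: "a > 0" and b: "b \<ge> 0"
  shows "(\<lambda>j. 2 * of_real (b ^ j / fact j) * parabola_moment a (2 * j + 4)) sums bessel_integral a b"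
proof -
  let ?f = "\<lambda>j t. 2 * of_real (b ^ j / fact j) * parabola_gauss a (2 * j + 4) t"
  have int: "integrable lborel (?f j)" for j
    by (intro integrable_mult_right parabola_gauss_integrable a)
  have nf: "norm (?f j t) \<le> (b ^ j / fact j) * (2 * (exp a * exp (- a * t\<^sup>2)))" for j t
  proof -
    have "norm (?f j t) = (b ^ j / fact j) * (2 * norm (parabola_gauss a (2 * j + 4) t))"
      using b by (simp add: norm_mult norm_divide norm_power)
    also have "\<dots> \<le> (b ^ j / fact j) * (2 * (exp a * exp (- a * t\<^sup>2)))"
      using b norm_parabola_gauss_le by (intro mult_left_mono) auto
    finally show ?thesis .
  qed
  have sb: "summable (\<lambda>j. b ^ j / fact j)"
    using summable_exp[of b] by (simp add: divide_inverse mult.commute)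
  have eq: "?f j t = 2 / (vline t) ^ 4 * exp (of_real a * (vline t)\<^sup>2) * ((of_real b / (vline t)\<^sup>2) ^ j /\<^sub>R fact j)" for j t
  proof -
    define y where "y = vline t"
    have "y ^ (2 * j + 4) = (y\<^sup>2) ^ j * y ^ 4" by (simp add: power_add power_mult)
    thus ?thesis unfolding parabola_gauss_def y_def[symmetric]
      by (simp add: scaleR_conv_of_real power_divide divide_inverse power_mult_distrib power_inverse mult_ac)
  qed
  have sums: "(\<lambda>j. ?f j t) sums bessel_integrand a b (vline t)" for t
    unfolding eq bessel_integrand_def exp_add mult.assoc[symmetric]
    by (intro sums_mult exp_converges)
  have "(\<lambda>j. integral\<^sup>L lborel (?f j)) sums (LINT t|lborel. (\<Sum>j. ?f j t))"
  proof (rule sums_integral[OF int])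
    show "AE t in lborel. summable (\<lambda>j. norm (?f j t))"
    proof (rule AE_I2)
      fix t
      show "summable (\<lambda>j. norm (?f j t))"
        using nf by (intro summable_comparison_test'[OF summable_mult2[OF sb]]) auto
    qed
    have "norm (LINT t|lborel. norm (?f j t)) \<le> (b ^ j / fact j) * (LINT t|lborel. 2 * (exp a * exp (- a * t\<^sup>2)))" for j
    proof -
      have "(LINT t|lborel. norm (?f j t)) \<le> (LINT t|lborel. (b ^ j / fact j) * (2 * (exp a * exp (- a * t\<^sup>2))))"
        by (intro integral_mono nf integrable_norm int integrable_mult_right gaussian_integrable a)
      thus ?thesis by simp
    qed
    thus "summable (\<lambda>j. LINT t|lborel. norm (?f j t))"
      by (intro summable_comparison_test'[OF summable_mult2[OF sb]]) auto
  qed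
  also have "(LINT t|lborel. (\<Sum>j. ?f j t)) = bessel_integral a b"
    unfolding bessel_integral_def using sums by (simp add: sums_iff)
  finally show ?thesis by simp
qed

text \<open>
  The Gaussian moments turn the expansion in powers of \<open>b\<close> into the termwise derivative of the
  power series of \<open>2 \<surd>\<pi> sinh (2 \<surd>(ab)) / \<surd>b\<close>.  The integral is a Bessel function \<open>I\<^bsub>3/2\<^esub>\<close> in disguise.
\<close>
theorem bessel_integral_derivative:
  assumes a: "a > 0" and b: "b > 0"
  obtains K where "bessel_integral a b = of_real K"
    "((\<lambda>b. 2 * sqrt pi * sinh (2 * sqrt (a * b)) / sqrt b) has_real_derivative K) (at b)"
proof -
  define c where "c = (\<lambda>j. 2 * sqrt pi * (2 * sqrt a) ^ (2 * j + 1) / fact (2 * j + 1))"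
  have sums: "(\<lambda>j. c j * x ^ j) sums (2 * sqrt pi * sinh (2 * sqrt (a * x)) / sqrt x)" if x: "x > 0" for x
  proof -
    have "(\<lambda>n. if even n then 0 else (2 * sqrt (a * x)) ^ n /\<^sub>R fact n) sums sinh (2 * sqrt (a * x))"
      by (rule sinh_converges)
    hence "(\<lambda>j. (\<lambda>n. if even n then 0 else (2 * sqrt (a * x)) ^ n /\<^sub>R fact n) (2 * j + 1)) sums sinh (2 * sqrt (a * x))"
      by (subst sums_mono_reindex[where f = "\<lambda>n. if even n then 0 else (2 * sqrt (a * x)) ^ n /\<^sub>R fact n"])
         (auto simp: strict_mono_def elim!: oddE)
    hence "(\<lambda>j. (2 * sqrt pi / sqrt x) * ((2 * sqrt (a * x)) ^ (2 * j + 1) / fact (2 * j + 1))) sums ((2 * sqrt pi / sqrt x) * sinh (2 * sqrt (a * x)))"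
      by (intro sums_mult) (simp add: divide_inverse mult.commute)
    moreover have "(2 * sqrt pi / sqrt x) * ((2 * sqrt (a * x)) ^ (2 * j + 1) / fact (2 * j + 1)) = c j * x ^ j" for j
    proof -
      have p: "(2 * sqrt (a * x)) ^ (2 * j + 1) = (2 * sqrt a) ^ (2 * j + 1) * (x ^ j * sqrt x)"
      proof -
        have "sqrt x ^ (2 * j + 1) = x ^ j * sqrt x" using x by (simp add: power_mult)
        moreover have "2 * sqrt (a * x) = (2 * sqrt a) * sqrt x" by (simp add: real_sqrt_mult)
        ultimately show ?thesis by (simp only: power_mult_distrib)
      qed
      have cancel: "(2 * sqrt pi / sqrt x) * (A * (X * sqrt x) / F) = 2 * sqrt pi * A / F * X" for A X F
        using x by simp
      show ?thesis unfolding c_def p by (rule cancel)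
    qed
    ultimately show ?thesis by simp
  qed
  have summ: "summable (\<lambda>j. c j * x ^ j)" for x
    by (rule powser_inside[OF sums_summable[OF sums[of "\<bar>x\<bar> + 1"]]]) auto
  define K where "K = (\<Sum>j. diffs c j * b ^ j)"
  have D: "((\<lambda>x. \<Sum>j. c j * x ^ j) has_real_derivative K) (at b)"
    unfolding K_def by (rule termdiffs_strong_converges_everywhere[OF summ])
  have "eventually (\<lambda>x. x > 0) (nhds b)"
    using b eventually_nhds_in_open[of "{0<..}" b] by auto
  hence "eventually (\<lambda>x. (\<Sum>j. c j * x ^ j) = 2 * sqrt pi * sinh (2 * sqrt (a * x)) / sqrt x) (nhds b)"
    by eventually_elim (use sums in \<open>simp add: sums_iff\<close>)
  hence D': "((\<lambda>b. 2 * sqrt pi * sinh (2 * sqrt (a * b)) / sqrt b) has_real_derivative K) (at b)"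
    using D by (subst (asm) DERIV_cong_ev[OF refl _ refl]) auto
  have "(\<lambda>j. diffs c j * b ^ j) sums K"
    unfolding K_def by (intro summable_sums termdiff_converges_all summ)
  hence "(\<lambda>j. complex_of_real (diffs c j * b ^ j)) sums of_real K" by (rule sums_of_real)
  moreover have "complex_of_real (diffs c j * b ^ j) = 2 * of_real (b ^ j / fact j) * parabola_moment a (2 * j + 4)" for j
  proof -
    have p: "(2 * sqrt a) ^ (2 * Suc j + 1) = 2 ^ (2 * j + 3) * a ^ (j + 1) * sqrt a"
    proof -
      have "sqrt a ^ (2 * Suc j + 1) = a ^ (j + 1) * sqrt a" using a by (simp only: power_add power_mult real_sqrt_pow2 less_imp_le power_one_right) simp
      moreover have "2 * Suc j + 1 = 2 * j + 3" by simp
      ultimately show ?thesis by (simp only: power_mult_distrib mult.assoc)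
    qed
    have f: "(fact (j + 1) :: real) = real (Suc j) * fact j" by simp
    have sq: "sqrt (pi / a) = sqrt pi * sqrt a / a" using a by (simp add: real_sqrt_divide real_div_sqrt field_simps)
    have "diffs c j = 2 * sqrt pi * (2 ^ (2 * j + 3) * a ^ (j + 1) * sqrt a) / fact (2 * j + 3) * real (Suc j)"
      unfolding diffs_def c_def p by (simp add: eval_nat_numeral del: of_nat_Suc fact_Suc)
    also have "\<dots> = 2 * (1 / fact j) * (sqrt (pi / a) * (2 * a) ^ (j + 2) * 2 ^ (j + 1) * fact (j + 1) / fact (2 * j + 3))"
      unfolding f sq using a by (simp add: field_simps power_add power_mult_distrib power_mult power2_eq_square eval_nat_numeral del: of_nat_Suc fact_Suc)
    finally show ?thesis unfolding parabola_gauss_even[OF a] by (simp del: fact_Suc of_nat_Suc)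
  qed
  ultimately have "bessel_integral a b = of_real K"
    using bessel_integral_sums[OF a, of b] b by (simp add: sums_iff)
  thus ?thesis using that D' by blast
qed

section \<open>Primitives and estimates on a single arc\<close>

definition gf_coeff_integrand :: "nat \<Rightarrow> complex \<Rightarrow> complex" where
  "gf_coeff_integrand n \<tau> = partition_gf (exp (2 * of_real pi * \<i> * \<tau>)) * exp (- 2 * of_real pi * \<i> * of_nat n * \<tau>)"

text \<open>
  Termwise integration of \<open>\<Sum> p(m) e\<^bsup>2\<pi>i(m-n)\<tau>\<^esup>\<close>: the term \<open>m = n\<close> contributes the linear function
  \<open>p(n) \<tau>\<close>, and all others are periodic.
\<close>
lemma gf_coeff_primitive:
  obtains \<Phi> where "\<And>\<tau>. \<Phi> (\<tau> + 1) - \<Phi> \<tau> = of_nat (num_partitions n)"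
    "\<And>\<tau>. Im \<tau> > 0 \<Longrightarrow> (\<Phi> has_field_derivative gf_coeff_integrand n \<tau>) (at \<tau>)"
proof -
  define c where "c = (\<lambda>m. of_nat (num_partitions m) / (of_nat m - of_nat n) :: complex)"
  define C where "C = (\<lambda>q. \<Sum>m. c m * q ^ m)"
  define e where "e = (\<lambda>\<tau>. exp (2 * of_real pi * \<i> * \<tau>) :: complex)"
  define f where "f = (\<lambda>\<tau>. exp (- 2 * of_real pi * \<i> * of_nat n * \<tau>) :: complex)"
  define \<Phi> where "\<Phi> = (\<lambda>\<tau>. of_nat (num_partitions n) * \<tau> + C (e \<tau>) * f \<tau> / (2 * of_real pi * \<i>))"
  have summ: "summable (\<lambda>m. c m * q ^ m)" if "norm q < 1" for q
  proof (rule summable_comparison_test[OF _ partition_gf_norm_summable[OF that]], intro exI allI impI)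
    fix m
    have "norm (c m) \<le> real (num_partitions m)"
    proof (cases "m = n")
      case False
      have "norm (of_nat m - of_nat n :: complex) = \<bar>real m - real n\<bar>"
        by (metis norm_of_real of_real_diff of_real_of_nat_eq)
      also have "\<dots> \<ge> 1" using False by linarith
      finally have "real (num_partitions m) / norm (of_nat m - of_nat n :: complex) \<le> real (num_partitions m) / 1"
        by (intro divide_left_mono) auto
      thus ?thesis by (simp add: c_def norm_divide)
    qed (simp add: c_def)
    thus "norm (c m * q ^ m) \<le> norm (of_nat (num_partitions m) * q ^ m)"
      by (simp add: norm_mult mult_right_mono)
  qed
  show ?thesis
  proof (rule that[of \<Phi>])
    fix \<tau> :: complex
    have e1: "e (\<tau> + 1) = e \<tau>" 
      using exp_plus_2pin[of "2 * of_real pi * \<i> * \<tau>" 1] by (simp add: e_def algebra_simps)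
    have f1: "f (\<tau> + 1) = f \<tau>" 
      using exp_plus_2pin[of "- 2 * of_real pi * \<i> * of_nat n * \<tau>" "- int n"] by (simp add: f_def algebra_simps)
    show "\<Phi> (\<tau> + 1) - \<Phi> \<tau> = of_nat (num_partitions n)"
      unfolding \<Phi>_def e1 f1 by (simp add: algebra_simps)
  next
    fix \<tau> :: complex assume im: "Im \<tau> > 0"
    have ne: "norm (e \<tau>) < 1" using im by (simp add: e_def)
    define D where "D = (\<Sum>m. diffs c m * e \<tau> ^ m)"
    have dC: "(C has_field_derivative D) (at (e \<tau>))"
      unfolding C_def D_def
    proof (rule termdiffs_strong)
      let ?r = "of_real ((norm (e \<tau>) + 1) / 2) :: complex"
      have "norm ?r = (norm (e \<tau>) + 1) / 2" by (simp only: norm_of_real) simp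
      thus "summable (\<lambda>m. c m * ?r ^ m)" "norm (e \<tau>) < norm ?r" using ne by (auto intro!: summ)
    qed
    have de: "(e has_field_derivative (2 * of_real pi * \<i> * e \<tau>)) (at \<tau>)"
      unfolding e_def by (auto intro!: derivative_eq_intros)
    have df: "(f has_field_derivative (- 2 * of_real pi * \<i> * of_nat n * f \<tau>)) (at \<tau>)"
      unfolding f_def by (auto intro!: derivative_eq_intros)
    have "(\<lambda>m. of_nat (Suc m) * c (Suc m) * e \<tau> ^ m) sums D"
    proof -
      obtain K where K: "norm (e \<tau>) < K" "K < 1" using dense[OF ne] by blast
      have "summable (\<lambda>m. diffs c m * e \<tau> ^ m)"
        by (rule termdiff_converges[OF K(1)]) (use K summ in auto)
      thus ?thesis unfolding D_def diffs_def by (rule summable_sums)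
    qed
    from sums_mult[OF this, of "e \<tau>"]
    have "(\<lambda>m. of_nat (Suc m) * c (Suc m) * e \<tau> ^ Suc m) sums (e \<tau> * D)" by (simp add: mult_ac)
    hence "(\<lambda>m. of_nat m * c m * e \<tau> ^ m) sums (e \<tau> * D)" by (subst (asm) sums_Suc_iff) simp
    moreover have "(\<lambda>m. of_nat n * (c m * e \<tau> ^ m)) sums (of_nat n * C (e \<tau>))"
      unfolding C_def by (intro sums_mult summable_sums summ ne)
    ultimately have "(\<lambda>m. of_nat m * c m * e \<tau> ^ m - of_nat n * (c m * e \<tau> ^ m)) sums (e \<tau> * D - of_nat n * C (e \<tau>))"
      by (rule sums_diff)
    moreover have "of_nat m * c m * e \<tau> ^ m - of_nat n * (c m * e \<tau> ^ m) =
       of_nat (num_partitions m) * e \<tau> ^ m - (if m = n then of_nat (num_partitions n) * e \<tau> ^ n else 0)" for m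
    proof (cases "m = n")
      case False
      hence "(of_nat m - of_nat n :: complex) \<noteq> 0" by simp
      hence "(of_nat m - of_nat n) * c m = of_nat (num_partitions m)" by (simp add: c_def)
      thus ?thesis using False by (simp add: algebra_simps)
    qed (simp add: c_def)
    moreover have "(\<lambda>m. of_nat (num_partitions m) * e \<tau> ^ m - (if m = n then of_nat (num_partitions n) * e \<tau> ^ n else 0)) sums
       (partition_gf (e \<tau>) - of_nat (num_partitions n) * e \<tau> ^ n)"
      by (intro sums_diff partition_gf_sums ne sums_single)
    ultimately have key: "e \<tau> * D - of_nat n * C (e \<tau>) = partition_gf (e \<tau>) - of_nat (num_partitions n) * e \<tau> ^ n"
      by (simp add: sums_iff)
    have ef: "e \<tau> ^ n * f \<tau> = 1"
      unfolding e_def f_def exp_of_nat_mult[symmetric] exp_add[symmetric] by (simp add: algebra_simps)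
    have dCe: "((\<lambda>\<tau>. C (e \<tau>)) has_field_derivative D * (2 * of_real pi * \<i> * e \<tau>)) (at \<tau>)"
      by (rule DERIV_chain2[OF dC de])
    have "(\<Phi> has_field_derivative of_nat (num_partitions n) +
       (D * (2 * of_real pi * \<i> * e \<tau>) * f \<tau> + (- 2 * of_real pi * \<i> * of_nat n * f \<tau>) * C (e \<tau>)) / (2 * of_real pi * \<i>)) (at \<tau>)"
      unfolding \<Phi>_def
      using DERIV_add[OF DERIV_cmult[OF DERIV_ident] DERIV_cdivide[OF DERIV_mult[OF dCe df]]]
      by (simp only: mult_1_right)
    also have "of_nat (num_partitions n) +
       (D * (2 * of_real pi * \<i> * e \<tau>) * f \<tau> + (- 2 * of_real pi * \<i> * of_nat n * f \<tau>) * C (e \<tau>)) / (2 * of_real pi * \<i>) =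
       of_nat (num_partitions n) + (e \<tau> * D - of_nat n * C (e \<tau>)) * f \<tau>"
      by (simp add: field_simps)
    also have "\<dots> = of_nat (num_partitions n) + (partition_gf (e \<tau>) * f \<tau> - of_nat (num_partitions n) * (e \<tau> ^ n * f \<tau>))"
      unfolding key by (simp add: algebra_simps)
    also have "\<dots> = gf_coeff_integrand n \<tau>"
      unfolding ef by (simp add: gf_coeff_integrand_def e_def f_def)
    finally show "(\<Phi> has_field_derivative gf_coeff_integrand n \<tau>) (at \<tau>)" .
  qed
qed

text \<open>
  The Ford circle corresponds to the line \<open>y\<^sup>2 = 1 + is\<close>.  The last bound converts the distance
  \<open>s\<close> of an end point into decay of negative powers of \<open>y\<close>.
\<close>
lemma csqrt_one_plus_ii:
  fixes s :: real
  defines "y \<equiv> csqrt (vline s)"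
  shows "Re y \<ge> 1" "(Re y)\<^sup>2 = 1 + (Im y)\<^sup>2" "y\<^sup>2 = vline s" "\<bar>Im y\<bar> < Re y"
    "(1 + \<bar>s\<bar>) / 3 \<le> (Re y)\<^sup>2"
proof -
  show y2: "y\<^sup>2 = vline s" by (simp add: y_def)
  have re: "Re y \<ge> 0" using csqrt_principal[of "vline s"] by (auto simp: y_def)
  have "Re (y\<^sup>2) = 1" "Im (y\<^sup>2) = s" unfolding y2 by auto
  hence p: "Re y * Re y - Im y * Im y = 1" and s: "2 * Re y * Im y = s"
    by (simp_all add: power2_eq_square mult.commute mult.left_commute)
  show pq: "(Re y)\<^sup>2 = 1 + (Im y)\<^sup>2" using p by (simp add: power2_eq_square)
  hence "(Re y)\<^sup>2 \<ge> 1\<^sup>2" by simp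
  thus "Re y \<ge> 1" using re by (rule power2_le_imp_le)
  have "\<bar>Im y\<bar>\<^sup>2 < (Re y)\<^sup>2" using pq by simp
  thus lt: "\<bar>Im y\<bar> < Re y" using re by (rule power2_less_imp_less)
  have "\<bar>s\<bar> = 2 * Re y * \<bar>Im y\<bar>" unfolding s[symmetric] using re by (simp add: abs_mult)
  also have "\<dots> \<le> 2 * Re y * Re y" using lt re by (intro mult_left_mono) auto
  finally have "\<bar>s\<bar> \<le> 2 * (Re y)\<^sup>2" by (simp add: power2_eq_square)
  moreover have "(Re y)\<^sup>2 \<ge> 1" using pq by simp
  ultimately show "(1 + \<bar>s\<bar>) / 3 \<le> (Re y)\<^sup>2" by simp
qed

text \<open>
  Between \<open>Re y = 1\<close> and the curve \<open>Re y\<^sup>2 = 1\<close> the exponential is bounded and \<open>|y|\<close> is at least the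
  real part of the end point, which also bounds the length of the segment.
\<close>
lemma horizontal_estimate:
  fixes s :: real
  assumes a: "a \<ge> 0" and b: "b \<ge> 0"
    and PG: "\<And>y. Re y > 0 \<Longrightarrow> (PG has_field_derivative bessel_integrand a b y) (at y)"
  defines "y \<equiv> csqrt (vline s)"
  shows "norm (PG y - PG (vline (Im y))) \<le> 2 * exp (a + b) / (Re y) ^ 3"
proof -
  note Y = csqrt_one_plus_ii[of s, folded y_def]
  define p where "p = Re y"
  define q where "q = Im y"
  have p1: "p \<ge> 1" and pq: "p\<^sup>2 = 1 + q\<^sup>2" using Y by (auto simp: p_def q_def)
  have "norm (PG y - PG (vline q)) \<le> (2 / p ^ 4 * exp (a + b)) * norm (y - (vline q))"
  proof (rule field_differentiable_bound[where S = "closed_segment (vline q) y"])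
    fix w assume "w \<in> closed_segment (vline q) y"
    then obtain u where u: "0 \<le> u" "u \<le> 1" "w = (1 - u) *\<^sub>R (vline q) + u *\<^sub>R y"
      by (auto simp: closed_segment_def)
    have Imw: "Im w = q" unfolding u(3) by (simp add: q_def[symmetric] algebra_simps)
    have Rew: "Re w = 1 + u * (p - 1)" unfolding u(3) by (simp add: p_def algebra_simps)
    have "0 \<le> u * (p - 1)" "0 \<le> (1 - u) * (p - 1)" using u p1 by simp_all
    moreover have "u * (p - 1) = Re w - 1" "(1 - u) * (p - 1) = p - Re w"
      unfolding Rew by (simp_all add: algebra_simps)
    ultimately have le: "1 \<le> Re w" "Re w \<le> p" by simp_all
    have sq: "1 \<le> (Re w)\<^sup>2" "(Re w)\<^sup>2 \<le> p\<^sup>2" using le by (auto intro: power_mono)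
    have nw2: "(norm w)\<^sup>2 \<ge> p\<^sup>2" using sq pq by (simp add: cmod_power2 Imw)
    hence nw: "norm w \<ge> p" by (rule power2_le_imp_le) simp
    show "(PG has_field_derivative bessel_integrand a b w) (at w within closed_segment (vline q) y)"
      by (rule has_field_derivative_at_within[OF PG]) (use le in simp)
    have "norm (bessel_integrand a b w) \<le> 2 / norm w ^ 4 * (exp b * exp (a * Re (w\<^sup>2)))"
      using nw p1 b by (intro norm_bessel_integrand_le) auto
    also have "\<dots> \<le> 2 / p ^ 4 * (exp b * exp (a * 1))"
    proof (intro mult_mono)
      show "2 / norm w ^ 4 \<le> 2 / p ^ 4" using nw p1 by (intro frac_le power_mono) auto
      have "Re (w\<^sup>2) \<le> 1" using sq pq by (simp add: power2_eq_square Imw)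
      thus "exp (a * Re (w\<^sup>2)) \<le> exp (a * 1)" using a by (simp only: exp_le_cancel_iff mult_left_mono)
    qed auto
    finally show "norm (bessel_integrand a b w) \<le> 2 / p ^ 4 * exp (a + b)" by (simp add: exp_add mult.commute)
  qed (rule convex_closed_segment ends_in_segment)+
  moreover have "norm (y - (vline q)) \<le> p"
  proof -
    have "y - (vline q) = of_real (p - 1)" by (simp add: complex_eq_iff p_def q_def)
    thus ?thesis using p1 by (simp only: norm_of_real)
  qed
  hence "(2 / p ^ 4 * exp (a + b)) * norm (y - (vline q)) \<le> (2 / p ^ 4 * exp (a + b)) * p"
    using p1 by (intro mult_left_mono) auto
  moreover have "(2 / p ^ 4 * exp (a + b)) * p = 2 * exp (a + b) / p ^ 3"
    using p1 by (simp add: eval_nat_numeral)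
  ultimately have "norm (PG y - PG (vline q)) \<le> 2 * exp (a + b) / p ^ 3" by linarith
  thus ?thesis by (simp only: p_def q_def)
qed

text \<open>
  Completes the segment to the whole line; beyond its ends the factor \<open>y\<^bsup>-4\<^esup>\<close> is small, and the
  Gaussian makes the rest integrable.
\<close>
lemma vertical_estimate:
  fixes q1 q2 :: real
  assumes a: "a > 0" and b: "b \<ge> 0" and q: "q1 \<ge> 0" "q2 \<ge> 0"
    and m: "m > 0" "m \<le> 1 + q1\<^sup>2" "m \<le> 1 + q2\<^sup>2"
    and PG: "\<And>y. Re y > 0 \<Longrightarrow> (PG has_field_derivative bessel_integrand a b y) (at y)"
  shows "norm (PG (vline q2) - PG (vline (- q1)) - \<i> * bessel_integral a b)
           \<le> 2 * exp (a + b) / m\<^sup>2 * (LINT t|lborel. exp (- a * t\<^sup>2))"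
proof -
  let ?g = "\<lambda>t. bessel_integrand a b (vline t)"
  let ?I = "{- q1..q2}"
  have int: "integrable lborel ?g" by (rule bessel_integrand_line_integrable[OF a b])
  have int1: "integrable lborel (\<lambda>t. indicat_real ?I t *\<^sub>R ?g t)"
    by (rule integrable_mult_indicator[OF _ int]) simp
  define F where "F = (\<lambda>t. PG (vline t))"
  define f where "f = (\<lambda>t. \<i> * ?g t)"
  have deriv: "(F has_vector_derivative f t) (at t within ?I)" for t
  proof -
    have "((\<lambda>t. 1 + \<i> * complex_of_real t) has_vector_derivative \<i>) (at t within ?I)"
      by (auto intro!: derivative_eq_intros)
    moreover have "(PG has_field_derivative ?g t) (at (vline t))" by (rule PG) simp
    hence "(PG has_field_derivative ?g t) (at (vline t) within (\<lambda>t. 1 + \<i> * complex_of_real t) ` ?I)"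
      by (rule has_field_derivative_at_within)
    ultimately have "((PG \<circ> (\<lambda>t. 1 + \<i> * complex_of_real t)) has_vector_derivative \<i> * ?g t) (at t within ?I)"
      by (rule field_vector_diff_chain_within)
    thus ?thesis unfolding F_def f_def o_def .
  qed
  have contf: "continuous_on ?I f" unfolding f_def by (intro continuous_intros bessel_integrand_line_continuous)
  have "(LBINT t. indicat_real ?I t *\<^sub>R f t) = F q2 - F (- q1)"
    by (rule integral_FTC_atLeastAtMost[OF _ deriv contf]) (use q in simp)
  hence "(LBINT t. indicat_real ?I t *\<^sub>R (\<i> * ?g t)) = PG (vline q2) - PG (vline (- q1))"
    unfolding F_def f_def .
  moreover have "(LBINT t. indicat_real ?I t *\<^sub>R (\<i> * ?g t)) = \<i> * (LBINT t. indicat_real ?I t *\<^sub>R ?g t)"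
    by (subst integral_mult_right_zero[symmetric]) (simp add: mult_scaleR_right)
  ultimately have PGeq: "PG (vline q2) - PG (vline (- q1)) = \<i> * (LBINT t. indicat_real ?I t *\<^sub>R ?g t)"
    by metis
  have "PG (vline q2) - PG (vline (- q1)) - \<i> * bessel_integral a b =
      - \<i> * ((LBINT t. ?g t) - (LBINT t. indicat_real ?I t *\<^sub>R ?g t))"
    unfolding PGeq bessel_integral_def by (simp add: right_diff_distrib)
  moreover have "(LBINT t. ?g t) - (LBINT t. indicat_real ?I t *\<^sub>R ?g t) = (LBINT t. ?g t - indicat_real ?I t *\<^sub>R ?g t)"
    by (rule Bochner_Integration.integral_diff[OF int int1, symmetric])
  ultimately have normeq: "norm (PG (vline q2) - PG (vline (- q1)) - \<i> * bessel_integral a b) =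
      norm (LBINT t. ?g t - indicat_real ?I t *\<^sub>R ?g t)"
    by (simp only: norm_mult norm_minus_cancel norm_ii mult_1_left)
  have "norm (LBINT t. ?g t - indicat_real ?I t *\<^sub>R ?g t) \<le> (LINT t|lborel. 2 * exp (a + b) / m\<^sup>2 * exp (- a * t\<^sup>2))"
  proof (rule Bochner_Integration.integral_norm_bound_integral)
    show "integrable lborel (\<lambda>t. ?g t - indicat_real ?I t *\<^sub>R ?g t)"
      by (rule Bochner_Integration.integrable_diff[OF int int1])
    show "integrable lborel (\<lambda>t. 2 * exp (a + b) / m\<^sup>2 * exp (- a * t\<^sup>2))"
      by (intro integrable_mult_right gaussian_integrable a)
    fix t
    show "norm (?g t - indicat_real ?I t *\<^sub>R ?g t) \<le> 2 * exp (a + b) / m\<^sup>2 * exp (- a * t\<^sup>2)"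
    proof (cases "t \<in> ?I")
      case False
      have "m \<le> 1 + t\<^sup>2"
      proof (cases "t > q2")
        case True
        hence "q2\<^sup>2 \<le> t\<^sup>2" using q by (intro power_mono) auto
        thus ?thesis using m by linarith
      next
        case False
        hence "q1 \<le> - t" using \<open>t \<notin> ?I\<close> by auto
        hence "q1\<^sup>2 \<le> (- t)\<^sup>2" using q by (intro power_mono) auto
        thus ?thesis using m by simp
      qed
      hence "2 / (1 + t\<^sup>2)\<^sup>2 \<le> 2 / m\<^sup>2" using m by (intro frac_le power_mono) auto
      hence "2 / (1 + t\<^sup>2)\<^sup>2 * (exp (a + b) * exp (- a * t\<^sup>2)) \<le> 2 / m\<^sup>2 * (exp (a + b) * exp (- a * t\<^sup>2))"
        by (intro mult_right_mono) auto
      thus ?thesis using False norm_bessel_integrand_line_le[OF b, of a t] by (simp add: mult_ac)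
    qed auto
  qed
  moreover have "(LINT t|lborel. 2 * exp (a + b) / m\<^sup>2 * exp (- a * t\<^sup>2)) = 2 * exp (a + b) / m\<^sup>2 * (LINT t|lborel. exp (- a * t\<^sup>2))"
    by (rule integral_mult_right_zero)
  ultimately show ?thesis unfolding normeq by simp
qed

text \<open>
  The path between the end points is moved to the right by \<open>L\<close>.  The two horizontal pieces are
  bounded uniformly in \<open>L\<close>, and the connecting piece vanishes as \<open>L \<rightarrow> \<infinity>\<close>.
\<close>
lemma remainder_estimate:
  fixes s1 s2 :: real
  assumes c: "c \<ge> 0"
    and PR: "\<And>y. \<bar>Im y\<bar> < Re y \<Longrightarrow> (PR has_field_derivative R y) (at y)"
    and R: "\<And>y. \<bar>Im y\<bar> < Re y \<Longrightarrow> Re (y\<^sup>2) \<ge> 1 \<Longrightarrow> norm (R y) \<le> c / norm y ^ 4 * exp (- Re (y\<^sup>2))"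
  defines "y1 \<equiv> csqrt (vline s1)" and "y2 \<equiv> csqrt (vline s2)"
  shows "norm (PR y2 - PR y1) \<le> c / (Re y1) ^ 4 + c / (Re y2) ^ 4"
proof -
  have horiz: "norm (PR (y + of_real L) - PR y) \<le> c / (Re y) ^ 4"
    if y: "y = csqrt (vline s)" and L: "L \<ge> 0" for y s L
  proof (cases "L = 0")
    case True thus ?thesis using c csqrt_one_plus_ii(1)[of s] by (simp add: y)
  next
    case False
    note Y = csqrt_one_plus_ii[of s, folded y]
    have wedge: "\<bar>Im (y + of_real l)\<bar> < Re (y + of_real l)" if "l \<ge> 0" for l using Y(4) that by simp
    have dP: "((\<lambda>l. PR (y + of_real l)) has_vector_derivative R (y + of_real l)) (at l)" if "l \<ge> 0" for l
    proof -
      have "((\<lambda>l. y + complex_of_real l) has_vector_derivative 1) (at l)"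
        by (auto intro!: derivative_eq_intros)
      from field_vector_diff_chain_at[OF this PR[OF wedge[OF that]]] show ?thesis by (simp add: o_def)
    qed
    have "norm (PR (y + of_real L) - PR (y + of_real 0)) \<le> (- (c / Re y ^ 4) * exp (- L)) - (- (c / Re y ^ 4) * exp (- 0))"
    proof (rule differentiable_bound_general[where f' = "\<lambda>l. R (y + of_real l)" and \<phi>' = "\<lambda>l. c / Re y ^ 4 * exp (- l)"])
      show "(0::real) < L" using L False by simp
      show "continuous_on {0..L} (\<lambda>l. PR (y + of_real l))"
        using dP by (intro continuous_at_imp_continuous_on ballI has_vector_derivative_continuous) auto
      show "continuous_on {0..L} (\<lambda>l. - (c / Re y ^ 4) * exp (- l))" by (intro continuous_intros)
      fix l assume l: "0 < l" "l < L"
      show "((\<lambda>l. PR (y + of_real l)) has_vector_derivative R (y + of_real l)) (at l)" using l by (intro dP) auto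
      show "((\<lambda>l. - (c / Re y ^ 4) * exp (- l)) has_vector_derivative c / Re y ^ 4 * exp (- l)) (at l)"
      proof -
        have "((\<lambda>l. - K * exp (- l)) has_real_derivative K * exp (- l)) (at l)" for K
          by (auto intro!: derivative_eq_intros)
        thus ?thesis unfolding has_real_derivative_iff_has_vector_derivative .
      qed
      let ?w = "y + of_real l"
      have "Re (?w\<^sup>2) = 1 + 2 * Re y * l + l\<^sup>2"
        using Y(2) by (simp add: power2_eq_square algebra_simps)
      moreover have "1 * l \<le> (2 * Re y) * l" using Y(1) l by (intro mult_right_mono) auto
      ultimately have re2: "Re (?w\<^sup>2) \<ge> 1 + l" using zero_le_power2[of l] by linarith
      have "Re y \<le> norm ?w" using complex_Re_le_cmod[of ?w] l by simp
      hence "c / norm ?w ^ 4 \<le> c / Re y ^ 4" using Y(1) c by (intro frac_le power_mono) auto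
      moreover have "exp (- Re (?w\<^sup>2)) \<le> exp (- l)" using re2 by simp
      ultimately have "c / norm ?w ^ 4 * exp (- Re (?w\<^sup>2)) \<le> c / Re y ^ 4 * exp (- l)"
        using c Y(1) by (intro mult_mono) auto
      moreover have "norm (R ?w) \<le> c / norm ?w ^ 4 * exp (- Re (?w\<^sup>2))"
        using l re2 by (intro R wedge) auto
      ultimately show "norm (R ?w) \<le> c / Re y ^ 4 * exp (- l)" by linarith
    qed
    also have "\<dots> = c / Re y ^ 4 - c / Re y ^ 4 * exp (- L)" by simp
    also have "\<dots> \<le> c / Re y ^ 4" using c Y(1) by simp
    finally show ?thesis by simp
  qed
  note Y1 = csqrt_one_plus_ii[of s1, folded y1_def]
  note Y2 = csqrt_one_plus_ii[of s2, folded y2_def]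
  define Q where "Q = \<bar>Im y1\<bar> + \<bar>Im y2\<bar>"
  have vert: "norm (PR (y2 + of_real L) - PR (y1 + of_real L)) \<le> c * exp (- L) * norm (y2 - y1)" if L: "L \<ge> Q\<^sup>2" for L
  proof -
    have L0: "L \<ge> 0" using L zero_le_power2[of Q] by linarith
    let ?S = "closed_segment (y1 + of_real L) (y2 + of_real L)"
    have "norm (PR (y2 + of_real L) - PR (y1 + of_real L)) \<le> c * exp (- L) * norm (y2 + of_real L - (y1 + of_real L))"
    proof (rule field_differentiable_bound[where S = ?S])
      fix w assume "w \<in> ?S"
      then obtain u where u: "0 \<le> u" "u \<le> 1" "w = (1 - u) *\<^sub>R (y1 + of_real L) + u *\<^sub>R (y2 + of_real L)"
        by (auto simp: closed_segment_def)
      define v where "v = 1 - u"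
      have v: "0 \<le> v" "v \<le> 1" "u + v = 1" using u by (auto simp: v_def)
      have Rew: "Re w = v * Re y1 + u * Re y2 + L"
        unfolding u(3) by (simp add: v_def algebra_simps)
      have Imw: "Im w = v * Im y1 + u * Im y2" unfolding u(3) by (simp add: v_def)
      have "v * 1 + u * 1 \<le> v * Re y1 + u * Re y2" using u v Y1 Y2 by (intro add_mono mult_left_mono) auto
      hence rew: "Re w \<ge> 1 + L" unfolding Rew using v by simp
      have ab: "\<bar>Im w\<bar> \<le> v * \<bar>Im y1\<bar> + u * \<bar>Im y2\<bar>"
        unfolding Imw using u v by (intro order_trans[OF abs_triangle_ineq]) (simp add: abs_mult)
      have "v * \<bar>Im y1\<bar> + u * \<bar>Im y2\<bar> \<le> 1 * \<bar>Im y1\<bar> + 1 * \<bar>Im y2\<bar>"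
        using u v by (intro add_mono mult_right_mono) auto
      hence imQ: "\<bar>Im w\<bar> \<le> Q" using ab by (simp add: Q_def)
      have "v * \<bar>Im y1\<bar> \<le> v * Re y1" "u * \<bar>Im y2\<bar> \<le> u * Re y2"
        using u v Y1(4) Y2(4) by (auto intro!: mult_left_mono)
      moreover have "v * \<bar>Im y1\<bar> + u * \<bar>Im y2\<bar> < v * Re y1 + u * Re y2"
      proof (cases "v = 0")
        case True
        thus ?thesis using v Y2(4) by simp
      next
        case False
        hence "v * \<bar>Im y1\<bar> < v * Re y1" using v Y1(4) by (intro mult_strict_left_mono) auto
        thus ?thesis using calculation by linarith
      qed
      ultimately have wedge: "\<bar>Im w\<bar> < Re w" using ab L0 unfolding Rew by linarith
      have "(1 + L)\<^sup>2 \<le> (Re w)\<^sup>2" using rew L0 by (intro power_mono) auto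
      moreover have "(Im w)\<^sup>2 \<le> Q\<^sup>2" using imQ by (metis abs_ge_zero power2_abs power_mono)
      moreover have "(1 + L)\<^sup>2 \<ge> 1 + 2 * L" by (simp add: power2_eq_square algebra_simps)
      ultimately have re2: "Re (w\<^sup>2) \<ge> 1 + L" using L by (simp add: power2_eq_square)
      have nw: "norm w \<ge> 1" using complex_Re_le_cmod[of w] rew L0 by linarith
      show "(PR has_field_derivative R w) (at w within ?S)"
        using PR[OF wedge] by (rule has_field_derivative_at_within)
      have "norm (R w) \<le> c / norm w ^ 4 * exp (- Re (w\<^sup>2))" using re2 L0 by (intro R wedge) auto
      also have "\<dots> \<le> c / 1 * exp (- L)"
        using c nw re2 by (intro mult_mono frac_le one_le_power) auto
      finally show "norm (R w) \<le> c * exp (- L)" by simp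
    qed auto
    thus ?thesis by simp
  qed
  let ?B = "c / (Re y1) ^ 4 + c / (Re y2) ^ 4"
  let ?P1 = "\<lambda>L. PR (y1 + of_real L)" and ?P2 = "\<lambda>L. PR (y2 + of_real L)"
  have "norm (PR y2 - PR y1) \<le> ?B + c * exp (- L) * norm (y2 - y1)" if L: "L \<ge> Q\<^sup>2" for L
  proof -
    have L0: "L \<ge> 0" using L zero_le_power2[of Q] by linarith
    have tri: "norm (A + B - C) \<le> norm A + norm B + norm C" for A B C :: complex
      using norm_triangle_ineq4[of "A + B" C] norm_triangle_ineq[of A B] by linarith
    have "PR y2 - PR y1 = (?P2 L - ?P1 L) + (?P1 L - PR y1) - (?P2 L - PR y2)" by simp
    also have "norm \<dots> \<le> norm (?P2 L - ?P1 L) + norm (?P1 L - PR y1) + norm (?P2 L - PR y2)"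
      by (rule tri)
    finally show ?thesis
      using vert[OF L] horiz[OF y1_def[THEN meta_eq_to_obj_eq] L0] horiz[OF y2_def[THEN meta_eq_to_obj_eq] L0] by linarith
  qed
  hence ev: "eventually (\<lambda>L. norm (PR y2 - PR y1) \<le> ?B + c * exp (- L) * norm (y2 - y1)) at_top"
    by (intro eventually_mono[OF eventually_ge_at_top[of "Q\<^sup>2"]])
  have "((\<lambda>L::real. exp (- L)) \<longlongrightarrow> 0) at_top" by real_asymp
  hence "((\<lambda>L. ?B + c * exp (- L) * norm (y2 - y1)) \<longlongrightarrow> ?B + c * 0 * norm (y2 - y1)) at_top"
    by (intro tendsto_intros)
  hence "norm (PR y2 - PR y1) \<le> ?B + c * 0 * norm (y2 - y1)"
    by (rule tendsto_lowerbound[OF _ ev]) simp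
  thus ?thesis by simp
qed

section \<open>The Rademacher series\<close>

text \<open>
  The summand of \<open>A\<^sub>k(n)\<close> together with the factor \<open>k\<^bsup>-5/2\<^esup>\<close>, which collects \<open>k\<^bsup>-1/2\<^esup>\<close> from the
  transformation of \<open>F\<close> and \<open>k\<^bsup>-2\<^esup>\<close> from the change of variables \<open>\<tau> = h/k + i / (k\<^sup>2y\<^sup>2)\<close>.
\<close>
definition arc_weight :: "nat \<Rightarrow> int \<Rightarrow> nat \<Rightarrow> complex" where
  "arc_weight n h k = exp (of_real pi * \<i> * of_real (dedekind_sum h k) - 2 * of_real pi * \<i> * of_nat n * of_int h / of_nat k)
      / of_real ((real k)\<^sup>2 * sqrt (real k))"

definition bessel_parameter :: "nat \<Rightarrow> nat \<Rightarrow> real" where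
  "bessel_parameter n k = 2 * pi * (real n - 1 / 24) / (real k)\<^sup>2"

abbreviation arc_integral :: "nat \<Rightarrow> nat \<Rightarrow> complex" where
  "arc_integral n k \<equiv> bessel_integral (pi / 12) (bessel_parameter n k)"

lemma norm_arc_weight: "norm (arc_weight n h k) = 1 / ((real k)\<^sup>2 * sqrt (real k))"
proof -
  have "Re (of_real pi * \<i> * of_real (dedekind_sum h k) - 2 * of_real pi * \<i> * of_nat n * of_int h / of_nat k) = 0"
    by (simp add: Re_divide_of_nat)
  thus ?thesis unfolding arc_weight_def norm_divide norm_exp_eq_Re by (simp del: of_real_mult of_real_power)
qed

lemma wedge_facts:
  assumes "\<bar>Im y\<bar> < Re y"
  shows "y \<noteq> 0" "Re (y\<^sup>2) > 0" "Re (1 / y) > 0" "Re (1 / y\<^sup>2) > 0"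
proof -
  show y0: "y \<noteq> 0" using assms by auto
  have "(Im y)\<^sup>2 < (Re y)\<^sup>2"
    using assms by (metis abs_ge_zero power2_abs power_strict_mono zero_less_numeral)
  thus re2: "Re (y\<^sup>2) > 0" by (simp add: power2_eq_square)
  show "Re (1 / y) > 0" using assms by (intro Re_one_divide_pos) auto
  show "Re (1 / y\<^sup>2) > 0" by (intro Re_one_divide_pos re2)
qed

text \<open>
  The transformation law at \<open>z = 1 / (k y\<^sup>2)\<close>, multiplied by \<open>d\<tau>/dy\<close>.  The wedge condition is
  \<open>Re y\<^sup>2 > 0\<close> together with \<open>Re y > 0\<close>; the former places \<open>\<tau>\<close> in the upper half-plane.
\<close>
lemma farey_arc_integrand:
  fixes h H :: int and k n :: nat
  assumes k: "k > 0" and hH: "int k dvd h * H + 1" and y: "\<bar>Im y\<bar> < Re y"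
  shows "gf_coeff_integrand n (of_int h / of_nat k + \<i> / ((of_nat k)\<^sup>2 * y\<^sup>2)) * (- 2 * \<i> / ((of_nat k)\<^sup>2 * y ^ 3)) =
    (- \<i> * arc_weight n h k) * (bessel_integrand (pi / 12) (bessel_parameter n k) y *
      partition_gf (exp (2 * of_real pi * \<i> * ((of_int H + \<i> * of_nat k * y\<^sup>2) / of_nat k))))"
proof -
  note W = wedge_facts[OF y]
  define z where "z = 1 / (of_nat k * y\<^sup>2)"
  define G where "G = partition_gf (exp (2 * of_real pi * \<i> * ((of_int H + \<i> * of_nat k * y\<^sup>2) / of_nat k)))"
  define r where "r = complex_of_real (sqrt (real k))"
  define K where "K = complex_of_nat k"
  define \<omega> where "\<omega> = exp (of_real pi * \<i> * of_real (dedekind_sum h k))"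
  have K0: "K \<noteq> 0" and r0: "r \<noteq> 0" using k by (auto simp: K_def r_def)
  have r2: "r\<^sup>2 = K" by (simp add: r_def K_def flip: of_real_power)
  have z1: "z = (1 / y\<^sup>2) /\<^sub>R real k" by (simp add: z_def scaleR_conv_of_real divide_inverse mult.commute)
  have Rez: "Re z > 0" unfolding z1 using W(4) k by simp
  have cs: "csqrt z = 1 / (r * y)"
  proof (rule csqrt_unique)
    show "(1 / (r * y))\<^sup>2 = z" by (simp add: z_def power_divide power_mult_distrib r2 K_def)
    have "1 / (r * y) = (1 / y) /\<^sub>R sqrt (real k)"
      by (simp add: r_def scaleR_conv_of_real divide_inverse mult.commute)
    hence "Re (1 / (r * y)) > 0" using W(3) k by simp
    thus "0 < Re (1 / (r * y)) \<or> Re (1 / (r * y)) = 0 \<and> 0 \<le> Im (1 / (r * y))" by simp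
  qed
  define \<tau> where "\<tau> = of_int h / K + \<i> / (K\<^sup>2 * y\<^sup>2)"
  have tau: "\<tau> = (of_int h + \<i> * z) / of_nat k"
    using K0 W(1) by (simp add: \<tau>_def z_def K_def add_divide_distrib power2_eq_square)
  have eH: "(of_int H + \<i> / z) / of_nat k = (of_int H + \<i> * of_nat k * y\<^sup>2) / of_nat k"
    using K0 W(1) by (simp add: z_def K_def)
  have gf: "partition_gf (exp (2 * of_real pi * \<i> * \<tau>)) =
     \<omega> * (1 / (r * y)) * exp (of_real pi / (12 * K * z) - of_real pi * z / (12 * K)) * G"
    using partition_gf_modular[OF k hH Rez] unfolding tau[symmetric] G_def K_def \<omega>_def cs eH .
  have e1: "of_real pi / (12 * K * z) - of_real pi * z / (12 * K) =
      of_real pi / 12 * y\<^sup>2 - of_real pi / 12 / (K\<^sup>2 * y\<^sup>2)"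
    using K0 W(1) by (simp add: z_def K_def[symmetric] field_simps power2_eq_square)
  have e2: "- 2 * of_real pi * \<i> * of_nat n * \<tau> =
      - (2 * of_real pi * \<i> * of_nat n * of_int h / K) + 2 * of_real pi * of_nat n / (K\<^sup>2 * y\<^sup>2)"
    by (simp add: \<tau>_def algebra_simps)
  have e3: "of_real (pi / 12) * y\<^sup>2 + of_real (bessel_parameter n k) / y\<^sup>2 =
     (of_real pi / 12 * y\<^sup>2 - of_real pi / 12 / (K\<^sup>2 * y\<^sup>2)) + 2 * of_real pi * of_nat n / (K\<^sup>2 * y\<^sup>2)"
    using K0 W(1) by (simp add: bessel_parameter_def K_def field_simps)
  have bi: "bessel_integrand (pi / 12) (bessel_parameter n k) y =
     2 / y ^ 4 * (exp (of_real pi / (12 * K * z) - of_real pi * z / (12 * K)) * exp (2 * of_real pi * of_nat n / (K\<^sup>2 * y\<^sup>2)))"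
    unfolding bessel_integrand_def e3 e1 exp_add ..
  have aw: "arc_weight n h k = \<omega> * exp (- (2 * of_real pi * \<i> * of_nat n * of_int h / K)) / (K\<^sup>2 * r)"
    unfolding arc_weight_def \<omega>_def exp_add[symmetric] by (simp add: K_def r_def)
  have "gf_coeff_integrand n \<tau> * (- 2 * \<i> / (K\<^sup>2 * y ^ 3)) =
    (- \<i> * arc_weight n h k) * (bessel_integrand (pi / 12) (bessel_parameter n k) y * G)"
    unfolding gf_coeff_integrand_def gf e2 exp_add bi aw
    using K0 r0 W(1) by (simp add: divide_simps eval_nat_numeral mult_ac)
  thus ?thesis unfolding \<tau>_def K_def G_def .
qed

lemma bessel_primitive:
  obtains PG where "\<And>y. Re y > 0 \<Longrightarrow> (PG has_field_derivative bessel_integrand a b y) (at y)"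
proof -
  have op: "open {y. Re y > 0}" by (rule open_halfspace_Re_gt)
  have "bessel_integrand a b holomorphic_on {y. Re y > 0}"
    unfolding bessel_integrand_def by (intro holomorphic_intros) auto
  then obtain PG where PG: "\<And>y. y \<in> {y. Re y > 0} \<Longrightarrow> (PG has_field_derivative bessel_integrand a b y) (at y within {y. Re y > 0})"
    using holomorphic_convex_primitive'[OF convex_halfspace_Re_gt op] by metis
  show ?thesis
  proof (rule that[of PG])
    fix y :: complex assume "Re y > 0"
    thus "(PG has_field_derivative bessel_integrand a b y) (at y)"
      using PG[of y] at_within_open[OF _ op, of y] by simp
  qed
qed

text \<open>
  On the arc of \<open>h/k\<close> the main term is integrated to the left of the arc and the remainder to the
  right.  The end points satisfy \<open>1 / Re y \<le> \<surd>(3k/N)\<close> since neighbouring denominators have sum above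
  \<open>N\<close>, and every error is of the order of the third power of this quantity.
\<close>
lemma farey_arc_estimate:
  assumes n: "n \<ge> 1"
    and \<Phi>: "\<And>\<tau>. Im \<tau> > 0 \<Longrightarrow> (\<Phi> has_field_derivative gf_coeff_integrand n \<tau>) (at \<tau>)"
  obtains C where "C \<ge> 0"
    "\<And>N h k. 0 < k \<Longrightarrow> k \<le> N \<Longrightarrow> coprime h (int k) \<Longrightarrow>
       norm (farey_arc \<Phi> N h (int k) - arc_weight n h k * arc_integral n k)
         \<le> C / (real k * (real N * sqrt (real N)))"
proof -
  define a where "a = pi / 12"
  define B where "B = 2 * pi * real n"
  define I where "I = (LINT t|lborel. exp (- a * t\<^sup>2))"
  have a0: "a > 0" by (simp add: a_def)
  have I0: "I \<ge> 0" unfolding I_def by (intro Bochner_Integration.integral_nonneg) auto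
  obtain C0 where C0: "C0 > 0" "\<And>q. norm q \<le> exp (- 2 * pi) \<Longrightarrow> norm (partition_gf q - 1) \<le> C0 * norm q"
    by (rule partition_gf_minus_1_bound) blast
  define C1 where "C1 = 4 * exp (a + B) + 2 * exp (a + B) * I + 4 * C0 * exp B"
  have C1: "C1 \<ge> 0" unfolding C1_def using I0 C0 by (intro add_nonneg_nonneg mult_nonneg_nonneg) auto
  show ?thesis
  proof (rule that[of "3 * sqrt 3 * C1"])
    show "3 * sqrt 3 * C1 \<ge> 0" using C1 by simp
    fix N k :: nat and h :: int
    assume k: "0 < k" and kN: "k \<le> N" and co: "coprime h (int k)"
    define b where "b = bessel_parameter n k"
    have b0: "b \<ge> 0" using n by (simp add: b_def bessel_parameter_def)
    have bB: "b \<le> B"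
    proof -
      have "2 * pi * (real n - 1 / 24) / (real k)\<^sup>2 \<le> 2 * pi * real n / 1"
        using k n by (intro frac_le) (auto intro!: mult_left_mono)
      thus ?thesis by (simp add: b_def B_def bessel_parameter_def)
    qed
    define W0 where "W0 = - \<i> * arc_weight n h k"
    have nW0: "norm W0 = 1 / ((real k)\<^sup>2 * sqrt (real k))"
      by (simp add: W0_def norm_mult norm_arc_weight)
    have W00: "W0 \<noteq> 0" using nW0 k by auto
    obtain H where H: "int k dvd h * H + 1" using farey_next_exists[OF co, of N] k by auto
    obtain PG where PG: "\<And>y. Re y > 0 \<Longrightarrow> (PG has_field_derivative bessel_integrand a b y) (at y)"
      by (rule bessel_primitive) blast
    define T where "T = (\<lambda>y. of_int h / of_nat k + \<i> / ((of_nat k)\<^sup>2 * y\<^sup>2) :: complex)"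
    define q where "q = (\<lambda>y. exp (2 * of_real pi * \<i> * ((of_int H + \<i> * of_nat k * y\<^sup>2) / of_nat k)) :: complex)"
    define R where "R = (\<lambda>y. bessel_integrand a b y * (partition_gf (q y) - 1))"
    \<comment> \<open>a primitive of the remainder, known without integrating it\<close>
    define PR where "PR = (\<lambda>y. \<Phi> (T y) / W0 - PG y)"
    have dPR: "(PR has_field_derivative R y) (at y)" if y: "\<bar>Im y\<bar> < Re y" for y
    proof -
      note W = wedge_facts[OF y]
      have "Im (T y) = Re (1 / y\<^sup>2) / (real k)\<^sup>2"
      proof -
        have "T y = of_real (of_int h / real k) + \<i> * ((1 / y\<^sup>2) /\<^sub>R (real k)\<^sup>2)"
          by (simp add: T_def scaleR_conv_of_real divide_inverse mult_ac)
        thus ?thesis by (simp add: divide_inverse mult.commute)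
      qed
      hence ImT: "Im (T y) > 0" using W(4) k by simp
      have dT: "(T has_field_derivative (- 2 * \<i> / ((of_nat k)\<^sup>2 * y ^ 3))) (at y)"
      proof -
        have "((\<lambda>y. of_int h / of_nat k + \<i> / (of_nat k)\<^sup>2 * inverse (y\<^sup>2)) has_field_derivative
            0 + \<i> / (of_nat k)\<^sup>2 * (- (inverse (y\<^sup>2) * (2 * y) * inverse (y\<^sup>2)))) (at y)"
          using W(1) by (intro DERIV_add DERIV_const DERIV_cmult DERIV_inverse') (auto intro!: derivative_eq_intros)
        moreover have "0 + \<i> / (of_nat k)\<^sup>2 * (- (inverse (y\<^sup>2) * (2 * y) * inverse (y\<^sup>2))) = - 2 * \<i> / ((of_nat k)\<^sup>2 * y ^ 3)"
          using W(1) by (simp add: divide_simps eval_nat_numeral)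
        moreover have "(\<lambda>y. of_int h / of_nat k + \<i> / (of_nat k)\<^sup>2 * inverse (y\<^sup>2)) = T"
          by (simp add: T_def fun_eq_iff divide_inverse)
        ultimately show ?thesis by metis
      qed
      have "((\<lambda>y. \<Phi> (T y)) has_field_derivative gf_coeff_integrand n (T y) * (- 2 * \<i> / ((of_nat k)\<^sup>2 * y ^ 3))) (at y)"
        by (rule DERIV_chain2[OF \<Phi>[OF ImT] dT])
      hence d1: "((\<lambda>y. \<Phi> (T y)) has_field_derivative W0 * (bessel_integrand a b y * partition_gf (q y))) (at y)"
        using farey_arc_integrand[OF k H y, of n] by (simp only: T_def W0_def a_def b_def q_def)
      have d2: "(PG has_field_derivative bessel_integrand a b y) (at y)" by (rule PG) (use y in linarith)
      have "(PR has_field_derivative W0 * (bessel_integrand a b y * partition_gf (q y)) / W0 - bessel_integrand a b y) (at y)"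
        unfolding PR_def by (rule DERIV_diff[OF DERIV_cdivide[OF d1] d2])
      moreover have "W0 * (bessel_integrand a b y * partition_gf (q y)) / W0 - bessel_integrand a b y = R y"
        using W00 by (simp add: R_def algebra_simps)
      ultimately show ?thesis by simp
    qed
    define c where "c = 2 * C0 * exp b"
    have c0: "c \<ge> 0" using C0 by (simp add: c_def)
    have Rb: "norm (R y) \<le> c / norm y ^ 4 * exp (- Re (y\<^sup>2))" if y: "\<bar>Im y\<bar> < Re y" and re: "Re (y\<^sup>2) \<ge> 1" for y
    proof -
      define X where "X = Re (y\<^sup>2)"
      have "(norm y)\<^sup>2 \<ge> 1\<^sup>2" using re complex_Re_le_cmod[of "y\<^sup>2"] by (simp add: norm_power)
      hence ny: "norm y \<ge> 1" by (rule power2_le_imp_le) simp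
      have "2 * of_real pi * \<i> * ((of_int H + \<i> * of_nat k * y\<^sup>2) / of_nat k) =
          \<i> * of_real (2 * pi * of_int H / real k) + of_real (- 2 * pi) * y\<^sup>2"
        using k by (simp add: field_simps)
      hence "Re (2 * of_real pi * \<i> * ((of_int H + \<i> * of_nat k * y\<^sup>2) / of_nat k)) = - 2 * pi * X"
        by (simp add: X_def)
      hence nq: "norm (q y) = exp (- 2 * pi * X)" unfolding q_def norm_exp_eq_Re by simp
      have "norm (q y) \<le> exp (- 2 * pi)" unfolding nq using re by (simp add: X_def)
      hence g: "norm (partition_gf (q y) - 1) \<le> C0 * exp (- 2 * pi * X)" using C0(2) nq by metis
      have "norm (R y) \<le> (2 / norm y ^ 4 * (exp b * exp (a * X))) * (C0 * exp (- 2 * pi * X))"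
        unfolding R_def norm_mult X_def
        by (intro mult_mono norm_bessel_integrand_le b0 ny g[unfolded X_def]) auto
      also have "\<dots> = c / norm y ^ 4 * exp (a * X - 2 * pi * X)"
        by (simp add: c_def exp_diff exp_minus field_simps)
      also have "\<dots> \<le> c / norm y ^ 4 * exp (- X)"
      proof -
        have "1 * X \<le> (2 * pi - pi / 12) * X" using pi_gt3 re by (intro mult_right_mono) (auto simp: X_def)
        hence "a * X - 2 * pi * X \<le> - X" by (simp add: a_def algebra_simps)
        thus ?thesis using c0 by (intro mult_left_mono) auto
      qed
      finally show ?thesis unfolding X_def .
    qed
    define k1 where "k1 = farey_next N (- h) (int k)"
    define k2 where "k2 = farey_next N h (int k)"
    have k12: "int N - int k < k1" "int N - int k < k2"
      using farey_next_props[of "- h" "int k" N] farey_next_props[of h "int k" N] co k by (auto simp: k1_def k2_def)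
    have k12pos: "k1 > 0" "k2 > 0" using k12 kN by auto
    define s1 where "s1 = - (of_int k1 / real k)"
    define s2 where "s2 = of_int k2 / real k"
    define y1 where "y1 = csqrt (vline s1)"
    define y2 where "y2 = csqrt (vline s2)"
    note Y1 = csqrt_one_plus_ii[of s1, folded y1_def]
    note Y2 = csqrt_one_plus_ii[of s2, folded y2_def]
    have tang: "T y = farey_tangency h (int k) m" if "y\<^sup>2 = vline (of_int m / real k)" for y m
    proof -
      have "(of_nat k)\<^sup>2 * y\<^sup>2 = of_nat k * (of_nat k + \<i> * of_int m)"
        unfolding that using k by (simp add: field_simps power2_eq_square)
      thus ?thesis unfolding T_def farey_tangency_def by simp
    qed
    have T1: "T y1 = farey_tangency h (int k) (- k1)" using Y1(3) by (intro tang) (simp add: s1_def)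
    have T2: "T y2 = farey_tangency h (int k) k2" using Y2(3) by (intro tang) (simp add: s2_def)
    have "farey_arc \<Phi> N h (int k) = \<Phi> (T y2) - \<Phi> (T y1)"
      unfolding farey_arc_def T1 T2 k1_def k2_def ..
    also have "\<dots> = W0 * ((PG y2 - PG y1) + (PR y2 - PR y1))"
      using W00 by (simp add: PR_def field_simps)
    finally have arc: "farey_arc \<Phi> N h (int k) = W0 * ((PG y2 - PG y1) + (PR y2 - PR y1))" .
    \<comment> \<open>an upper bound for \<open>1 / Re y\<close> at both end points\<close>
    define \<rho> where "\<rho> = sqrt (3 * real k / real N)"
    have N0: "N > 0" using k kN by simp
    have \<rho>0: "\<rho> > 0" using k N0 by (simp add: \<rho>_def)
    have size: "1 / p ^ 3 \<le> \<rho> ^ 3" if p: "p \<ge> 1" "(1 + \<bar>s\<bar>) / 3 \<le> p\<^sup>2" and s: "\<bar>s\<bar> = of_int m / real k" "int N - int k < m" for p s :: real and m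
    proof -
      have "real N \<le> real k + of_int m" using s(2) by linarith
      hence "real N / real k \<le> (real k + of_int m) / real k" by (intro divide_right_mono) auto
      also have "\<dots> = 1 + \<bar>s\<bar>" using s(1) k by (simp add: add_divide_distrib)
      also have "\<dots> \<le> 3 * p\<^sup>2" using p(2) by simp
      finally have "real N / real k \<le> 3 * p\<^sup>2" .
      hence "1 / p\<^sup>2 \<le> 3 * real k / real N" using k N0 p(1) by (simp add: field_simps)
      hence "sqrt (1 / p\<^sup>2) \<le> \<rho>" unfolding \<rho>_def by (rule real_sqrt_le_mono)
      hence "1 / p \<le> \<rho>" using p(1) by (simp add: real_sqrt_divide)
      hence "(1 / p) ^ 3 \<le> \<rho> ^ 3" using p(1) by (intro power_mono) auto
      thus ?thesis by (simp add: power_divide)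
    qed
    have sz1: "1 / (Re y1) ^ 3 \<le> \<rho> ^ 3" using k12pos k12 by (intro size[OF Y1(1) Y1(5), of k1]) (auto simp: s1_def)
    have sz2: "1 / (Re y2) ^ 3 \<le> \<rho> ^ 3" using k12pos k12 by (intro size[OF Y2(1) Y2(5), of k2]) (auto simp: s2_def)
    have four: "1 / p ^ 4 \<le> 1 / p ^ 3" if "p \<ge> 1" for p :: real
      using that by (intro frac_le) (auto simp: power_increasing)
    have E: "exp (a + b) \<le> exp (a + B)" using bB by simp
    have scale: "u / p ^ j \<le> u' * \<rho> ^ 3" if "1 / p ^ j \<le> \<rho> ^ 3" "0 \<le> u" "u \<le> u'" for u u' p j
    proof -
      have "u * (1 / p ^ j) \<le> u * \<rho> ^ 3" using that by (intro mult_left_mono) auto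
      also have "\<dots> \<le> u' * \<rho> ^ 3" using that \<rho>0 by (intro mult_right_mono) auto
      finally show ?thesis by simp
    qed
    let ?L = "\<lambda>y. PG (vline (Im y))"
    have h1: "norm (PG y1 - ?L y1) \<le> 2 * exp (a + B) * \<rho> ^ 3"
      by (rule order_trans[OF horizontal_estimate[OF less_imp_le[OF a0] b0 PG, of s1, folded y1_def] scale[OF sz1]]) (use E in auto)
    have h2: "norm (PG y2 - ?L y2) \<le> 2 * exp (a + B) * \<rho> ^ 3"
      by (rule order_trans[OF horizontal_estimate[OF less_imp_le[OF a0] b0 PG, of s2, folded y2_def] scale[OF sz2]]) (use E in auto)
    have im: "Im y1 \<le> 0" "Im y2 \<ge> 0"
    proof -
      have "Im (y1\<^sup>2) \<le> 0" "Im (y2\<^sup>2) \<ge> 0" unfolding Y1(3) Y2(3) using k12pos by (auto simp: s1_def s2_def)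
      hence "Re y1 * Im y1 \<le> 0" "Re y2 * Im y2 \<ge> 0" by (simp_all add: power2_eq_square mult.commute)
      thus "Im y1 \<le> 0" "Im y2 \<ge> 0" using Y1(1) Y2(1) by (auto simp: mult_le_0_iff zero_le_mult_iff)
    qed
    define P where "P = min (Re y1) (Re y2)"
    have P1: "P \<ge> 1" using Y1(1) Y2(1) by (simp add: P_def)
    have szP: "1 / P ^ 4 \<le> \<rho> ^ 3"
    proof -
      have "P = Re y1 \<or> P = Re y2" unfolding P_def by linarith
      hence "1 / P ^ 3 \<le> \<rho> ^ 3" using sz1 sz2 by metis
      thus ?thesis using four[OF P1] by linarith
    qed
    have v: "norm (?L y2 - ?L y1 - \<i> * bessel_integral a b) \<le> 2 * exp (a + B) * I * \<rho> ^ 3"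
    proof -
      have Psq: "P\<^sup>2 \<le> (Re y1)\<^sup>2" "P\<^sup>2 \<le> (Re y2)\<^sup>2" using P1 by (auto simp: P_def intro!: power_mono)
      have "norm (?L y2 - PG (vline (- (- Im y1))) - \<i> * bessel_integral a b)
           \<le> 2 * exp (a + b) / (P\<^sup>2)\<^sup>2 * I"
        unfolding I_def
        by (rule vertical_estimate[OF a0 b0 _ _ _ _ _ PG]) (use im P1 Psq Y1(2) Y2(2) in auto)
      also have "2 * exp (a + b) / (P\<^sup>2)\<^sup>2 * I = (2 * exp (a + b) * I) / P ^ 4" by simp
      also have "\<dots> \<le> 2 * exp (a + B) * I * \<rho> ^ 3"
        by (rule scale[OF szP]) (use E I0 in \<open>auto intro!: mult_right_mono\<close>)
      finally show ?thesis by simp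
    qed
    have r: "norm (PR y2 - PR y1) \<le> 4 * C0 * exp B * \<rho> ^ 3"
    proof -
      have "norm (PR y2 - PR y1) \<le> c / (Re y1) ^ 4 + c / (Re y2) ^ 4"
        unfolding y1_def y2_def by (rule remainder_estimate[OF c0 dPR Rb])
      also have "\<dots> \<le> (2 * C0 * exp B) * \<rho> ^ 3 + (2 * C0 * exp B) * \<rho> ^ 3"
      proof (rule add_mono)
        have cB: "c \<le> 2 * C0 * exp B" unfolding c_def using bB C0 by (intro mult_left_mono) auto
        show "c / (Re y1) ^ 4 \<le> (2 * C0 * exp B) * \<rho> ^ 3"
          using order_trans[OF four[OF Y1(1)] sz1] c0 cB by (rule scale)
        show "c / (Re y2) ^ 4 \<le> (2 * C0 * exp B) * \<rho> ^ 3"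
          using order_trans[OF four[OF Y2(1)] sz2] c0 cB by (rule scale)
      qed
      finally show ?thesis by simp
    qed
    define D where "D = (PG y2 - PG y1) + (PR y2 - PR y1) - \<i> * bessel_integral a b"
    have nD: "norm D \<le> C1 * \<rho> ^ 3"
    proof -
      have tri: "norm (A - A' + V + R') \<le> norm A + norm A' + norm V + norm R'" for A A' V R' :: complex
        using norm_triangle_ineq[of "A - A' + V" R'] norm_triangle_ineq[of "A - A'" V] norm_triangle_ineq4[of A A'] by linarith
      have Deq: "D = (PG y2 - ?L y2) - (PG y1 - ?L y1)
          + (?L y2 - ?L y1 - \<i> * bessel_integral a b) + (PR y2 - PR y1)"
        by (simp add: D_def)
      have "norm D \<le> norm (PG y2 - ?L y2) + norm (PG y1 - ?L y1)
          + norm (?L y2 - ?L y1 - \<i> * bessel_integral a b) + norm (PR y2 - PR y1)"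
        unfolding Deq by (rule tri)
      also have "\<dots> \<le> 2 * exp (a + B) * \<rho> ^ 3 + 2 * exp (a + B) * \<rho> ^ 3 + 2 * exp (a + B) * I * \<rho> ^ 3 + 4 * C0 * exp B * \<rho> ^ 3"
        by (intro add_mono h1 h2 v r)
      also have "\<dots> = C1 * \<rho> ^ 3" by (simp add: C1_def algebra_simps)
      finally show ?thesis .
    qed
    have "farey_arc \<Phi> N h (int k) - arc_weight n h k * bessel_integral a b = W0 * D"
      unfolding arc D_def W0_def by (simp add: algebra_simps)
    hence "norm (farey_arc \<Phi> N h (int k) - arc_weight n h k * bessel_integral a b) \<le> 1 / ((real k)\<^sup>2 * sqrt (real k)) * (C1 * \<rho> ^ 3)"
      using nD by (simp add: norm_mult nW0 mult_left_mono divide_right_mono)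
    also have "\<rho> ^ 3 = 3 * sqrt 3 * (real k * sqrt (real k)) / (real N * sqrt (real N))"
    proof -
      have "\<rho> ^ 3 = \<rho>\<^sup>2 * \<rho>" by (simp add: eval_nat_numeral)
      also have "\<rho>\<^sup>2 = 3 * real k / real N" by (simp add: \<rho>_def)
      finally show ?thesis by (simp add: \<rho>_def real_sqrt_divide real_sqrt_mult)
    qed
    also have "1 / ((real k)\<^sup>2 * sqrt (real k)) * (C1 * (3 * sqrt 3 * (real k * sqrt (real k)) / (real N * sqrt (real N)))) =
       3 * sqrt 3 * C1 / (real k * (real N * sqrt (real N)))"
      using k by (simp add: power2_eq_square)
    finally show "norm (farey_arc \<Phi> N h (int k) - arc_weight n h k * arc_integral n k)
         \<le> 3 * sqrt 3 * C1 / (real k * (real N * sqrt (real N)))"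
      unfolding a_def b_def .
  qed
qed

text \<open>
  There are at most \<open>k\<close> arcs with denominator \<open>k\<close>, so the errors add up to \<open>O(N\<^bsup>-1/2\<^esup>)\<close>.
\<close>
lemma partial_sums_tendsto:
  assumes n: "n \<ge> 1"
  shows "(\<lambda>N. \<Sum>k=1..N. \<Sum>h\<in>{h::nat. 1 \<le> h \<and> h \<le> k \<and> coprime h k}.
            arc_weight n (int h) k * arc_integral n k) \<longlonglongrightarrow> of_nat (num_partitions n)"
proof -
  obtain \<Phi> where \<Phi>: "\<And>\<tau>. \<Phi> (\<tau> + 1) - \<Phi> \<tau> = of_nat (num_partitions n)"
    "\<And>\<tau>. Im \<tau> > 0 \<Longrightarrow> (\<Phi> has_field_derivative gf_coeff_integrand n \<tau>) (at \<tau>)"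
    by (rule gf_coeff_primitive) blast
  obtain C where C: "C \<ge> 0"
    "\<And>N h k. 0 < k \<Longrightarrow> k \<le> N \<Longrightarrow> coprime h (int k) \<Longrightarrow>
       norm (farey_arc \<Phi> N h (int k) - arc_weight n h k * arc_integral n k)
         \<le> C / (real k * (real N * sqrt (real N)))"
    by (rule farey_arc_estimate[OF n \<Phi>(2)]) blast+
  let ?C = "\<lambda>k. {h::nat. 1 \<le> h \<and> h \<le> k \<and> coprime h k}"
  let ?w = "\<lambda>h k. arc_weight n (int h) k * arc_integral n k"
  let ?E = "\<lambda>k N. C / (real k * (real N * sqrt (real N)))"
  let ?a = "\<lambda>N h k. farey_arc \<Phi> N (int h) (int k)"
  let ?S = "\<lambda>N. \<Sum>k=1..N. \<Sum>h\<in>?C k. ?w h k"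
  have "norm (?S N - of_nat (num_partitions n)) \<le> C / sqrt (real N)" if N: "N > 0" for N
  proof -
    have eq: "of_nat (num_partitions n) = (\<Sum>k=1..N. \<Sum>h\<in>?C k. ?a N h k)"
      unfolding farey_dissection[OF N] \<Phi>(1) ..
    have "norm (\<Sum>k=1..N. \<Sum>h\<in>?C k. ?w h k - ?a N h k) \<le> (\<Sum>k=1..N. ?E 1 N)"
    proof (rule sum_norm_le)
      fix k assume k: "k \<in> {1..N}"
      have "norm (\<Sum>h\<in>?C k. ?w h k - ?a N h k) \<le> (\<Sum>h\<in>?C k. ?E k N)"
      proof (rule sum_norm_le)
        fix h assume "h \<in> ?C k"
        hence "coprime (int h) (int k)" by simp
        from C(2)[OF _ _ this] k show "norm (?w h k - ?a N h k) \<le> ?E k N"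
          by (simp add: norm_minus_commute)
      qed
      also have "\<dots> = real (card (?C k)) * (?E k N)" by simp
      also have "\<dots> \<le> real k * (?E k N)"
      proof (rule mult_right_mono)
        have "card (?C k) \<le> card {1..k}" by (rule card_mono) auto
        thus "real (card (?C k)) \<le> real k" by simp
      qed (use C in simp)
      also have "\<dots> = ?E 1 N" using k by simp
      finally show "norm (\<Sum>h\<in>?C k. ?w h k - ?a N h k) \<le> ?E 1 N" .
    qed
    moreover have "(\<Sum>k=1..N. ?E 1 N) = C / sqrt (real N)" using N by simp
    ultimately show ?thesis unfolding eq by (simp only: sum_subtractf)
  qed
  hence "eventually (\<lambda>N. norm (?S N - of_nat (num_partitions n)) \<le> C / sqrt (real N)) sequentially"
    by (intro eventually_mono[OF eventually_gt_at_top[of 0]]) blast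
  moreover have "(\<lambda>N. C / sqrt (real N)) \<longlonglongrightarrow> 0" by real_asymp
  ultimately have "(\<lambda>N. ?S N - of_nat (num_partitions n)) \<longlonglongrightarrow> 0" by (rule Lim_null_comparison)
  thus ?thesis by (simp only: LIM_zero_iff)
qed

text \<open>
  The chain rule for \<open>b = 2\<pi>(x - 1/24)/k\<^sup>2\<close>.
\<close>
lemma rademacher_derivative:
  assumes n: "n \<ge> 1" and k: "k > 0"
  shows "complex_of_real (1 / (pi * sqrt 2) * sqrt (real k) *
     deriv (\<lambda>x::real. sinh (pi / real k * sqrt (2 / 3 * (x - 1 / 24))) / sqrt (x - 1 / 24)) (real n)) =
     arc_integral n k / of_real ((real k)\<^sup>2 * sqrt (real k))"
proof -
  define b where "b = bessel_parameter n k"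
  have b0: "b > 0" using n k by (simp add: b_def bessel_parameter_def)
  obtain K where K: "bessel_integral (pi / 12) b = of_real K"
    "((\<lambda>b. 2 * sqrt pi * sinh (2 * sqrt (pi / 12 * b)) / sqrt b) has_real_derivative K) (at b)"
    using bessel_integral_derivative[of "pi / 12" b] b0 by auto
  let ?f = "\<lambda>x::real. sinh (pi / real k * sqrt (2 / 3 * (x - 1 / 24))) / sqrt (x - 1 / 24)"
  let ?S = "\<lambda>b. 2 * sqrt pi * sinh (2 * sqrt (pi / 12 * b)) / sqrt b"
  define \<beta> where "\<beta> = (\<lambda>x. 2 * pi / (real k)\<^sup>2 * (x - 1 / 24))"
  have bn: "\<beta> (real n) = b" by (simp add: \<beta>_def b_def bessel_parameter_def)
  have "(\<beta> has_real_derivative 2 * pi / (real k)\<^sup>2 * (1 - 0)) (at (real n))"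
    unfolding \<beta>_def by (intro DERIV_cmult DERIV_diff DERIV_ident DERIV_const)
  from DERIV_chain2[OF K(2)[folded bn] this]
  have D: "((\<lambda>x. ?S (\<beta> x) / (sqrt 2 * real k)) has_real_derivative K * (2 * pi / (real k)\<^sup>2 * (1 - 0)) / (sqrt 2 * real k)) (at (real n))"
    by (rule DERIV_cdivide)
  have eq: "?S (\<beta> x) / (sqrt 2 * real k) = ?f x" if x: "x > 1 / 24" for x
  proof -
    define u where "u = sqrt (x - 1 / 24)"
    have u: "u > 0" using x by (simp add: u_def)
    have sb: "sqrt (\<beta> x) = sqrt 2 * sqrt pi / real k * u"
      using k by (simp add: \<beta>_def u_def real_sqrt_mult real_sqrt_divide)
    have "2 * sqrt (pi / 12 * \<beta> x) = pi / real k * sqrt (2 / 3 * (x - 1 / 24))"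
    proof -
      have "2 * sqrt (pi / 12 * \<beta> x) = sqrt (4 * (pi / 12 * \<beta> x))"
        by (simp only: real_sqrt_mult real_sqrt_four)
      also have "4 * (pi / 12 * \<beta> x) = (pi / real k)\<^sup>2 * (2 / 3 * (x - 1 / 24))"
      proof -
        have "4 * (pi / 12 * (2 * pi / (real k)\<^sup>2 * w)) = (pi / real k)\<^sup>2 * (2 / 3 * w)" for w
          using k by (simp add: power2_eq_square field_simps)
        thus ?thesis unfolding \<beta>_def .
      qed
      also have "sqrt \<dots> = pi / real k * sqrt (2 / 3 * (x - 1 / 24))"
        by (simp only: real_sqrt_mult real_sqrt_abs) simp
      finally show ?thesis .
    qed
    hence "?S (\<beta> x) / (sqrt 2 * real k) = 2 * sqrt pi * sinh (pi / real k * sqrt (2 / 3 * (x - 1 / 24))) / (sqrt 2 * sqrt pi / real k * u) / (sqrt 2 * real k)"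
      by (simp only: sb)
    also have "\<dots> = sinh (pi / real k * sqrt (2 / 3 * (x - 1 / 24))) / u"
      using u k by (simp add: field_simps)
    finally show ?thesis unfolding u_def .
  qed
  have n24: "real n > 1 / 24" using n by simp
  hence "eventually (\<lambda>x. x \<in> {1/24<..}) (nhds (real n))"
    by (intro eventually_nhds_in_open) auto
  hence "eventually (\<lambda>x. ?S (\<beta> x) / (sqrt 2 * real k) = ?f x) (nhds (real n))"
    by eventually_elim (use eq in simp)
  from DERIV_cong_ev[OF refl this refl] D
  have "(?f has_real_derivative K * (2 * pi / (real k)\<^sup>2 * (1 - 0)) / (sqrt 2 * real k)) (at (real n))" by blast
  hence d: "deriv ?f (real n) = K * (2 * pi / (real k)\<^sup>2) / (sqrt 2 * real k)" by (simp add: DERIV_imp_deriv)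
  have "1 / (pi * sqrt 2) * sqrt (real k) * deriv ?f (real n) = K / ((real k)\<^sup>2 * sqrt (real k))"
  proof -
    define r where "r = sqrt (real k)"
    have r: "r > 0" "real k = r * r" using k by (auto simp: r_def)
    show ?thesis unfolding d r_def[symmetric] unfolding r(2)
      using r(1) by (simp add: field_simps power2_eq_square)
  qed
  thus ?thesis unfolding b_def[symmetric] K(1) by (simp only: of_real_divide)
qed

theorem theorem1p1:
  fixes n :: nat
  assumes "n \<ge> 1"
  shows "(\<lambda>m. let k = Suc m in
            of_real (1 / (pi * sqrt 2)) * A_sum k n * of_real (sqrt (real k)) *
            of_real (deriv (\<lambda>x::real. sinh (pi / real k * sqrt (2 / 3 * (x - 1 / 24)))
                                      / sqrt (x - 1 / 24)) (real n)))
         sums (of_nat (num_partitions n) :: complex)"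
proof -
  let ?C = "\<lambda>k. {h::nat. 1 \<le> h \<and> h \<le> k \<and> coprime h k}"
  let ?w = "\<lambda>k. \<Sum>h\<in>?C k. arc_weight n (int h) k * arc_integral n k"
  let ?d = "\<lambda>k. deriv (\<lambda>x::real. sinh (pi / real k * sqrt (2 / 3 * (x - 1 / 24))) / sqrt (x - 1 / 24)) (real n)"
  have summand: "of_real (1 / (pi * sqrt 2)) * A_sum k n * of_real (sqrt (real k)) * of_real (?d k) = ?w k" if k: "k > 0" for k
  proof -
    define R where "R = complex_of_real ((real k)\<^sup>2 * sqrt (real k))"
    have R0: "R \<noteq> 0" using k by (simp add: R_def)
    hence A: "A_sum k n = (\<Sum>h\<in>?C k. arc_weight n (int h) k * R)"
      unfolding A_sum_def arc_weight_def R_def[symmetric] by simp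
    have "of_real (1 / (pi * sqrt 2)) * A_sum k n * of_real (sqrt (real k)) * of_real (?d k) =
       A_sum k n * complex_of_real (1 / (pi * sqrt 2) * sqrt (real k) * ?d k)"
      by (simp only: of_real_mult mult_ac)
    also have "\<dots> = A_sum k n * (arc_integral n k / R)"
      unfolding rademacher_derivative[OF assms k] R_def ..
    also have "\<dots> = ?w k"
      unfolding A sum_distrib_right using R0 by (intro sum.cong refl) simp
    finally show ?thesis .
  qed
  have "(\<lambda>N. \<Sum>m<N. ?w (Suc m)) \<longlonglongrightarrow> of_nat (num_partitions n)"
  proof -
    have "(\<Sum>m<N. ?w (Suc m)) = (\<Sum>k=1..N. ?w k)" for N
      by (rule sum.reindex_bij_witness[of _ "\<lambda>k. k - 1" Suc]) auto
    thus ?thesis using partial_sums_tendsto[OF assms] by simp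
  qed
  thus ?thesis unfolding sums_def Let_def summand[OF zero_less_Suc] .
qed

end
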